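(* For all integers $k\ge1$ and all $j_1,\dots,j_k\in V_\infty$, the sequence $$M^{(n)}_{j_1,\dots,j_k}=\prod_{l=1}^k e^{u^{(n)}_{j_l}}\big(1+\mathrm{i}\,s^{(n)}_{j_l}\big),\qquad n\in\mathbb{N},$$ (with $\mathrm{i}=\sqrt{-1}$), its real part and its imaginary part are martingales under $\mu^W_\infty$ with respect to the filtration $\big(\mathcal{F}_n=\sigma(\boldsymbol{\beta}^{(n)},\boldsymbol{\theta}^{(n)})\big)_{n\in\mathbb{N}}$.
   Context: Finite-volume model. Let $\tilde G=(\tilde V,\tilde E)$ be a finite connected undirected graph without loops or parallel edges, $\delta\in\tilde V$ a distinguished vertex, $V=\tilde V\setminus\{\delta\}$, with weights $W_{ij}=W_{ji}>0$ if $i\sim j$ and $W_{ij}=0$ otherwise. Let $\Omega_V=\{(u,s)\in\mathbb{R}^{\tilde V}\times\mathbb{R}^{\tilde V}:u_\delta=s_\delta=0\}$. Let $A^W(u)\in\mathbb{R}^{\tilde V\times\tilde V}$ have entries $-W_{ij}e^{u_i+u_j}$ for $i\neq j$ and $\sum_{k\in\tilde V}W_{ik}e^{u_i+u_k}$ for $i=j$, and let $A^W_{VV}(u)$ be its restriction to $V\times V$. The probability measure $\mu^W$ on $\Omega_V$ is $$\mu^W(du\,ds)=\det A^W_{VV}(u)\prod_{(i\sim j)\in\tilde E}e^{-W_{ij}[\cosh(u_i-u_j)-1+\frac12(s_i-s_j)^2e^{u_i+u_j}]}\prod_{i\in V}\frac{e^{-u_i}}{2\pi}du_i\,ds_i .$$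 For $i\in V$: $\beta_i^{V}(u)=\frac12\sum_{j\in\tilde V}W_{ij}e^{u_j-u_i}$, $\theta^{V}_i(u,s)=\sum_{j\in\tilde V}W_{ij}e^{u_j}(s_i-s_j)$, i.e. $\theta^V=\mathrm{diag}(e^{-u_i})_{i\in V}A^W_{VV}(u)s_V$. It is known that $u$ is a measurable function of $\beta^V$: there is a measurable $f_V^W:\mathbb{R}^V\to\mathbb{R}^{\tilde V}$ with $u=f_V^W(\beta^V(u))$ for all $u\in\mathbb{R}^{\tilde V}$ with $u_\delta=0$. Consequently $s=g_V^W(\beta^V,\theta^V)$, where $g_V^W:\mathbb{R}^V\times\mathbb{R}^V\to\mathbb{R}^{\tilde V}$ is the measurable function with $g_V^W(\beta,\theta)=s$ given by $s_\delta=0$, $s_V=A^W_{VV}(u)^{-1}\mathrm{diag}(e^{u_i})_{i\in V}\,\theta$ with $u=f_V^W(\beta)$. Infinite graph and wired approximation. $G_\infty=(V_\infty,E_\infty)$ is an infinite undirected graph with edge weights $W_{ij}=W_{ji}>0$ for $i\sim j$ and $W_{ij}=0$ otherwise. It is approximated by finite graphs $\tilde G_n=(\tilde V_n,\tilde E_n)$, $\tilde V_n=V_n\cup\{\delta_n\}$, with $V_n\subseteq V_{n+1}$ finite subsets of $V_\infty$, $\bigcup_nV_n=V_\infty$, and $\tilde E_n=E_n\cup\{(i\sim\delta_n):i\in V_n,\ \exists j\in V_\infty\setminus V_n:(i\sim j)\in E_\infty\}$, where $E_n$ is the set of edges in $E_\infty$ with both endpoints in $V_n$. Weights on $\tilde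 G_n$: $W^{(n)}_{ij}=W_{ij}$ for $i,j\in V_n$; $W^{(n)}_{i\delta_n}=W^{(n)}_{\delta_ni}=\sum_{j\in V_\infty\setminus V_n}W_{ij}$ for $i\in V_n$; $W^{(n)}_{\delta_n\delta_n}=0$. It is assumed that these sums are finite and that each $\tilde G_n$ satisfies the assumptions on finite graphs above. $\mu_n^W$ denotes the measure above for $\tilde G_n$ with distinguished vertex $\delta_n$ and weights $W^{(n)}$; $\beta^{V_n},\theta^{V_n}$ are the corresponding variables and $f^W_{V_n},g^W_{V_n}$ the corresponding functions. Infinite volume coupling. The laws of $(\beta^{V_n},\theta^{V_n})$ under $\mu^W_n$, $n\in\mathbb{N}$, are consistent, so by Kolmogorov's theorem there is a probability space $(\Omega_\infty,\mathcal{F}_\infty,\mu^W_\infty)$ with real random variables $\boldsymbol{\beta}_i,\boldsymbol{\theta}_i$, $i\in V_\infty$, such that for every $n$ the law of $(\boldsymbol{\beta}^{(n)},\boldsymbol{\theta}^{(n)})=((\boldsymbol{\beta}_i)_{i\in V_n},(\boldsymbol{\theta}_i)_{i\in V_n})$ under $\mu_\infty^W$ equals the law of $(\beta^{V_n},\theta^{V_n})$ under $\mu^W_n$. Set $u^{(n)}=f^W_{V_n}(\boldsymbol{\beta}^{(n)})$ and $s^{(n)}=g^W_{V_n}(\boldsymbol{\beta}^{(n)},\boldsymbol{\theta}^{(n)})$ (indexed by $\tilde V_n$), and $u^{(n)}_i=s^{(n)}_i=0$ for $i\in V_\infty\setminus V_n$. *)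

theory Defs
  imports "HOL-Probability.Probability"
begin

section \<open>Matrices indexed by a finite subset of a type\<close>

text \<open>The vertex set of the finite graph varies with \<open>n\<close>, so its matrices cannot be typed as
  \<open>real ^ 'n ^ 'n\<close>. The two notions below are the library definitions of \<open>det\<close> and
  \<open>matrix_inv\<close> with \<open>UNIV\<close> replaced by the index set.\<close>

definition det_on :: "'v set \<Rightarrow> ('v \<Rightarrow> 'v \<Rightarrow> real) \<Rightarrow> real" where
  "det_on I A = (\<Sum>p | p permutes I. of_int (sign p) * (\<Prod>i\<in>I. A i (p i)))"

definition matrix_inv_on :: "'v set \<Rightarrow> ('v \<Rightarrow> 'v \<Rightarrow> real) \<Rightarrow> ('v \<Rightarrow> 'v \<Rightarrow> real)" where
  "matrix_inv_on I A = (SOME B. \<forall>i\<in>I. \<forall>j\<in>I.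
     (\<Sum>k\<in>I. A i k * B k j) = (if i = j then 1 else 0) \<and>
     (\<Sum>k\<in>I. B i k * A k j) = (if i = j then 1 else 0))"


section \<open>Finite-volume model\<close>

text \<open>A finite graph is given by the set \<open>V\<close> of its vertices other than the distinguished
  vertex \<open>\<delta>\<close>, so its vertex set is \<open>insert \<delta> V\<close>; edges are two-element sets.\<close>

definition finite_weighted_graph ::
    "'v set \<Rightarrow> 'v \<Rightarrow> 'v set set \<Rightarrow> ('v \<Rightarrow> 'v \<Rightarrow> real) \<Rightarrow> bool" where
  "finite_weighted_graph V \<delta> E W \<longleftrightarrow>
     finite V \<and> \<delta> \<notin> V \<and>
     (\<forall>e\<in>E. e \<subseteq> insert \<delta> V \<and> card e = 2) \<and>
     (\<forall>i\<in>insert \<delta> V. \<forall>j\<in>insert \<delta> V. (i, j) \<in> {(a, b). {a, b} \<in> E}\<^sup>*) \<and>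
     (\<forall>i\<in>insert \<delta> V. \<forall>j\<in>insert \<delta> V.
        W i j = W j i \<and> ({i, j} \<in> E \<longrightarrow> W i j > 0) \<and> ({i, j} \<notin> E \<longrightarrow> W i j = 0))"

text \<open>The \<open>\<sigma>\<close>-algebra of \<open>\<real>\<^sup>I\<close>; its elements are functions that are \<open>undefined\<close> off \<open>I\<close>.\<close>

abbreviation RV :: "'v set \<Rightarrow> ('v \<Rightarrow> real) measure" where
  "RV I \<equiv> \<Pi>\<^sub>M i\<in>I. borel"

definition Omega :: "'v set \<Rightarrow> 'v \<Rightarrow> (('v \<Rightarrow> real) \<times> ('v \<Rightarrow> real)) set" where
  "Omega V \<delta> = {(u, s). u \<in> insert \<delta> V \<rightarrow>\<^sub>E UNIV \<and> s \<in> insert \<delta> V \<rightarrow>\<^sub>E UNIV \<and> u \<delta> = 0 \<and> s \<delta> = 0}"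

definition Omega_borel :: "'v set \<Rightarrow> 'v \<Rightarrow> (('v \<Rightarrow> real) \<times> ('v \<Rightarrow> real)) measure" where
  "Omega_borel V \<delta> = restrict_space (RV (insert \<delta> V) \<Otimes>\<^sub>M RV (insert \<delta> V)) (Omega V \<delta>)"

definition A_mat ::
    "'v set \<Rightarrow> 'v \<Rightarrow> ('v \<Rightarrow> 'v \<Rightarrow> real) \<Rightarrow> ('v \<Rightarrow> real) \<Rightarrow> 'v \<Rightarrow> 'v \<Rightarrow> real" where
  "A_mat V \<delta> W u i j =
     (if i = j then (\<Sum>k\<in>insert \<delta> V. W i k * exp (u i + u k)) else - W i j * exp (u i + u j))"

text \<open>The value at an unordered pair \<open>{i, j}\<close> of a function that is symmetric in \<open>i\<close> and \<open>j\<close>.\<close>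

definition edge_value :: "('v \<Rightarrow> 'v \<Rightarrow> real) \<Rightarrow> 'v set \<Rightarrow> real" where
  "edge_value h e = (THE x. \<exists>i j. e = {i, j} \<and> x = h i j)"

lemma edge_value_doubleton: "h i j = h j i \<Longrightarrow> edge_value h {i, j} = h i j"
  unfolding edge_value_def by (rule the_equality) (auto simp: doubleton_eq_iff)

definition mu_density ::
    "'v set \<Rightarrow> 'v \<Rightarrow> 'v set set \<Rightarrow> ('v \<Rightarrow> 'v \<Rightarrow> real) \<Rightarrow> ('v \<Rightarrow> real) \<Rightarrow> ('v \<Rightarrow> real) \<Rightarrow> real" where
  "mu_density V \<delta> E W u s =
     det_on V (A_mat V \<delta> W u) *
     (\<Prod>e\<in>E. edge_value (\<lambda>i j.
        exp (- W i j * (cosh (u i - u j) - 1 + 1 / 2 * (s i - s j)\<^sup>2 * exp (u i + u j)))) e) *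
     (\<Prod>i\<in>V. exp (- u i) / (2 * pi))"

text \<open>The reference measure on \<^term>\<open>Omega V \<delta>\<close> is Lebesgue measure \<open>\<Prod>\<^sub>i du\<^sub>i ds\<^sub>i\<close> in the
  coordinates \<open>i \<in> V\<close>, transported by setting the \<open>\<delta>\<close>-coordinates to 0.\<close>

definition mu ::
    "'v set \<Rightarrow> 'v \<Rightarrow> 'v set set \<Rightarrow> ('v \<Rightarrow> 'v \<Rightarrow> real) \<Rightarrow> (('v \<Rightarrow> real) \<times> ('v \<Rightarrow> real)) measure" where
  "mu V \<delta> E W =
     density
       (distr ((\<Pi>\<^sub>M i\<in>V. lborel) \<Otimes>\<^sub>M (\<Pi>\<^sub>M i\<in>V. lborel)) (Omega_borel V \<delta>)
          (\<lambda>(u, s). (u(\<delta> := 0), s(\<delta> := 0))))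
       (\<lambda>(u, s). ennreal (mu_density V \<delta> E W u s))"

definition beta_of ::
    "'v set \<Rightarrow> 'v \<Rightarrow> ('v \<Rightarrow> 'v \<Rightarrow> real) \<Rightarrow> ('v \<Rightarrow> real) \<Rightarrow> ('v \<Rightarrow> real)" where
  "beta_of V \<delta> W u = (\<lambda>i\<in>V. 1 / 2 * (\<Sum>j\<in>insert \<delta> V. W i j * exp (u j - u i)))"

definition theta_of ::
    "'v set \<Rightarrow> 'v \<Rightarrow> ('v \<Rightarrow> 'v \<Rightarrow> real) \<Rightarrow> ('v \<Rightarrow> real) \<Rightarrow> ('v \<Rightarrow> real) \<Rightarrow> ('v \<Rightarrow> real)" where
  "theta_of V \<delta> W u s = (\<lambda>i\<in>V. \<Sum>j\<in>insert \<delta> V. W i j * exp (u j) * (s i - s j))"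

text \<open>\<open>f\<close> is a measurable function that recovers \<open>u\<close> from \<open>\<beta>\<close>. It is not unique off the range
  of \<^term>\<open>beta_of V \<delta> W\<close>, so it is kept as a parameter.\<close>

definition recovers_u ::
    "'v set \<Rightarrow> 'v \<Rightarrow> ('v \<Rightarrow> 'v \<Rightarrow> real) \<Rightarrow> (('v \<Rightarrow> real) \<Rightarrow> ('v \<Rightarrow> real)) \<Rightarrow> bool" where
  "recovers_u V \<delta> W f \<longleftrightarrow>
     f \<in> RV V \<rightarrow>\<^sub>M RV (insert \<delta> V) \<and>
     (\<forall>u \<in> insert \<delta> V \<rightarrow>\<^sub>E UNIV. u \<delta> = 0 \<longrightarrow> f (beta_of V \<delta> W u) = u)"

definition g_fun ::
    "'v set \<Rightarrow> 'v \<Rightarrow> ('v \<Rightarrow> 'v \<Rightarrow> real) \<Rightarrow> (('v \<Rightarrow> real) \<Rightarrow> ('v \<Rightarrow> real)) \<Rightarrow>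
      ('v \<Rightarrow> real) \<Rightarrow> ('v \<Rightarrow> real) \<Rightarrow> ('v \<Rightarrow> real)" where
  "g_fun V \<delta> W f \<beta> \<theta> = (let u = f \<beta> in
     (\<lambda>i\<in>insert \<delta> V. if i = \<delta> then 0
        else (\<Sum>j\<in>V. matrix_inv_on V (A_mat V \<delta> W u) i j * (exp (u j) * \<theta> j))))"


section \<open>Infinite graph and wired approximation\<close>

definition infinite_weighted_graph ::
    "'v set \<Rightarrow> 'v set set \<Rightarrow> ('v \<Rightarrow> 'v \<Rightarrow> real) \<Rightarrow> bool" where
  "infinite_weighted_graph V E W \<longleftrightarrow>
     infinite V \<and>
     E \<subseteq> {{i, j} |i j. i \<in> V \<and> j \<in> V} \<and>
     (\<forall>i\<in>V. \<forall>j\<in>V.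
        W i j = W j i \<and> ({i, j} \<in> E \<longrightarrow> W i j > 0) \<and> ({i, j} \<notin> E \<longrightarrow> W i j = 0))"

definition wired_edges :: "'v set \<Rightarrow> 'v set set \<Rightarrow> 'v set \<Rightarrow> 'v \<Rightarrow> 'v set set" where
  "wired_edges Vinf Einf V \<delta> =
     {e \<in> Einf. e \<subseteq> V} \<union> {{i, \<delta>} |i. i \<in> V \<and> (\<exists>j \<in> Vinf - V. {i, j} \<in> Einf)}"

definition wired_weight ::
    "'v set \<Rightarrow> ('v \<Rightarrow> 'v \<Rightarrow> real) \<Rightarrow> 'v set \<Rightarrow> 'v \<Rightarrow> ('v \<Rightarrow> 'v \<Rightarrow> real)" where
  "wired_weight Vinf W V \<delta> i j =
     (if i \<in> V \<and> j \<in> V then W i j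
      else if i \<in> V \<and> j = \<delta> then (\<Sum>\<^sub>\<infinity>k\<in>Vinf - V. W i k)
      else if i = \<delta> \<and> j \<in> V then (\<Sum>\<^sub>\<infinity>k\<in>Vinf - V. W j k)
      else 0)"

definition wired_approximation ::
    "'v set \<Rightarrow> 'v set set \<Rightarrow> ('v \<Rightarrow> 'v \<Rightarrow> real) \<Rightarrow> (nat \<Rightarrow> 'v set) \<Rightarrow> (nat \<Rightarrow> 'v) \<Rightarrow> bool" where
  "wired_approximation Vinf Einf W V \<delta> \<longleftrightarrow>
     (\<forall>n. finite (V n) \<and> V n \<subseteq> V (Suc n)) \<and>
     (\<Union>n. V n) = Vinf \<and>
     (\<forall>n. \<delta> n \<notin> Vinf) \<and>
     (\<forall>n. \<forall>i\<in>V n. W i summable_on (Vinf - V n)) \<and>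
     (\<forall>n. finite_weighted_graph (V n) (\<delta> n) (wired_edges Vinf Einf (V n) (\<delta> n))
             (wired_weight Vinf W (V n) (\<delta> n)))"


section \<open>Infinite-volume coupling\<close>

definition restr_beta_theta ::
    "'v set \<Rightarrow> ('v \<Rightarrow> 'a \<Rightarrow> real) \<Rightarrow> ('v \<Rightarrow> 'a \<Rightarrow> real) \<Rightarrow> 'a \<Rightarrow> ('v \<Rightarrow> real) \<times> ('v \<Rightarrow> real)" where
  "restr_beta_theta V \<beta> \<theta> \<omega> = (\<lambda>i\<in>V. \<beta> i \<omega>, \<lambda>i\<in>V. \<theta> i \<omega>)"

definition infinite_volume_coupling ::
    "'v set \<Rightarrow> 'v set set \<Rightarrow> ('v \<Rightarrow> 'v \<Rightarrow> real) \<Rightarrow> (nat \<Rightarrow> 'v set) \<Rightarrow> (nat \<Rightarrow> 'v) \<Rightarrow>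
      'a measure \<Rightarrow> ('v \<Rightarrow> 'a \<Rightarrow> real) \<Rightarrow> ('v \<Rightarrow> 'a \<Rightarrow> real) \<Rightarrow> bool" where
  "infinite_volume_coupling Vinf Einf W V \<delta> M \<beta> \<theta> \<longleftrightarrow>
     prob_space M \<and>
     (\<forall>i\<in>Vinf. \<beta> i \<in> borel_measurable M \<and> \<theta> i \<in> borel_measurable M) \<and>
     (\<forall>n. distr M (RV (V n) \<Otimes>\<^sub>M RV (V n)) (restr_beta_theta (V n) \<beta> \<theta>) =
           (let W' = wired_weight Vinf W (V n) (\<delta> n) in
            distr (mu (V n) (\<delta> n) (wired_edges Vinf Einf (V n) (\<delta> n)) W')
              (RV (V n) \<Otimes>\<^sub>M RV (V n))
              (\<lambda>(u, s). (beta_of (V n) (\<delta> n) W' u, theta_of (V n) (\<delta> n) W' u s))))"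

definition u_seq ::
    "(nat \<Rightarrow> 'v set) \<Rightarrow> (nat \<Rightarrow> 'v) \<Rightarrow> (nat \<Rightarrow> ('v \<Rightarrow> real) \<Rightarrow> ('v \<Rightarrow> real)) \<Rightarrow>
      ('v \<Rightarrow> 'a \<Rightarrow> real) \<Rightarrow> nat \<Rightarrow> 'v \<Rightarrow> 'a \<Rightarrow> real" where
  "u_seq V \<delta> f \<beta> n i \<omega> =
     (if i \<in> insert (\<delta> n) (V n) then f n (\<lambda>j\<in>V n. \<beta> j \<omega>) i else 0)"

definition s_seq ::
    "'v set \<Rightarrow> ('v \<Rightarrow> 'v \<Rightarrow> real) \<Rightarrow> (nat \<Rightarrow> 'v set) \<Rightarrow> (nat \<Rightarrow> 'v) \<Rightarrow>
      (nat \<Rightarrow> ('v \<Rightarrow> real) \<Rightarrow> ('v \<Rightarrow> real)) \<Rightarrow>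
      ('v \<Rightarrow> 'a \<Rightarrow> real) \<Rightarrow> ('v \<Rightarrow> 'a \<Rightarrow> real) \<Rightarrow> nat \<Rightarrow> 'v \<Rightarrow> 'a \<Rightarrow> real" where
  "s_seq Vinf W V \<delta> f \<beta> \<theta> n i \<omega> =
     (if i \<in> insert (\<delta> n) (V n)
      then g_fun (V n) (\<delta> n) (wired_weight Vinf W (V n) (\<delta> n)) (f n)
             (\<lambda>j\<in>V n. \<beta> j \<omega>) (\<lambda>j\<in>V n. \<theta> j \<omega>) i
      else 0)"

definition beta_theta_filtration ::
    "'a measure \<Rightarrow> (nat \<Rightarrow> 'v set) \<Rightarrow> ('v \<Rightarrow> 'a \<Rightarrow> real) \<Rightarrow> ('v \<Rightarrow> 'a \<Rightarrow> real) \<Rightarrow> nat \<Rightarrow> 'a measure" where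
  "beta_theta_filtration M V \<beta> \<theta> n =
     vimage_algebra (space M) (restr_beta_theta (V n) \<beta> \<theta>) (RV (V n) \<Otimes>\<^sub>M RV (V n))"


section \<open>Martingales\<close>

text \<open>\<^term>\<open>real_cond_exp\<close> only covers real-valued functions. The predicate below says that \<open>g\<close> is
  a version of the conditional expectation of \<open>f\<close> given \<open>F\<close>; for real-valued functions it agrees
  with \<^term>\<open>real_cond_exp\<close> up to null sets.\<close>

definition has_cond_exp ::
    "'a measure \<Rightarrow> 'a measure \<Rightarrow> ('a \<Rightarrow> 'b::{banach, second_countable_topology}) \<Rightarrow> ('a \<Rightarrow> 'b) \<Rightarrow> bool"
  where
  "has_cond_exp M F f g \<longleftrightarrow>
     integrable M f \<and> integrable M g \<and> g \<in> borel_measurable F \<and>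
     (\<forall>A\<in>sets F. (\<integral>x\<in>A. f x \<partial>M) = (\<integral>x\<in>A. g x \<partial>M))"

lemma (in finite_measure_subalgebra) has_cond_exp_real_cond_exp:
  fixes f g :: "'a \<Rightarrow> real"
  assumes "has_cond_exp M F f g"
  shows "AE x in M. real_cond_exp M F f x = g x"
  using assms by (intro real_cond_exp_charact) (auto simp: has_cond_exp_def)

definition martingale ::
    "'a measure \<Rightarrow> (nat \<Rightarrow> 'a measure) \<Rightarrow>
      (nat \<Rightarrow> 'a \<Rightarrow> 'b::{banach, second_countable_topology}) \<Rightarrow> bool" where
  "martingale M F X \<longleftrightarrow>
     filtration (space M) F \<and>
     (\<forall>n. subalgebra M (F n)) \<and>
     (\<forall>n. X n \<in> borel_measurable (F n)) \<and>
     (\<forall>n. integrable M (X n)) \<and>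
     (\<forall>m n. m \<le> n \<longrightarrow> has_cond_exp M (F m) (X n) (X m))"

end

theory Submission
  imports Defs
begin

text \<open>Fix a finite graph with root \<open>\<delta>\<close> and put \<open>\<zeta>\<^sub>i = e\<^bsup>u\<^sub>i\<^esup> (1 + \<i> s\<^sub>i)\<close>, \<open>\<eta>\<^sub>i = W\<^sub>i\<^sub>\<delta>\<close>,
\<open>z = \<eta> + \<i> \<theta>\<close> and \<open>H = 2 diag(\<beta>) - W\<close> on \<open>V\<close>. The definitions of \<open>\<beta>\<close> and \<open>\<theta>\<close> say precisely that
\<open>H \<zeta> = z\<close>, so the process is a product of coordinates of \<open>H\<^sup>-\<^sup>1 z\<close>, and the whole proof is
Gaussian elimination of \<open>H\<close>, one vertex at a time, carried out on the level of measures.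

Elimination of a vertex \<open>x\<close> with pivot \<open>h = 2 \<beta>\<^sub>x - W\<^sub>x\<^sub>x > 0\<close> turns the model on \<open>V \<union> {x}\<close> into the same
kind of model on \<open>V\<close>, with weights \<open>W\<^sub>i\<^sub>j + W\<^sub>i\<^sub>x W\<^sub>x\<^sub>j / h\<close> and pinning \<open>\<eta>\<^sub>i + W\<^sub>i\<^sub>x \<eta>\<^sub>x / h\<close>. Given the fields
on \<open>V\<close>, passing from \<open>(u\<^sub>x, s\<^sub>x)\<close> to \<open>(log h, \<theta>\<^sub>x)\<close> is an affine change of variables, and the density
splits off the factor \<open>kern a (log h) \<theta>\<^sub>x\<close>, in which \<open>a = \<eta>\<^sub>x + (\<Sum>j\<in>V. W x j)\<close> is the total
weight at \<open>x\<close> (\<open>dens_pin_elim\<close>, \<open>mu_pin_integral_insert\<close>). Two properties of this factor give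
the theorem.

\<^item> It depends on the surroundings of \<open>x\<close> only through \<open>a\<close>. Wiring some of the other vertices into the
  root moves their weights from \<open>W\<close> to \<open>\<eta>\<close> and leaves \<open>a\<close> unchanged.

\<^item> Under \<open>kern a\<close> the variable \<open>\<psi> = (a + \<i> r) e\<^sup>-\<^sup>v\<close> has all its moments equal to 1
  (\<open>psi_moments\<close>): the moments of order \<open>m\<close> and \<open>m + 2\<close> agree because their difference is the
  integral of a divergence, and the orders 0 and 1 are Gaussian integrals.

The second property yields, by eliminating all vertices, that the expectation of a polynomial in
\<open>\<zeta>\<close> is its value at \<open>\<zeta> = 1\<close> (\<open>zeta_polynomial_integral\<close>). The two together yield \<open>wiring_id_subset\<close>:
if a function of \<open>(\<beta>, \<theta>)\<close> on \<open>S \<subseteq> V\<close> is multiplied by a polynomial in \<open>\<zeta>\<close>, its expectation does not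
change when \<open>V - S\<close> is wired into the root and \<open>\<zeta>\<close> is replaced by 1 there. Both sides eliminate
\<open>S\<close> with the same factors, and what remains is the expectation of a polynomial in \<open>\<zeta>\<close> over \<open>V - S\<close>.
For \<open>V = V\<^sub>n\<close> and \<open>S = V\<^sub>m\<close> this is the martingale property.

The identities need integrability of polynomials in \<open>\<zeta>\<close>. Halving all weights changes the density by
\<open>exp(-energy/2)\<close> up to a constant, which beats any polynomial in \<open>\<zeta>\<close> because the energy controls
\<open>e\<^bsup>\<bar>u\<^sub>i\<bar>\<^esup>\<close> and \<open>s\<^sub>i\<close> along paths to the root, while the model with halved weights still has mass 1
(\<open>integrable_polyfun_zeta\<close>).\<close>

section \<open>Determinants over a finite index set\<close>

text \<open>Expanding the product at row \<open>a\<close> leaves the determinant of a matrix with two equal rows; composing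
the permutations with the transposition of these rows shows that it equals its own negative.\<close>

lemma det_on_row_add:
  assumes "finite I" "a \<in> I" "b \<in> I" "a \<noteq> b"
  shows "det_on I (\<lambda>i k. if i = a then A i k + c * A b k else A i k) = det_on I A"
proof -
  have P: "(\<Prod>i\<in>I. F i) = F a * (\<Prod>i\<in>I-{a}. F i)" for F :: "'a \<Rightarrow> real"
    using assms by (simp add: prod.remove)
  define D where "D = (\<Sum>p | p permutes I. of_int (sign p) * (\<Prod>i\<in>I. (if i = a then A b (p i) else A i (p i))))"
  have "D = (\<Sum>p | p permutes I. of_int (sign (p \<circ> Transposition.transpose a b)) *
      (\<Prod>i\<in>I. (if i = a then A b ((p \<circ> Transposition.transpose a b) i) else A i ((p \<circ> Transposition.transpose a b) i))))"
    unfolding D_def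
    by (rule sum_permutations_compose_right) (simp add: permutes_swap_id assms)
  also have "\<dots> = (\<Sum>p | p permutes I. - (of_int (sign p) * (\<Prod>i\<in>I. (if i = a then A b (p i) else A i (p i)))))"
  proof (rule sum.cong[OF refl], goal_cases)
    case (1 p)
    then have p: "p permutes I" by simp
    have pp: "permutation p" using p assms(1) by (auto simp: permutation_permutes)
    have s: "sign (p \<circ> Transposition.transpose a b) = - sign p"
      using pp assms by (simp add: sign_compose permutation_swap_id sign_swap_id)
    have "(\<Prod>i\<in>I. (if i = a then A b ((p \<circ> Transposition.transpose a b) i) else A i ((p \<circ> Transposition.transpose a b) i)))
        = (\<Prod>i\<in>I. (if i = a then A b (p i) else A i (p i)))"
      by (rule prod.reindex_bij_witness[where i="Transposition.transpose a b" and j="Transposition.transpose a b"])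
         (use assms in \<open>auto simp: Transposition.transpose_def\<close>)
    then show ?case by (simp add: s)
  qed
  finally have "D = - D" by (simp add: sum_negf D_def)
  then have D0: "D = 0" by simp
  have "det_on I (\<lambda>i k. if i = a then A i k + c * A b k else A i k)
     = (\<Sum>p | p permutes I. of_int (sign p) * (\<Prod>i\<in>I. A i (p i))
          + c * (of_int (sign p) * (\<Prod>i\<in>I. (if i = a then A b (p i) else A i (p i)))))"
    unfolding det_on_def by (rule sum.cong[OF refl]) (simp add: P algebra_simps)
  also have "\<dots> = det_on I A + c * D"
    by (simp add: sum.distrib det_on_def D_def sum_distrib_left)
  finally show ?thesis using D0 by simp
qed

lemma det_on_rows_add:
  assumes "finite I" "b \<in> I" "T \<subseteq> I - {b}"
  shows "det_on I (\<lambda>i k. if i \<in> T then A i k + c i * A b k else A i k) = det_on I A"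
proof -
  have "finite T" using assms finite_subset by blast
  then show ?thesis using assms(3)
  proof (induction T)
    case (insert a T)
    let ?A = "\<lambda>i k. if i \<in> T then A i k + c i * A b k else A i k"
    have "det_on I (\<lambda>i k. if i \<in> insert a T then A i k + c i * A b k else A i k)
        = det_on I (\<lambda>i k. if i = a then ?A i k + c a * ?A b k else ?A i k)"
      using insert by (intro arg_cong[where f="det_on I"] ext) auto
    also have "\<dots> = det_on I ?A" using insert assms by (intro det_on_row_add) auto
    finally show ?case using insert by simp
  qed simp
qed

lemma det_on_cong:
  assumes "\<And>i j. i \<in> I \<Longrightarrow> j \<in> I \<Longrightarrow> A i j = B i j"
  shows "det_on I A = det_on I B"
  unfolding det_on_def
  by (intro sum.cong refl arg_cong2[where f="(*)"] prod.cong) (auto simp: assms permutes_in_image)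

text \<open>A permutation contributes only if it maps no row but \<open>x\<close> to the column \<open>x\<close>, that is, if it fixes
\<open>x\<close>.\<close>

lemma det_on_pivot:
  assumes "finite I" "x \<notin> I" "\<And>i. i \<in> I \<Longrightarrow> A i x = 0"
  shows "det_on (insert x I) A = A x x * det_on I A"
proof -
  have "det_on (insert x I) A = (\<Sum>p | p permutes I. of_int (sign p) * (\<Prod>i\<in>insert x I. A i (p i)))"
    unfolding det_on_def
  proof (rule sum.mono_neutral_right)
    show "finite {p. p permutes insert x I}" using assms by (simp add: finite_permutations)
    show "{p. p permutes I} \<subseteq> {p. p permutes insert x I}"
      by (auto intro: permutes_subset)
    show "\<forall>p\<in>{p. p permutes insert x I} - {p. p permutes I}. of_int (sign p) * (\<Prod>i\<in>insert x I. A i (p i)) = 0"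
    proof
      fix p assume "p \<in> {p. p permutes insert x I} - {p. p permutes I}"
      then have p: "p permutes insert x I" and np: "\<not> p permutes I" by auto
      obtain i where i: "i \<in> insert x I" "p i = x" 
        using permutes_image[OF p] by (metis imageE insertI1)
      have "i \<noteq> x"
      proof
        assume "i = x"
        then have "p permutes I" using p i by (intro permutes_superset[OF p]) auto
        with np show False by simp
      qed
      then have "i \<in> I" "A i (p i) = 0" using i assms by auto
      then have "(\<Prod>i\<in>insert x I. A i (p i)) = 0" using assms(1) by (intro prod_zero) auto
      then show "of_int (sign p) * (\<Prod>i\<in>insert x I. A i (p i)) = 0" by simp
    qed
  qed
  also have "\<dots> = A x x * det_on I A"
    unfolding det_on_def sum_distrib_left
  proof (rule sum.cong[OF refl], goal_cases)
    case (1 p)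
    then have "p x = x" using assms permutes_not_in by fastforce
    then show ?case using assms by simp
  qed
  finally show ?thesis .
qed

text \<open>One step of Gaussian elimination: subtracting multiples of row \<open>x\<close> from the other rows clears
column \<open>x\<close>.\<close>

lemma det_on_schur:
  assumes "finite I" "x \<notin> I" "A x x \<noteq> 0"
  shows "det_on (insert x I) A = A x x * det_on I (\<lambda>i j. A i j - A i x * A x j / A x x)"
proof -
  let ?c = "\<lambda>i. - A i x / A x x"
  let ?B = "\<lambda>i k. if i \<in> I then A i k + ?c i * A x k else A i k"
  have "det_on (insert x I) A = det_on (insert x I) ?B"
    using assms by (intro det_on_rows_add[symmetric]) auto
  also have "\<dots> = ?B x x * det_on I ?B"
    using assms by (intro det_on_pivot) auto
  also have "\<dots> = A x x * det_on I (\<lambda>i j. A i j - A i x * A x j / A x x)"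
    using assms by (auto intro!: det_on_cong)
  finally show ?thesis .
qed

lemma det_on_smult:
  assumes "finite I"
  shows "det_on I (\<lambda>i j. c * A i j) = c ^ card I * det_on I A"
  by (simp add: det_on_def prod.distrib sum_distrib_left mult_ac)

section \<open>The pinned model and the elimination of a vertex\<close>

text \<open>The weights of a model after some vertices have been eliminated or wired. The root has disappeared
from the vertex set; \<open>\<eta> i\<close> is the weight between \<open>i\<close> and the root. The diagonal of \<open>W\<close> may be
non-zero, since elimination creates loops; they enter only the variable \<open>\<beta>\<close>. The last condition
says that no set of vertices is cut off from the root. It is connectedness in a form that passes
to Schur complements without any talk of paths.\<close>

definition pinned :: "'v set \<Rightarrow> ('v \<Rightarrow> 'v \<Rightarrow> real) \<Rightarrow> ('v \<Rightarrow> real) \<Rightarrow> bool" where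
  "pinned V W \<eta> \<longleftrightarrow> finite V \<and>
     (\<forall>i\<in>V. \<forall>j\<in>V. W i j = W j i \<and> W i j \<ge> 0) \<and> (\<forall>i\<in>V. \<eta> i \<ge> 0) \<and>
     (\<forall>S\<subseteq>V. S \<noteq> {} \<longrightarrow> (\<exists>i\<in>S. \<eta> i > 0 \<or> (\<exists>j\<in>V - S. W i j > 0)))"

text \<open>The sum omits \<open>j = i\<close>, so that loops do not contribute to the matrix or to the energy.\<close>

definition local_field :: "'v set \<Rightarrow> ('v \<Rightarrow> 'v \<Rightarrow> real) \<Rightarrow> ('v \<Rightarrow> real) \<Rightarrow> ('v \<Rightarrow> real) \<Rightarrow> 'v \<Rightarrow> real" where
  "local_field V W \<eta> u i = \<eta> i + (\<Sum>j\<in>V-{i}. W i j * exp (u j))"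

text \<open>The matrix \<open>A\<^sub>V\<^sub>V(u)\<close>, with the weight to the root written as pinning.\<close>

definition A_pin :: "'v set \<Rightarrow> ('v \<Rightarrow> 'v \<Rightarrow> real) \<Rightarrow> ('v \<Rightarrow> real) \<Rightarrow> ('v \<Rightarrow> real) \<Rightarrow> 'v \<Rightarrow> 'v \<Rightarrow> real" where
  "A_pin V W \<eta> u i j = (if i = j then exp (u i) * local_field V W \<eta> u i else - W i j * exp (u i + u j))"

definition pair_energy :: "real \<Rightarrow> real \<Rightarrow> real \<Rightarrow> real \<Rightarrow> real" where
  "pair_energy a s b t = cosh (a - b) - 1 + 1 / 2 * (s - t)\<^sup>2 * exp (a + b)"

definition energy :: "'v set \<Rightarrow> ('v \<Rightarrow> 'v \<Rightarrow> real) \<Rightarrow> ('v \<Rightarrow> real) \<Rightarrow> ('v \<Rightarrow> real) \<Rightarrow> ('v \<Rightarrow> real) \<Rightarrow> real" where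
  "energy V W \<eta> u s = 1 / 2 * (\<Sum>i\<in>V. \<Sum>j\<in>V. W i j * pair_energy (u i) (s i) (u j) (s j))
     + (\<Sum>i\<in>V. \<eta> i * pair_energy (u i) (s i) 0 0)"

definition dens_pin :: "'v set \<Rightarrow> ('v \<Rightarrow> 'v \<Rightarrow> real) \<Rightarrow> ('v \<Rightarrow> real) \<Rightarrow> ('v \<Rightarrow> real) \<Rightarrow> ('v \<Rightarrow> real) \<Rightarrow> real" where
  "dens_pin V W \<eta> u s = det_on V (A_pin V W \<eta> u) * exp (- energy V W \<eta> u s) * (\<Prod>i\<in>V. exp (- u i) / (2 * pi))"

text \<open>In contrast to the matrix, \<open>\<beta>\<close> counts loops. With this convention \<open>\<beta>\<close> on the remaining vertices is
unchanged by elimination.\<close>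

definition beta_at :: "'v set \<Rightarrow> ('v \<Rightarrow> 'v \<Rightarrow> real) \<Rightarrow> ('v \<Rightarrow> real) \<Rightarrow> ('v \<Rightarrow> real) \<Rightarrow> 'v \<Rightarrow> real" where
  "beta_at V W \<eta> u i = 1 / 2 * ((\<eta> i + (\<Sum>j\<in>V. W i j * exp (u j))) * exp (- u i))"

definition theta_at :: "'v set \<Rightarrow> ('v \<Rightarrow> 'v \<Rightarrow> real) \<Rightarrow> ('v \<Rightarrow> real) \<Rightarrow> ('v \<Rightarrow> real) \<Rightarrow> ('v \<Rightarrow> real) \<Rightarrow> 'v \<Rightarrow> real" where
  "theta_at V W \<eta> u s i = \<eta> i * s i + (\<Sum>j\<in>V. W i j * exp (u j) * (s i - s j))"

text \<open>The value 1 off \<open>V\<close> corresponds to \<open>u = s = 0\<close>. It makes \<open>\<zeta>\<close> of a wired model comparable with \<open>\<zeta>\<close>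
of the original one, because wired vertices carry the value of the root.\<close>

definition zeta :: "'v set \<Rightarrow> ('v \<Rightarrow> real) \<Rightarrow> ('v \<Rightarrow> real) \<Rightarrow> 'v \<Rightarrow> complex" where
  "zeta V u s j = (if j \<in> V then of_real (exp (u j)) * (1 + \<i> * of_real (s j)) else 1)"

text \<open>Schur complement of the weights at the vertex \<open>x\<close> with pivot \<open>h\<close>.\<close>

definition elim_W :: "('v \<Rightarrow> 'v \<Rightarrow> real) \<Rightarrow> 'v \<Rightarrow> real \<Rightarrow> 'v \<Rightarrow> 'v \<Rightarrow> real" where
  "elim_W W x h i j = W i j + W i x * W x j / h"

definition elim_pin :: "('v \<Rightarrow> 'v \<Rightarrow> real) \<Rightarrow> ('v \<Rightarrow> real) \<Rightarrow> 'v \<Rightarrow> real \<Rightarrow> 'v \<Rightarrow> real" where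
  "elim_pin W \<eta> x h i = \<eta> i + W i x * \<eta> x / h"

text \<open>Weights only grow, so the only danger is an edge from \<open>S\<close> that leads to \<open>x\<close> alone. Then \<open>S \<union> {x}\<close>
has an exit in the old model, and if it is at \<open>x\<close>, elimination turns the two steps through \<open>x\<close> into a
direct connection.\<close>

lemma pinned_elim:
  assumes "pinned (insert x V) W \<eta>" "x \<notin> V" "h > 0"
  shows "pinned V (elim_W W x h) (elim_pin W \<eta> x h)"
proof -
  note p = assms(1)[unfolded pinned_def]
  have sym: "W i j = W j i" "W i j \<ge> 0" if "i \<in> insert x V" "j \<in> insert x V" for i j using p that by auto
  have e0: "\<eta> i \<ge> 0" if "i \<in> insert x V" for i using p that by auto
  have cut: "\<exists>i\<in>S. \<eta> i > 0 \<or> (\<exists>j\<in>insert x V - S. W i j > 0)" if "S \<subseteq> insert x V" "S \<noteq> {}" for S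
    using p that by blast
  have Wge: "elim_W W x h i j \<ge> W i j" if "i \<in> V" "j \<in> V" for i j
    using sym that assms(3) by (simp add: elim_W_def)
  have Ege: "elim_pin W \<eta> x h i \<ge> \<eta> i" if "i \<in> V" for i
    using sym e0 that assms(3) by (simp add: elim_pin_def)
  show ?thesis unfolding pinned_def
  proof (intro conjI allI impI ballI)
    show "finite V" using p by auto
    fix i j assume ij: "i \<in> V" "j \<in> V"
    show "elim_W W x h i j = elim_W W x h j i" using sym ij by (simp add: elim_W_def mult.commute)
    show "elim_W W x h i j \<ge> 0" using Wge[OF ij] sym(2)[of i j] ij by simp
  next
    fix i assume "i \<in> V" then show "elim_pin W \<eta> x h i \<ge> 0" using Ege[of i] e0[of i] by simp
  next
    fix S assume S: "S \<subseteq> V" "S \<noteq> {}"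
    have easy: "\<exists>i\<in>S. elim_pin W \<eta> x h i > 0 \<or> (\<exists>j\<in>V - S. elim_W W x h i j > 0)"
      if "i \<in> S" "\<eta> i > 0 \<or> (\<exists>j\<in>V - S. W i j > 0)" for i
      using that Ege[of i] Wge[of i] S(1) by (meson DiffD1 less_le_trans subsetD)
    obtain i where i: "i \<in> S" "\<eta> i > 0 \<or> (\<exists>j\<in>insert x V - S. W i j > 0)"
      using cut[of S] S by blast
    show "\<exists>i\<in>S. elim_pin W \<eta> x h i > 0 \<or> (\<exists>j\<in>V - S. elim_W W x h i j > 0)"
    proof (cases "\<eta> i > 0 \<or> (\<exists>j\<in>V - S. W i j > 0)")
      case False
      then have ix: "W i x > 0" using i by auto
      have iV: "i \<in> V" using i S by auto
      obtain k where k: "k \<in> insert x S" "\<eta> k > 0 \<or> (\<exists>j\<in>insert x V - insert x S. W k j > 0)"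
        using cut[of "insert x S"] S by blast
      show ?thesis
      proof (cases "k = x")
        case True
        then consider "\<eta> x > 0" | j where "j \<in> V - S" "W x j > 0" using k assms(2) by auto
        then show ?thesis
        proof cases
          case 1
          then have "elim_pin W \<eta> x h i > 0"
            using ix e0[of i] iV assms(3) by (simp add: elim_pin_def add_nonneg_pos)
          then show ?thesis using i by blast
        next
          case 2
          then have "elim_W W x h i j > 0"
            using ix sym(2)[of i j] iV assms(3) by (simp add: elim_W_def add_nonneg_pos)
          then show ?thesis using i 2 by blast
        qed
      next
        case False
        with k have "k \<in> S" "\<eta> k > 0 \<or> (\<exists>j\<in>V - S. W k j > 0)" by auto
        then show ?thesis by (rule easy)
      qed
    qed (rule easy[OF i(1)])
  qed
qed

lemma pinned_finite: "pinned V W \<eta> \<Longrightarrow> finite V"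
  by (simp add: pinned_def)

lemma pinned_nonneg:
  assumes "pinned V W \<eta>" "i \<in> V"
  shows "\<eta> i \<ge> 0" "j \<in> V \<Longrightarrow> W i j \<ge> 0" "j \<in> V \<Longrightarrow> W i j = W j i"
  using assms unfolding pinned_def by auto

lemma pinned_cut:
  assumes "pinned V W \<eta>" "S \<subseteq> V" "S \<noteq> {}"
  obtains i where "i \<in> S" "\<eta> i > 0" | i j where "i \<in> S" "j \<in> V - S" "W i j > 0"
  using assms unfolding pinned_def by blast

text \<open>The cut condition for \<open>S = {x}\<close>. For \<open>y = 1\<close> the quantity is the parameter of the law of the
eliminated vertex; for \<open>y = e\<^sup>u\<close> it is the numerator of \<open>e\<^bsup>u\<^sub>x\<^esup>\<close>.\<close>

lemma pinned_weighted_pos: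
  assumes p: "pinned (insert x V) W \<eta>" and x: "x \<notin> V" and y: "\<And>j. j \<in> V \<Longrightarrow> y j > 0"
  shows "\<eta> x + (\<Sum>j\<in>V. W x j * y j) > 0"
proof -
  have fin: "finite V" using pinned_finite[OF p] by simp
  have e: "\<eta> x \<ge> 0" using pinned_nonneg(1)[OF p, of x] by simp
  have w: "W x j * y j \<ge> 0" if "j \<in> V" for j
    using pinned_nonneg(2)[OF p, of x j] y[OF that] that by simp
  from p show ?thesis
  proof (rule pinned_cut[where S="{x}"])
    fix i assume "i \<in> {x}" "\<eta> i > 0"
    then show ?thesis using sum_nonneg[of V "\<lambda>j. W x j * y j", OF w] by simp
  next
    fix i j assume "i \<in> {x}" and j: "j \<in> insert x V - {x}" and "W i j > 0"
    then have "0 < W x j * y j" "j \<in> V" using y[of j] by auto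
    then have "(\<Sum>j\<in>V. W x j * y j) > 0" using fin w by (intro sum_pos2[of _ j]) auto
    then show ?thesis using e by simp
  qed auto
qed

text \<open>In the coordinates \<open>(e\<^sup>u, e\<^sup>u s, e\<^sup>-\<^sup>u + e\<^sup>u s\<^sup>2)\<close>, horospherical coordinates on the hyperboloid, the
interaction is bilinear. This is what makes the energy compatible with linear elimination.\<close>

lemma pair_energy_alt:
  fixes a s b t :: real
  defines "q \<equiv> \<lambda>a s. exp (- a) + exp a * s\<^sup>2"
  shows "pair_energy a s b t
    = 1/2 * (q a s * exp b + q b t * exp a) - (exp a * s) * (exp b * t) - 1"
  unfolding q_def
  by (simp add: pair_energy_def cosh_def exp_diff exp_minus exp_add field_simps power2_eq_square)

lemma exp_ln_diff:
  fixes c v :: real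
  assumes "c > 0"
  shows "exp (ln c - v) = c * exp (- v)" 
  by (subst exp_diff) (use assms in \<open>simp add: exp_minus divide_inverse\<close>)

text \<open>By bilinearity all sums over a row of weights, and the quadratic terms created by elimination, are
expressed through the four scalars \<open>Y\<close>, \<open>T\<close>, \<open>Q\<close>, \<open>n\<close>.\<close>

lemma sum_pair_energy_row:
  fixes w u s :: "'v \<Rightarrow> real" and V :: "'v set"
  defines "q \<equiv> \<lambda>a s. exp (- a) + exp a * s\<^sup>2"
  defines "Y \<equiv> \<Sum>j\<in>V. w j * exp (u j)"
    and "T \<equiv> \<Sum>j\<in>V. w j * (exp (u j) * s j)"
    and "Q \<equiv> \<Sum>j\<in>V. w j * q (u j) (s j)"
    and "n \<equiv> \<Sum>j\<in>V. w j"
  shows "(\<Sum>j\<in>V. w j * pair_energy a r (u j) (s j)) =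
      1/2 * (q a r * Y + Q * exp a) - exp a * r * T - n"
    and "(\<Sum>i\<in>V. \<Sum>j\<in>V. w i * w j * pair_energy (u i) (s i) (u j) (s j)) = Q * Y - T\<^sup>2 - n\<^sup>2"
    and "(\<Sum>j\<in>V. w j * pair_energy (u j) (s j) 0 0) = 1/2 * (Q + Y) - n"
proof -
  have row: "(\<Sum>j\<in>V. w j * pair_energy a r (u j) (s j)) =
      1/2 * (q a r * Y + Q * exp a) - exp a * r * T - n" for a r
  proof -
    have "(\<Sum>j\<in>V. w j * pair_energy a r (u j) (s j)) =
      (\<Sum>j\<in>V. 1/2 * q a r * (w j * exp (u j)) + 1/2 * exp a * (w j * q (u j) (s j))
        - exp a * r * (w j * (exp (u j) * s j)) - w j)"
      unfolding q_def by (rule sum.cong[OF refl]) (simp add: pair_energy_alt algebra_simps)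
    also have "\<dots> = 1/2 * q a r * Y + 1/2 * exp a * Q - exp a * r * T - n"
      unfolding Y_def T_def Q_def n_def
      by (simp only: sum.distrib sum_subtractf sum_distrib_left[symmetric])
    also have "\<dots> = 1/2 * (q a r * Y + Q * exp a) - exp a * r * T - n"
      by (simp add: algebra_simps)
    finally show ?thesis .
  qed
  show "(\<Sum>j\<in>V. w j * pair_energy a r (u j) (s j)) =
      1/2 * (q a r * Y + Q * exp a) - exp a * r * T - n" by (rule row)
  have "(\<Sum>i\<in>V. \<Sum>j\<in>V. w i * w j * pair_energy (u i) (s i) (u j) (s j))
     = (\<Sum>i\<in>V. w i * (\<Sum>j\<in>V. w j * pair_energy (u i) (s i) (u j) (s j)))"
    by (simp only: sum_distrib_left mult.assoc)
  also have "\<dots> = (\<Sum>i\<in>V. w i * (1/2 * (q (u i) (s i) * Y + Q * exp (u i)) - exp (u i) * s i * T - n))"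
    by (simp only: row)
  also have "\<dots> = (\<Sum>i\<in>V. 1/2 * Y * (w i * q (u i) (s i)) + 1/2 * Q * (w i * exp (u i))
        - T * (w i * (exp (u i) * s i)) - n * w i)"
    by (rule sum.cong[OF refl]) (simp add: algebra_simps)
  also have "\<dots> = 1/2 * Y * Q + 1/2 * Q * Y - T * T - n * n"
    unfolding Y_def T_def Q_def n_def
    by (simp only: sum.distrib sum_subtractf sum_distrib_left[symmetric])
  finally show "(\<Sum>i\<in>V. \<Sum>j\<in>V. w i * w j * pair_energy (u i) (s i) (u j) (s j)) = Q * Y - T\<^sup>2 - n\<^sup>2"
    by (simp add: power2_eq_square algebra_simps)
  have "(\<Sum>j\<in>V. w j * pair_energy (u j) (s j) 0 0) = (\<Sum>j\<in>V. w j * pair_energy 0 0 (u j) (s j))"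
    by (intro sum.cong refl) (simp add: pair_energy_alt algebra_simps)
  also have "\<dots> = 1/2 * (Q + Y) - n" by (simp add: row q_def algebra_simps)
  finally show "(\<Sum>j\<in>V. w j * pair_energy (u j) (s j) 0 0) = 1/2 * (Q + Y) - n" .
qed

text \<open>The inverse of elimination: given \<open>v = log h\<close> and the remaining fields, row \<open>x\<close> of \<open>H \<zeta> = z\<close>
determines \<open>u\<^sub>x\<close> by its real part and \<open>s\<^sub>x\<close> by its imaginary part.\<close>

definition reinsert_u where
  "reinsert_u V W \<eta> x v u = ln (\<eta> x + (\<Sum>j\<in>V. W x j * exp (u j))) - v"

definition reinsert_s where
  "reinsert_s V W \<eta> x r u s = (r + (\<Sum>j\<in>V. W x j * (exp (u j) * s j))) / (\<eta> x + (\<Sum>j\<in>V. W x j * exp (u j)))"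

text \<open>The joint density of \<open>v = log h\<close> and \<open>r = \<theta>\<^sub>x\<close> at an eliminated vertex of total weight \<open>a\<close>. The
logarithm of the pivot is used instead of the pivot, because then the domain is the whole plane
and the change of variables from \<open>u\<^sub>x\<close> is a reflected translation.\<close>

definition kern :: "real \<Rightarrow> real \<Rightarrow> real \<Rightarrow> real" where
  "kern a v r = 1 / (2 * pi) * exp (- 1 / 2 * (exp v + (a\<^sup>2 + r\<^sup>2) * exp (- v) - 2 * a))"

text \<open>Here \<open>y\<close>, \<open>s\<close>, \<open>q\<close> belong to the vertex \<open>x\<close>, and \<open>y\<close> and \<open>y s\<close> solve row \<open>x\<close> of the linear system. On
the right, the first two terms are the energy that elimination adds to the other vertices, and
the last one is the exponent of \<open>kern\<close>. It depends on \<open>e\<close> and \<open>n\<close> only through \<open>e + n\<close>: completing the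
square is what makes the total weight appear.\<close>

lemma energy_elim_algebra:
  fixes h e t T Y Q n y q :: real
  assumes h: "h > 0" and yy: "y * h = e + Y" and tt: "T + r = h * (y * s)" and y: "y > 0"
    and q: "q = 1 / y + y * s\<^sup>2"
  shows "1/2 * (q * Y + Q * y) - y * s * T - n + e * (1/2 * (q + y) - 1)
      = 1 / (2 * h) * (Q * Y - T\<^sup>2 - n\<^sup>2) + e / h * (1/2 * (Q + Y) - n)
        + 1/2 * (h + ((e + n)\<^sup>2 + r\<^sup>2) / h - 2 * (e + n))"
proof -

  have e1: "1 / (2 * h) * (Q * Y - T\<^sup>2 - n\<^sup>2) + e / h * (1/2 * (Q + Y) - n)
        + 1/2 * (h + ((e + n)\<^sup>2 + r\<^sup>2) / h - 2 * (e + n))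
      = (Q * (Y + e) - T\<^sup>2 + e * Y + e\<^sup>2 + r\<^sup>2 + h * h - 2 * h * (e + n)) / (2 * h)"
    using h by (simp add: field_simps power2_eq_square)
  have e2: "1/2 * (q * Y + Q * y) - y * s * T - n + e * (1/2 * (q + y) - 1)
    = (q * (Y + e) * h + Q * (y * h) - 2 * h * (y * s) * T - 2 * h * n + e * (y * h) - 2 * e * h) / (2 * h)"
    using h by (simp add: field_simps)
  have "q * (Y + e) * h = h * h * (y * q)" using yy by algebra
  also have "y * q = 1 + (y * s)\<^sup>2" using y q by (simp add: field_simps power2_eq_square)
  finally have e3: "q * (Y + e) * h = h * h + (T + r)\<^sup>2" using tt by algebra
  have e4: "2 * h * (y * s) * T = 2 * (T + r) * T" using tt by algebra
  have "q * (Y + e) * h + Q * (y * h) - 2 * h * (y * s) * T - 2 * h * n + e * (y * h) - 2 * e * h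
     = Q * (Y + e) - T\<^sup>2 + e * Y + e\<^sup>2 + r\<^sup>2 + h * h - 2 * h * (e + n)"
    unfolding e3 e4 yy by (simp add: algebra_simps power2_eq_square)
  then show ?thesis unfolding e1 e2 by simp
qed

lemma energy_elim:
  fixes W :: "'v \<Rightarrow> 'v \<Rightarrow> real" and u s :: "'v \<Rightarrow> real" and v r :: real
  assumes p: "pinned (insert x V) W \<eta>" and x: "x \<notin> V"
  defines "u' \<equiv> u(x := reinsert_u V W \<eta> x v u)" and "s' \<equiv> s(x := reinsert_s V W \<eta> x r u s)"
  shows "energy (insert x V) W \<eta> u' s' = energy V (elim_W W x (exp v)) (elim_pin W \<eta> x (exp v)) u s
     + 1 / 2 * (exp v + ((\<eta> x + (\<Sum>j\<in>V. W x j))\<^sup>2 + r\<^sup>2) * exp (- v) - 2 * (\<eta> x + (\<Sum>j\<in>V. W x j)))"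
proof -
  have fin: "finite V" using pinned_finite[OF p] by simp
  have sym: "W i x = W x i" if "i \<in> V" for i using pinned_nonneg(3)[OF p, of i x] that by simp
  have u'V: "u' i = u i" "s' i = s i" if "i \<in> V" for i using that x by (auto simp: u'_def s'_def)
  define q where "q = (\<lambda>a s::real. exp (- a) + exp a * s\<^sup>2)"
  define Y where "Y = (\<Sum>j\<in>V. W x j * exp (u j))"
  define T where "T = (\<Sum>j\<in>V. W x j * (exp (u j) * s j))"
  define Q where "Q = (\<Sum>j\<in>V. W x j * q (u j) (s j))"
  define n where "n = (\<Sum>j\<in>V. W x j)"
  define P where "P = (\<lambda>i j. pair_energy (u i) (s i) (u j) (s j))"
  have c: "\<eta> x + Y > 0" unfolding Y_def using pinned_weighted_pos[OF p x] by simp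
  have Pxx: "pair_energy a b a b = 0" for a b by (simp add: pair_energy_def)
  have Pc: "pair_energy a b d e = pair_energy d e a b" for a b d e
    by (simp add: pair_energy_alt algebra_simps)
  have E1: "energy (insert x V) W \<eta> u' s' = 1/2 * (\<Sum>i\<in>V. \<Sum>j\<in>V. W i j * P i j)
     + (\<Sum>j\<in>V. W x j * pair_energy (u' x) (s' x) (u j) (s j))
     + (\<Sum>i\<in>V. \<eta> i * pair_energy (u i) (s i) 0 0) + \<eta> x * pair_energy (u' x) (s' x) 0 0"
  proof -
    have "(\<Sum>i\<in>V. W i x * pair_energy (u' i) (s' i) (u' x) (s' x))
      = (\<Sum>j\<in>V. W x j * pair_energy (u' x) (s' x) (u j) (s j))"
      by (rule sum.cong[OF refl]) (simp add: sym u'V Pc[of "u' x" "s' x"])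
    then show ?thesis
      by (simp add: energy_def fin x u'V sum.distrib Pxx P_def cong: sum.cong)
  qed
  have E2: "energy V (elim_W W x (exp v)) (elim_pin W \<eta> x (exp v)) u s
    = 1/2 * (\<Sum>i\<in>V. \<Sum>j\<in>V. W i j * P i j) + 1 / (2 * exp v) * (Q * Y - T\<^sup>2 - n\<^sup>2)
     + (\<Sum>i\<in>V. \<eta> i * pair_energy (u i) (s i) 0 0) + \<eta> x / exp v * (1/2 * (Q + Y) - n)"
  proof -
    have "(\<Sum>i\<in>V. \<Sum>j\<in>V. elim_W W x (exp v) i j * P i j) = (\<Sum>i\<in>V. \<Sum>j\<in>V. W i j * P i j)
       + 1 / exp v * (\<Sum>i\<in>V. \<Sum>j\<in>V. W x i * W x j * P i j)"
      unfolding sum_distrib_left sum.distrib[symmetric]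
      by (intro sum.cong refl) (simp add: elim_W_def sym field_simps)
    moreover have "(\<Sum>i\<in>V. elim_pin W \<eta> x (exp v) i * pair_energy (u i) (s i) 0 0)
      = (\<Sum>i\<in>V. \<eta> i * pair_energy (u i) (s i) 0 0) + \<eta> x / exp v * (\<Sum>i\<in>V. W x i * pair_energy (u i) (s i) 0 0)"
      unfolding sum_distrib_left sum.distrib[symmetric]
      by (intro sum.cong refl) (simp add: elim_pin_def sym field_simps)
    moreover have "(\<Sum>i\<in>V. \<Sum>j\<in>V. W x i * W x j * P i j) = Q * Y - T\<^sup>2 - n\<^sup>2"
      unfolding P_def q_def Y_def T_def Q_def n_def by (rule sum_pair_energy_row(2))
    moreover have "(\<Sum>i\<in>V. W x i * pair_energy (u i) (s i) 0 0) = 1/2 * (Q + Y) - n"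
      unfolding q_def Y_def T_def Q_def n_def by (rule sum_pair_energy_row(3))
    ultimately have "energy V (elim_W W x (exp v)) (elim_pin W \<eta> x (exp v)) u s
      = 1/2 * ((\<Sum>i\<in>V. \<Sum>j\<in>V. W i j * P i j) + 1 / exp v * (Q * Y - T\<^sup>2 - n\<^sup>2))
        + ((\<Sum>i\<in>V. \<eta> i * pair_energy (u i) (s i) 0 0) + \<eta> x / exp v * (1/2 * (Q + Y) - n))"
      by (simp only: energy_def P_def)
    then show ?thesis by (simp add: distrib_left)
  qed
  have "exp (u' x) = (\<eta> x + Y) * exp (- v)"
    unfolding u'_def reinsert_u_def Y_def[symmetric] using c by (simp add: exp_ln_diff)
  then have yy: "exp (u' x) * exp v = \<eta> x + Y" by (simp add: exp_minus)
  have "s' x = (r + T) / (\<eta> x + Y)" by (simp add: s'_def reinsert_s_def T_def Y_def)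
  then have "T + r = (\<eta> x + Y) * s' x" using c by simp
  then have tt: "T + r = exp v * (exp (u' x) * s' x)" unfolding yy[symmetric] by (simp only: mult_ac)
  have alg: "1/2 * (q (u' x) (s' x) * Y + Q * exp (u' x)) - exp (u' x) * s' x * T - n
        + \<eta> x * (1/2 * (q (u' x) (s' x) + exp (u' x)) - 1)
      = 1 / (2 * exp v) * (Q * Y - T\<^sup>2 - n\<^sup>2) + \<eta> x / exp v * (1/2 * (Q + Y) - n)
        + 1/2 * (exp v + ((\<eta> x + n)\<^sup>2 + r\<^sup>2) / exp v - 2 * (\<eta> x + n))"
    by (rule energy_elim_algebra[OF _ yy tt]) (auto simp: q_def exp_minus field_simps)
  have rw: "(\<Sum>j\<in>V. W x j * pair_energy (u' x) (s' x) (u j) (s j))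
     = 1/2 * (q (u' x) (s' x) * Y + Q * exp (u' x)) - exp (u' x) * s' x * T - n"
    unfolding q_def Y_def T_def Q_def n_def by (rule sum_pair_energy_row(1))
  have px: "pair_energy (u' x) (s' x) 0 0 = 1/2 * (q (u' x) (s' x) + exp (u' x)) - 1"
    by (simp add: pair_energy_alt q_def)
  have e: "z * exp (- v) = z / exp v" for z by (simp add: exp_minus divide_inverse)
  show ?thesis unfolding E1 E2 rw px n_def[symmetric] e using alg by linarith
qed

text \<open>The assumption \<open>uh\<close> ties the pivot to \<open>u\<^sub>x\<close>. Off the diagonal the identity is the definition of
\<open>elim_W\<close>; on the diagonal it says that eliminating \<open>e\<^bsup>u\<^sub>x\<^esup>\<close> from the local field at \<open>i\<close> produces the
local field of the reduced model and a loop.\<close>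

lemma A_pin_schur:
  fixes W :: "'v \<Rightarrow> 'v \<Rightarrow> real" and u :: "'v \<Rightarrow> real"
  assumes p: "pinned (insert x V) W \<eta>" and x: "x \<notin> V" and h: "h > 0"
    and uh: "exp (u x) * h = \<eta> x + (\<Sum>j\<in>V. W x j * exp (u j))"
  shows "A_pin (insert x V) W \<eta> u x x = exp (u x) * (exp (u x) * h)"
    and "i \<in> V \<Longrightarrow> j \<in> V \<Longrightarrow> A_pin (insert x V) W \<eta> u i j
        - A_pin (insert x V) W \<eta> u i x * A_pin (insert x V) W \<eta> u x j / A_pin (insert x V) W \<eta> u x x
      = A_pin V (elim_W W x h) (elim_pin W \<eta> x h) u i j"
proof -
  have fin: "finite V" using pinned_finite[OF p] by simp
  have sym: "W i x = W x i" if "i \<in> V" for i using pinned_nonneg(3)[OF p, of i x] that by simp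
  define c where "c = \<eta> x + (\<Sum>j\<in>V. W x j * exp (u j))"
  have yx: "exp (u x) = c / h" using uh h by (simp add: c_def field_simps)
  have c: "c > 0" using uh h unfolding c_def by (metis exp_gt_zero mult_pos_pos)
  let ?A = "A_pin (insert x V) W \<eta> u"
  have "insert x V - {x} = V" using x by auto
  then have Axx: "?A x x = exp (u x) * c" unfolding A_pin_def local_field_def c_def by simp
  then show "?A x x = exp (u x) * (exp (u x) * h)" using uh by (simp add: c_def)
  have Aix: "?A i x = - W x i * exp (u i) * exp (u x)" "?A x i = - W x i * exp (u i) * exp (u x)" if "i \<in> V" for i
    using that x by (auto simp: A_pin_def sym exp_add)
  have Z: "?A i x * ?A x j / ?A x x = (W x i * W x j / h) * (exp (u i) * exp (u j))" if "i \<in> V" "j \<in> V" for i j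
    unfolding Aix[OF that(1)] Aix[OF that(2)] Axx using c h yx by (simp add: field_simps)
  show "?A i j - ?A i x * ?A x j / ?A x x = A_pin V (elim_W W x h) (elim_pin W \<eta> x h) u i j"
    if ij: "i \<in> V" "j \<in> V"
  proof (cases "i = j")
    case False
    then show ?thesis unfolding Z[OF ij] using ij
      by (simp add: A_pin_def elim_W_def sym exp_add algebra_simps)
  next
    case True
    have ix: "i \<noteq> x" using ij x by auto
    have S: "insert x V - {i} = insert x (V - {i})" using ix by auto
    have f1: "local_field (insert x V) W \<eta> u i = \<eta> i + W x i * (c / h) + (\<Sum>j\<in>V-{i}. W i j * exp (u j))"
      unfolding local_field_def S using fin x by (simp add: yx sym ij)
    have "(\<Sum>j\<in>V. W x j * exp (u j)) = W x i * exp (u i) + (\<Sum>j\<in>V-{i}. W x j * exp (u j))"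
      using fin ij by (simp add: sum.remove)
    then have cc: "c = \<eta> x + W x i * exp (u i) + (\<Sum>j\<in>V-{i}. W x j * exp (u j))"
      by (simp add: c_def)
    have f2: "local_field V (elim_W W x h) (elim_pin W \<eta> x h) u i
      = \<eta> i + W x i * \<eta> x / h + ((\<Sum>j\<in>V-{i}. W i j * exp (u j)) + W x i / h * (\<Sum>j\<in>V-{i}. W x j * exp (u j)))"
      unfolding local_field_def elim_pin_def elim_W_def sum_distrib_left sum.distrib[symmetric]
      using ij by (simp add: sym algebra_simps cong: sum.cong)
    have f3: "local_field (insert x V) W \<eta> u i = local_field V (elim_W W x h) (elim_pin W \<eta> x h) u i + W x i * W x i * exp (u i) / h"
      unfolding f1 f2 cc using h by (simp add: field_simps)
    have "?A i i - ?A i x * ?A x i / ?A x x = exp (u i) * (local_field (insert x V) W \<eta> u i - W x i * W x i * exp (u i) / h)"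
      unfolding Z[OF ij(1) ij(1)] using ij h by (simp add: A_pin_def field_simps)
    also have "\<dots> = A_pin V (elim_W W x h) (elim_pin W \<eta> x h) u i i"
      unfolding f3 by (simp add: A_pin_def)
    finally show ?thesis using True by simp
  qed
qed

lemma A_pin_elim:
  fixes W :: "'v \<Rightarrow> 'v \<Rightarrow> real"
  assumes p: "pinned (insert x V) W \<eta>" and x: "x \<notin> V"
  shows "det_on (insert x V) (A_pin (insert x V) W \<eta> (u(x := reinsert_u V W \<eta> x v u)))
    = exp (reinsert_u V W \<eta> x v u) * (\<eta> x + (\<Sum>j\<in>V. W x j * exp (u j)))
      * det_on V (A_pin V (elim_W W x (exp v)) (elim_pin W \<eta> x (exp v)) u)"
proof -
  have fin: "finite V" using pinned_finite[OF p] by simp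
  define u' where "u' = u(x := reinsert_u V W \<eta> x v u)"
  have u'V: "u' i = u i" if "i \<in> V" for i using that x by (auto simp: u'_def)
  define c where "c = \<eta> x + (\<Sum>j\<in>V. W x j * exp (u j))"
  have c: "c > 0" unfolding c_def using pinned_weighted_pos[OF p x] by simp
  have cu: "c = \<eta> x + (\<Sum>j\<in>V. W x j * exp (u' j))" unfolding c_def by (simp add: u'V)
  have "exp (u' x) = c * exp (- v)"
    unfolding u'_def reinsert_u_def c_def[symmetric] using c by (simp add: exp_ln_diff)
  then have yx: "exp (u' x) * exp v = c" by (simp add: exp_minus)
  let ?A = "A_pin (insert x V) W \<eta> u'"
  note S = A_pin_schur[OF p x exp_gt_zero yx[unfolded cu]]
  have Axx: "?A x x = exp (u' x) * c" using S(1) yx by simp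
  have "det_on (insert x V) ?A = ?A x x * det_on V (\<lambda>i j. ?A i j - ?A i x * ?A x j / ?A x x)"
    by (rule det_on_schur[OF fin x]) (use Axx c in simp)
  also have "det_on V (\<lambda>i j. ?A i j - ?A i x * ?A x j / ?A x x) = det_on V (A_pin V (elim_W W x (exp v)) (elim_pin W \<eta> x (exp v)) u')"
    by (rule det_on_cong) (rule S(2))
  also have "\<dots> = det_on V (A_pin V (elim_W W x (exp v)) (elim_pin W \<eta> x (exp v)) u)"
    by (rule det_on_cong) (auto simp: A_pin_def local_field_def u'V intro!: sum.cong)
  finally show ?thesis unfolding Axx by (simp only: u'_def c_def fun_upd_same)
qed

text \<open>Energy and determinant both split, and the factors \<open>e\<^bsup>u\<^sub>x\<^esup>\<close> cancel. The remaining factor \<open>c\<close> in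
front is the Jacobian of \<open>(u\<^sub>x, s\<^sub>x) \<mapsto> (v, r)\<close> and disappears in the change of variables.\<close>

lemma dens_pin_elim:
  fixes W :: "'v \<Rightarrow> 'v \<Rightarrow> real"
  assumes p: "pinned (insert x V) W \<eta>" and x: "x \<notin> V"
  shows "dens_pin (insert x V) W \<eta> (u(x := reinsert_u V W \<eta> x v u)) (s(x := reinsert_s V W \<eta> x r u s))
     = (\<eta> x + (\<Sum>j\<in>V. W x j * exp (u j))) * kern (\<eta> x + (\<Sum>j\<in>V. W x j)) v r
       * dens_pin V (elim_W W x (exp v)) (elim_pin W \<eta> x (exp v)) u s"
proof -
  have fin: "finite V" using pinned_finite[OF p] by simp
  let ?e = "reinsert_u V W \<eta> x v u"
  let ?V = "insert x V" and ?u = "u(x := ?e)" and ?s = "s(x := reinsert_s V W \<eta> x r u s)"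
  let ?W = "elim_W W x (exp v)" and ?p = "elim_pin W \<eta> x (exp v)"
  define c where "c = \<eta> x + (\<Sum>j\<in>V. W x j * exp (u j))"
  define K where "K = 1 / 2 * (exp v + ((\<eta> x + (\<Sum>j\<in>V. W x j))\<^sup>2 + r\<^sup>2) * exp (- v) - 2 * (\<eta> x + (\<Sum>j\<in>V. W x j)))"
  have P: "(\<Prod>i\<in>?V. exp (- ?u i) / (2 * pi)) = exp (- ?e) / (2 * pi) * (\<Prod>i\<in>V. exp (- u i) / (2 * pi))"
    using fin x by (auto intro!: prod.cong)
  have E: "exp (- energy ?V W \<eta> ?u ?s) = exp (- energy V ?W ?p u s) * exp (- K)"
    unfolding energy_elim[OF p x] K_def[symmetric] by (simp add: exp_diff exp_minus field_simps)
  have "dens_pin ?V W \<eta> ?u ?s = (exp ?e * c * det_on V (A_pin V ?W ?p u)) * (exp (- energy V ?W ?p u s) * exp (- K))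
      * (exp (- ?e) / (2 * pi) * (\<Prod>i\<in>V. exp (- u i) / (2 * pi)))"
    unfolding dens_pin_def P E A_pin_elim[OF p x] c_def ..
  also have "\<dots> = (exp ?e * exp (- ?e)) * (c * (1 / (2 * pi) * exp (- K)) * dens_pin V ?W ?p u s)"
    by (simp add: dens_pin_def)
  also have "exp ?e * exp (- ?e) = 1" by (simp add: exp_minus)
  also have "1 / (2 * pi) * exp (- K) = kern (\<eta> x + (\<Sum>j\<in>V. W x j)) v r"
    by (simp add: kern_def K_def)
  finally show ?thesis by (simp only: c_def mult.assoc mult_1_left)
qed

text \<open>All pivots are positive.\<close>

lemma det_A_pin_pos:
  assumes "pinned V W \<eta>"
  shows "det_on V (A_pin V W \<eta> u) > 0"
proof -
  have "finite V" using assms by (rule pinned_finite)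
  then show ?thesis using assms
  proof (induction V arbitrary: W \<eta>)
    case empty
    then show ?case by (simp add: det_on_def)
  next
    case (insert x V)
    define c where "c = \<eta> x + (\<Sum>j\<in>V. W x j * exp (u j))"
    have c: "c > 0" unfolding c_def using pinned_weighted_pos[OF insert.prems insert.hyps(2)] by simp
    \<comment> \<open>the value of \<open>v\<close> for which reinsertion returns \<open>u x\<close> itself\<close>
    have "u(x := reinsert_u V W \<eta> x (ln c - u x) u) = u" by (simp add: reinsert_u_def c_def fun_eq_iff)
    then show ?case
      using A_pin_elim[OF insert.prems insert.hyps(2), of u "ln c - u x"]
        insert.IH[OF pinned_elim[OF insert.prems insert.hyps(2)], of "exp (ln c - u x)"] c
      by (simp add: c_def[symmetric])
  qed
qed

lemma pair_energy_nonneg: "pair_energy a s b t \<ge> 0"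
  using cosh_real_ge_1[of "a - b"] by (simp add: pair_energy_def)

text \<open>The behaviour of \<open>\<beta>\<close>, \<open>\<theta>\<close> and \<open>\<zeta>\<close> under elimination is that of \<open>H\<close>, of the right-hand side and of the
solution of a linear system: \<open>\<beta>\<close> stays, \<open>\<theta>\<close> is shifted by a multiple of \<open>\<theta>\<^sub>x\<close>, and \<open>\<zeta>\<^sub>x\<close> is an affine
function of the other coordinates of \<open>\<zeta>\<close>.\<close>

lemma coords_reinsert:
  fixes W :: "'v \<Rightarrow> 'v \<Rightarrow> real"
  assumes p: "pinned (insert x V) W \<eta>" and x: "x \<notin> V"
  defines "u' \<equiv> \<lambda>v u. u(x := reinsert_u V W \<eta> x v u)" 
  shows "i \<in> V \<Longrightarrow> beta_at (insert x V) W \<eta> (u' v u) i = beta_at V (elim_W W x (exp v)) (elim_pin W \<eta> x (exp v)) u i"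
    and "beta_at (insert x V) W \<eta> (u' v u) x = 1/2 * (W x x + exp v)"
    and "i \<in> V \<Longrightarrow> theta_at (insert x V) W \<eta> (u' v u) (s(x := reinsert_s V W \<eta> x r u s)) i
        = theta_at V (elim_W W x (exp v)) (elim_pin W \<eta> x (exp v)) u s i - W i x * r / exp v"
    and "theta_at (insert x V) W \<eta> (u' v u) (s(x := reinsert_s V W \<eta> x r u s)) x = r"
    and "zeta (insert x V) (u' v u) (s(x := reinsert_s V W \<eta> x r u s))
        = (zeta V u s)(x := (of_real (\<eta> x) + \<i> * of_real r + (\<Sum>j\<in>V. of_real (W x j) * zeta V u s j)) / of_real (exp v))"
proof -
  have fin: "finite V" using pinned_finite[OF p] by simp
  have sym: "W i x = W x i" if "i \<in> V" for i using pinned_nonneg(3)[OF p, of i x] that by simp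
  define c where "c = \<eta> x + (\<Sum>j\<in>V. W x j * exp (u j))"
  define T where "T = (\<Sum>j\<in>V. W x j * (exp (u j) * s j))"
  have c: "c > 0" unfolding c_def using pinned_weighted_pos[OF p x] by simp
  define ux where "ux = reinsert_u V W \<eta> x v u"
  define sx where "sx = reinsert_s V W \<eta> x r u s"
  have yx: "exp ux = c / exp v"
    unfolding ux_def reinsert_u_def c_def[symmetric] using c by (simp add: exp_ln_diff exp_minus divide_inverse)
  have sx: "sx = (r + T) / c" by (simp add: sx_def reinsert_s_def T_def c_def)
  have tx: "exp ux * sx = (r + T) / exp v" using c by (simp add: yx sx)
  have uV: "(u(x := a)) i = u i" "(s(x := a)) i = s i" if "i \<in> V" for i a using that x by auto
  show "beta_at (insert x V) W \<eta> (u' v u) i = beta_at V (elim_W W x (exp v)) (elim_pin W \<eta> x (exp v)) u i" if i: "i \<in> V"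
  proof -
    have 1: "(\<Sum>j\<in>insert x V. W i j * exp ((u(x := ux)) j)) = W x i * (c / exp v) + (\<Sum>j\<in>V. W i j * exp (u j))"
    proof -
      have "(\<Sum>j\<in>V. W i j * exp ((u(x := ux)) j)) = (\<Sum>j\<in>V. W i j * exp (u j))"
        by (intro sum.cong refl) (simp only: uV)
      then show ?thesis using fin x i by (simp add: yx sym del: fun_upd_apply) (simp add: yx)
    qed
    have 2: "(\<Sum>j\<in>V. elim_W W x (exp v) i j * exp (u j)) = (\<Sum>j\<in>V. W i j * exp (u j)) + W x i / exp v * (\<Sum>j\<in>V. W x j * exp (u j))"
      unfolding elim_W_def sum_distrib_left sum.distrib[symmetric] using i by (intro sum.cong refl) (simp add: sym algebra_simps)
    show ?thesis unfolding beta_at_def u'_def ux_def[symmetric] 1 2 elim_pin_def unfolding uV(1)[OF i] using i 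
      by (simp add: c_def sym add_divide_distrib distrib_left)
  qed
  show "beta_at (insert x V) W \<eta> (u' v u) x = 1/2 * (W x x + exp v)"
  proof -
    have 1: "\<eta> x + (\<Sum>j\<in>insert x V. W x j * exp ((u(x := ux)) j)) = W x x * (c / exp v) + c"
    proof -
      have "(\<Sum>j\<in>V. W x j * exp ((u(x := ux)) j)) = (\<Sum>j\<in>V. W x j * exp (u j))"
        by (intro sum.cong refl) (simp only: uV)
      then show ?thesis by (simp only: sum.insert[OF fin x] fun_upd_same yx) (simp add: c_def)
    qed
    have e: "exp (- ux) = exp v / c" using yx by (simp add: exp_minus)
    have "1/2 * ((W x x * (c / exp v) + c) * (exp v / c)) = 1/2 * (W x x + exp v)"
      using c by (simp add: field_simps)
    then show ?thesis unfolding beta_at_def u'_def ux_def[symmetric] 1 fun_upd_same e .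
  qed
  show "theta_at (insert x V) W \<eta> (u' v u) (s(x := reinsert_s V W \<eta> x r u s)) i
        = theta_at V (elim_W W x (exp v)) (elim_pin W \<eta> x (exp v)) u s i - W i x * r / exp v" if i: "i \<in> V"
  proof -
    have 1: "(\<Sum>j\<in>insert x V. W i j * exp ((u(x := ux)) j) * ((s(x := sx)) i - (s(x := sx)) j))
      = W x i * (c / exp v) * s i - W x i * ((r + T) / exp v) + (\<Sum>j\<in>V. W i j * exp (u j) * (s i - s j))"
    proof -
      have "W x i * exp ux * (s i - sx) = W x i * (c / exp v) * s i - W x i * ((r + T) / exp v)"
        unfolding right_diff_distrib tx[symmetric] yx by (simp add: mult_ac)
      moreover have "(\<Sum>j\<in>V. W i j * exp ((u(x := ux)) j) * ((s(x := sx)) i - (s(x := sx)) j))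
          = (\<Sum>j\<in>V. W i j * exp (u j) * (s i - s j))"
        by (intro sum.cong refl) (simp only: uV i)
      ultimately show ?thesis by (simp only: sum.insert[OF fin x] sym[OF i] uV(2)[OF i] fun_upd_same)
    qed
    have 2: "(\<Sum>j\<in>V. elim_W W x (exp v) i j * exp (u j) * (s i - s j)) = (\<Sum>j\<in>V. W i j * exp (u j) * (s i - s j))
      + (W x i * s i / exp v * (\<Sum>j\<in>V. W x j * exp (u j)) - W x i / exp v * T)"
      unfolding elim_W_def T_def sum_distrib_left sum.distrib[symmetric] sum_subtractf[symmetric] using i
      by (intro sum.cong refl) (simp add: sym field_simps)
    show ?thesis unfolding theta_at_def u'_def ux_def[symmetric] sx_def[symmetric] 1 2 elim_pin_def unfolding uV(2)[OF i] using i 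
      by (simp add: c_def sym add_divide_distrib algebra_simps)
  qed
  show "theta_at (insert x V) W \<eta> (u' v u) (s(x := reinsert_s V W \<eta> x r u s)) x = r"
  proof -
    have 1: "(\<Sum>j\<in>insert x V. W x j * exp ((u(x := ux)) j) * ((s(x := sx)) x - (s(x := sx)) j))
      = sx * (\<Sum>j\<in>V. W x j * exp (u j)) - T"
      unfolding T_def sum_distrib_left sum_subtractf[symmetric]
      using fin x by (auto simp: uV algebra_simps intro!: sum.cong)
    show ?thesis unfolding theta_at_def u'_def ux_def[symmetric] sx_def[symmetric] 1
      using sx c by (simp add: c_def[symmetric] c_def field_simps)
  qed
  show "zeta (insert x V) (u' v u) (s(x := reinsert_s V W \<eta> x r u s))
        = (zeta V u s)(x := (of_real (\<eta> x) + \<i> * of_real r + (\<Sum>j\<in>V. of_real (W x j) * zeta V u s j)) / of_real (exp v))"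
  proof -
    have S: "(\<Sum>j\<in>V. of_real (W x j) * zeta V u s j) = of_real (\<Sum>j\<in>V. W x j * exp (u j)) + \<i> * of_real T"
      unfolding T_def of_real_sum sum_distrib_left sum.distrib[symmetric]
      by (intro sum.cong refl) (simp add: zeta_def algebra_simps)
    have "complex_of_real (exp ux) * (1 + \<i> * of_real sx) = of_real (exp ux) + \<i> * of_real (exp ux * sx)"
      by (simp add: algebra_simps)
    also have "\<dots> = (of_real c + \<i> * of_real (r + T)) / of_real (exp v)"
      unfolding tx unfolding yx by (simp add: add_divide_distrib distrib_left)
    also have "\<dots> = (of_real (\<eta> x) + \<i> * of_real r + (\<Sum>j\<in>V. of_real (W x j) * zeta V u s j)) / of_real (exp v)"
      unfolding S c_def by (simp add: algebra_simps)
    finally show ?thesis using x unfolding zeta_def u'_def ux_def[symmetric] sx_def[symmetric]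
      by (auto simp: fun_eq_iff)
  qed
qed

section \<open>The law of the eliminated vertex\<close>

lemma integral_derivative_vanishing:
  fixes F f :: "real \<Rightarrow> complex"
  assumes "\<And>x. (F has_vector_derivative f x) (at x)" "\<And>x. isCont f x" "integrable lborel f"
    and "(F \<longlongrightarrow> 0) at_bot" "(F \<longlongrightarrow> 0) at_top"
  shows "(\<integral>x. f x \<partial>lborel) = 0"
proof -
  have "(LBINT x=-\<infinity>..\<infinity>. f x) = 0 - 0"
  proof (rule interval_integral_FTC_integrable)
    show "set_integrable lborel (einterval (-\<infinity>) \<infinity>) f"
      using assms(3) by (simp add: einterval_def set_integrable_def)
    show "((F \<circ> real_of_ereal) \<longlongrightarrow> 0) (at_right (-\<infinity>))"
      unfolding ereal_tendsto_simps by (rule assms(4))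
    show "((F \<circ> real_of_ereal) \<longlongrightarrow> 0) (at_left \<infinity>)"
      unfolding ereal_tendsto_simps by (rule assms(5))
    show "(F has_vector_derivative f x) (at x)" for x by (rule assms(1))
    show "isCont f x" for x by (rule assms(2))
  qed simp
  then show ?thesis by (simp add: interval_lebesgue_integral_def einterval_def set_lebesgue_integral_def)
qed

abbreviation leb2 :: "(real \<times> real) measure" where
  "leb2 \<equiv> lborel \<Otimes>\<^sub>M lborel"

lemma kern_borel [measurable]: "case_prod (kern a) \<in> borel_measurable leb2"
  unfolding kern_def by measurable

lemma kern_pos: "kern a v r > 0" by (simp add: kern_def)

text \<open>The marginal of \<open>kern\<close> in \<open>v\<close>: given \<open>v\<close>, the variable \<open>r\<close> is Gaussian with variance \<open>e\<^sup>v\<close>.\<close>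

definition kern_v :: "real \<Rightarrow> real \<Rightarrow> real" where
  "kern_v a v = exp (v / 2) / sqrt (2 * pi) * exp (- 1/2 * (exp v + a\<^sup>2 * exp (- v) - 2 * a))"

lemma kern_normal: "kern a v r = kern_v a v * normal_density 0 (exp (v / 2)) r"
proof -
  have e: "(exp (v/2))\<^sup>2 = exp v" by (simp add: power2_eq_square flip: exp_add)
  have s: "sqrt (2 * pi * exp v) = sqrt (2 * pi) * exp (v/2)"
    unfolding e[symmetric] real_sqrt_mult by simp
  have "kern a v r = 1 / (2 * pi) * (exp (- 1/2 * (exp v + a\<^sup>2 * exp (- v) - 2 * a)) * exp (- r\<^sup>2 / (2 * exp v)))"
  proof -
    have "r\<^sup>2 * exp (- v) = r\<^sup>2 / exp v" by (simp add: exp_minus divide_inverse)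
    then have "- 1/2 * (exp v + (a\<^sup>2 + r\<^sup>2) * exp (- v) - 2 * a)
        = - 1/2 * (exp v + a\<^sup>2 * exp (- v) - 2 * a) + - r\<^sup>2 / (2 * exp v)"
      by (simp add: algebra_simps)
    then show ?thesis unfolding kern_def exp_add[symmetric] by simp
  qed
  also have "1 / (2 * pi) = exp (v/2) / sqrt (2 * pi) * (1 / (sqrt (2 * pi) * exp (v/2)))"
    by (simp add: field_simps)
  finally show ?thesis unfolding kern_v_def normal_density_def e s by simp
qed

lemma nn_integral_normal: "\<sigma> > 0 \<Longrightarrow> (\<integral>\<^sup>+x. ennreal (normal_density \<mu> \<sigma> x) \<partial>lborel) = 1"
  by (subst nn_integral_eq_integral) auto

lemma kern_v_shift:
  assumes "a > 0"
  shows "kern_v a (ln a + w) = sqrt (a / (2 * pi)) * exp (w / 2) * exp (- 2 * a * (sinh (w / 2))\<^sup>2)"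
proof -
  have "exp (ln a / 2) ^ 2 = a" using assms by (simp add: power2_eq_square flip: exp_add)
  then have 1: "exp (ln a / 2) = sqrt a" by (intro real_sqrt_unique[symmetric]) auto
  have c: "cosh w = 1 + 2 * (sinh (w/2))\<^sup>2" using cosh_double[of "w/2"] cosh_square_eq[of "w/2"] by simp
  have "exp (ln a + w) + a\<^sup>2 * exp (- (ln a + w)) - 2 * a = 2 * a * (cosh w - 1)"
    using assms by (simp add: exp_add exp_diff exp_minus cosh_def field_simps power2_eq_square)
  then have "- 1/2 * (exp (ln a + w) + a\<^sup>2 * exp (- (ln a + w)) - 2 * a) = - 2 * a * (sinh (w / 2))\<^sup>2"
    unfolding c by simp
  then show ?thesis unfolding kern_v_def
    by (simp add: add_divide_distrib exp_add 1 real_sqrt_divide)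
qed

text \<open>The substitution \<open>w = 2 arsinh y\<close> turns the integrand into a Gaussian density.\<close>

lemma gauss_sinh_integral:
  assumes "a > 0"
  shows "(\<integral>\<^sup>+w. ennreal (sqrt (a / (2 * pi)) * cosh (w / 2) * exp (- 2 * a * (sinh (w / 2))\<^sup>2)) \<partial>lborel) = 1"
proof -
  let ?f = "\<lambda>w::real. sqrt (a / (2 * pi)) * cosh (w / 2) * exp (- 2 * a * (sinh (w / 2))\<^sup>2)"
  let ?g = "\<lambda>y::real. 2 * arsinh y" and ?g' = "\<lambda>y::real. 2 / sqrt (y\<^sup>2 + 1)"
  have pos: "y\<^sup>2 + 1 > 0" for y :: real by (simp add: add_nonneg_pos)
  have fg: "?f (?g y) * ?g' y = normal_density 0 (1 / (2 * sqrt a)) y" for y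
  proof -
    have "?f (?g y) * ?g' y = 2 * sqrt (a / (2 * pi)) * exp (- 2 * a * y\<^sup>2)"
      using pos[of y] by (simp add: cosh_arsinh_real)
    also have "\<dots> = normal_density 0 (1 / (2 * sqrt a)) y"
      using assms by (simp add: normal_density_def power_divide power_mult_distrib real_sqrt_divide real_sqrt_mult field_simps)
    finally show ?thesis .
  qed
  have sq: "0 < sqrt a" using assms by simp
  have D: "DERIV ?g x :> ?g' x" for x by (auto intro!: derivative_eq_intros)
  have C: "isCont ?f (?g x)" for x by (intro continuous_intros) auto
  have C': "isCont ?g' x" for x using pos[of x] by (intro continuous_intros) auto
  have A: "((ereal \<circ> ?g \<circ> real_of_ereal) \<longlongrightarrow> - \<infinity>) (at_right (- \<infinity>))"
    unfolding ereal_tendsto_simps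
    by (simp add: comp_def filterlim_tendsto_pos_mult_at_bot[OF tendsto_const _ arsinh_real_at_bot])
  have B: "((ereal \<circ> ?g \<circ> real_of_ereal) \<longlongrightarrow> \<infinity>) (at_left \<infinity>)"
    unfolding ereal_tendsto_simps
    by (simp add: comp_def filterlim_tendsto_pos_mult_at_top[OF tendsto_const _ arsinh_real_at_top])
  have I: "set_integrable lborel (einterval (-\<infinity>) \<infinity>) (\<lambda>x. ?f (?g x) * ?g' x)"
    unfolding fg using sq by (simp add: einterval_def set_integrable_def)
  have N: "0 \<le> ?f (?g x)" "0 \<le> ?g' x" for x using assms by auto
  note S = interval_integral_substitution_nonneg[of "-\<infinity>" "\<infinity>" ?g ?g' ?f, OF _ D C C' N A B I]
  have *: "set_integrable lborel (einterval (-\<infinity>) \<infinity>) ?f \<and> (LBINT x=-\<infinity>..\<infinity>. ?f x) = (LBINT x=-\<infinity>..\<infinity>. ?f (?g x) * ?g' x)"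
    using S by simp
  have "integrable lborel ?f" using * by (simp add: einterval_def set_integrable_def)
  moreover have "(\<integral>x. ?f x \<partial>lborel) = 1"
    using * sq unfolding fg by (simp add: interval_lebesgue_integral_def einterval_def set_lebesgue_integral_def)
  ultimately show ?thesis using assms by (subst nn_integral_eq_integral) auto
qed

lemma nn_integral_reflect:
  fixes f :: "real \<Rightarrow> ennreal"
  assumes [measurable]: "f \<in> borel_measurable borel"
  shows "(\<integral>\<^sup>+x. f (- x) \<partial>lborel) = (\<integral>\<^sup>+x. f x \<partial>lborel)"
  using nn_integral_real_affine[of f "-1" 0] by simp

text \<open>The two exponentials \<open>e\<^bsup>w/2\<^esup>\<close> and \<open>e\<^bsup>-w/2\<^esup>\<close> have the same integral by reflection, and their mean
is \<open>cosh (w/2)\<close>. The two signs are the moments of order 0 and 1 of the eliminated vertex.\<close>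

lemma exp_half_sinh_integral:
  assumes "a > 0" "e = 1 \<or> e = -1"
  shows "(\<integral>\<^sup>+w. ennreal (sqrt (a / (2 * pi)) * exp (e * w / 2) * exp (- 2 * a * (sinh (w / 2))\<^sup>2)) \<partial>lborel) = 1"
proof -
  define F where "F = (\<lambda>w::real. ennreal (sqrt (a / (2 * pi)) * exp (e * w / 2) * exp (- 2 * a * (sinh (w / 2))\<^sup>2)))"
  have m [measurable]: "F \<in> borel_measurable borel" unfolding F_def sinh_def by measurable
  have "(\<integral>\<^sup>+w. F w \<partial>lborel) + (\<integral>\<^sup>+w. F w \<partial>lborel) = (\<integral>\<^sup>+w. F w \<partial>lborel) + (\<integral>\<^sup>+w. F (- w) \<partial>lborel)"
    by (simp add: nn_integral_reflect)
  also have "\<dots> = (\<integral>\<^sup>+w. F w + F (- w) \<partial>lborel)" by (subst nn_integral_add) auto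
  also have "\<dots> = (\<integral>\<^sup>+w. 2 * ennreal (sqrt (a / (2 * pi)) * cosh (w / 2) * exp (- 2 * a * (sinh (w / 2))\<^sup>2)) \<partial>lborel)"
  proof (intro nn_integral_cong)
    fix w :: real
    have "F w + F (- w) = ennreal (sqrt (a / (2 * pi)) * exp (e * w / 2) * exp (- 2 * a * (sinh (w / 2))\<^sup>2)
        + sqrt (a / (2 * pi)) * exp (- (e * w / 2)) * exp (- 2 * a * (sinh (w / 2))\<^sup>2))"
      unfolding F_def using assms(1) by (subst ennreal_plus[symmetric]) auto
    also have "\<dots> = ennreal (2 * (sqrt (a / (2 * pi)) * cosh (w / 2) * exp (- 2 * a * (sinh (w / 2))\<^sup>2)))"
      using assms(2) by (auto simp: cosh_def field_simps intro!: arg_cong[where f=ennreal])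
    finally show "F w + F (- w) = 2 * ennreal (sqrt (a / (2 * pi)) * cosh (w / 2) * exp (- 2 * a * (sinh (w / 2))\<^sup>2))"
      by (metis ennreal_mult' ennreal_numeral zero_le_numeral)
  qed
  also have "\<dots> = 2 * 1"
  proof -
    have m: "(\<lambda>w. ennreal (sqrt (a / (2 * pi)) * cosh (w / 2) * exp (- 2 * a * (sinh (w / 2))\<^sup>2))) \<in> borel_measurable lborel"
      unfolding cosh_def sinh_def by measurable
    show ?thesis by (simp only: nn_integral_cmult[OF m] gauss_sinh_integral[OF assms(1)])
  qed
  finally have "2 * (\<integral>\<^sup>+w. F w \<partial>lborel) = 2 * 1" by (simp only: mult_2)
  then show ?thesis unfolding F_def[symmetric] by (subst (asm) ennreal_mult_cancel_left) auto
qed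

lemma nn_integral_kern_v:
  assumes "a > 0"
  shows "(\<integral>\<^sup>+v. ennreal (kern_v a v) \<partial>lborel) = 1"
    and "(\<integral>\<^sup>+v. ennreal (a * exp (- v) * kern_v a v) \<partial>lborel) = 1"
proof -
  have [measurable]: "kern_v a \<in> borel_measurable borel" unfolding kern_v_def by measurable
  have "(\<integral>\<^sup>+v. ennreal (kern_v a v) \<partial>lborel) = (\<integral>\<^sup>+v. ennreal (kern_v a (ln a + v)) \<partial>lborel)"
    by (subst nn_integral_real_affine[of _ 1 "ln a"]) auto
  then show "(\<integral>\<^sup>+v. ennreal (kern_v a v) \<partial>lborel) = 1"
    unfolding kern_v_shift[OF assms] using exp_half_sinh_integral[OF assms, of 1] by simp
  have "(\<integral>\<^sup>+v. ennreal (a * exp (- v) * kern_v a v) \<partial>lborel) = (\<integral>\<^sup>+v. ennreal (a * exp (- (ln a + v)) * kern_v a (ln a + v)) \<partial>lborel)"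
    by (subst nn_integral_real_affine[of _ 1 "ln a"]) auto
  also have "(\<lambda>v. a * exp (- (ln a + v)) * kern_v a (ln a + v)) = (\<lambda>v. sqrt (a / (2 * pi)) * exp (-1 * v / 2) * exp (- 2 * a * (sinh (v / 2))\<^sup>2))"
  proof
    fix v
    have "a * exp (- (ln a + v)) = exp (- v)" using assms by (simp add: exp_add exp_diff exp_minus field_simps)
    moreover have "exp (- v) * exp (v / 2) = exp (-1 * v / 2)" unfolding exp_add[symmetric] by (simp add: field_simps)
    ultimately show "a * exp (- (ln a + v)) * kern_v a (ln a + v) = sqrt (a / (2 * pi)) * exp (-1 * v / 2) * exp (- 2 * a * (sinh (v / 2))\<^sup>2)"
      unfolding kern_v_shift[OF assms] by (simp add: mult_ac)
  qed
  finally show "(\<integral>\<^sup>+v. ennreal (a * exp (- v) * kern_v a v) \<partial>lborel) = 1"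
    using exp_half_sinh_integral[OF assms, of "-1"] by simp
qed

lemma nn_integral_kern:
  assumes "a > 0"
  shows "(\<integral>\<^sup>+v. \<integral>\<^sup>+r. ennreal (kern a v r) \<partial>lborel \<partial>lborel) = 1"
proof -
  have kp: "kern_v a v \<ge> 0" for v by (simp add: kern_v_def)
  have "(\<integral>\<^sup>+r. ennreal (kern a v r) \<partial>lborel) = ennreal (kern_v a v)" for v
    unfolding kern_normal using kp[of v]
    by (simp add: ennreal_mult' nn_integral_cmult nn_integral_normal)
  then show ?thesis using nn_integral_kern_v(1)[OF assms] by simp
qed

text \<open>The value of \<open>\<zeta>\<^sub>x\<close> when all other coordinates of \<open>\<zeta>\<close> equal 1.\<close>

definition psi :: "real \<Rightarrow> real \<Rightarrow> real \<Rightarrow> complex" where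
  "psi a v r = (of_real a + \<i> * of_real r) * of_real (exp (- v))"

text \<open>The Gibbs factor of \<open>kern\<close> with half the exponent, which dominates all moments of \<open>psi\<close>.\<close>

definition kern_majorant :: "real \<Rightarrow> real \<Rightarrow> real \<Rightarrow> real" where
  "kern_majorant a v r = exp (- 1/4 * (exp v + (a\<^sup>2 + r\<^sup>2) * exp (- v)))"

lemma kern_majorant_borel [measurable]: "case_prod (kern_majorant a) \<in> borel_measurable leb2"
  unfolding kern_majorant_def by measurable

lemma psi_borel [measurable]: "case_prod (psi a) \<in> borel_measurable leb2"
  unfolding psi_def by measurable

lemma power_le_fact_exp:
  fixes x :: real
  assumes "x \<ge> 0"
  shows "x ^ k \<le> fact k * exp x"
proof -
  have "(\<Sum>n\<in>{k}. x ^ n /\<^sub>R fact n) \<le> (\<Sum>n. x ^ n /\<^sub>R fact n)"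
    by (rule sum_le_suminf[OF summable_exp_generic]) (use assms in auto)
  then show ?thesis by (simp add: exp_def field_simps)
qed

text \<open>Halving the exponent is a rescaling of both variables, so the majorant is integrable because \<open>kern\<close>
is.\<close>

lemma kern_majorant_rescale: "kern_majorant a (ln 2 + v) (2 * r) = 2 * pi * exp (- a / 2) * kern (a / 2) v r"
proof -
  have "- 1/4 * (exp (ln 2 + v) + (a\<^sup>2 + (2 * r)\<^sup>2) * exp (- (ln 2 + v)))
     = - a / 2 + - 1 / 2 * (exp v + ((a/2)\<^sup>2 + r\<^sup>2) * exp (- v) - 2 * (a/2))"
    by (simp add: exp_add exp_diff exp_minus field_simps)
  then show ?thesis unfolding kern_majorant_def kern_def by (simp add: exp_add[symmetric])
qed

lemma integrable_kern_majorant: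
  assumes "a > 0"
  shows "integrable leb2 (case_prod (kern_majorant a))"
proof (rule integrableI_nonneg)
  have [measurable]: "kern_majorant a v \<in> borel_measurable borel" for v unfolding kern_majorant_def by measurable
  have [measurable]: "kern b v \<in> borel_measurable borel" for b v unfolding kern_def by measurable
  define G where "G = (\<lambda>v. \<integral>\<^sup>+r. ennreal (kern_majorant a v r) \<partial>lborel)"
  have [measurable]: "G \<in> borel_measurable borel" unfolding G_def by measurable
  have [measurable]: "(\<lambda>v. \<integral>\<^sup>+r. ennreal (kern (a/2) v r) \<partial>lborel) \<in> borel_measurable borel" by measurable
  have G: "G (ln 2 + v) = ennreal (4 * pi * exp (- a / 2)) * (\<integral>\<^sup>+r. ennreal (kern (a/2) v r) \<partial>lborel)" for v
  proof -
    have "G (ln 2 + v) = ennreal \<bar>2\<bar> * (\<integral>\<^sup>+r. ennreal (kern_majorant a (ln 2 + v) (0 + 2 * r)) \<partial>lborel)"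
      unfolding G_def by (rule nn_integral_real_affine) auto
    also have "\<dots> = ennreal 2 * (ennreal (2 * pi * exp (- a / 2)) * (\<integral>\<^sup>+r. ennreal (kern (a/2) v r) \<partial>lborel))"
      by (simp add: kern_majorant_rescale ennreal_mult' nn_integral_cmult)
    finally show ?thesis by (simp add: mult.assoc[symmetric] ennreal_mult''[symmetric] del: ennreal_numeral)
  qed
  have "(\<integral>\<^sup>+x. ennreal (case_prod (kern_majorant a) x) \<partial>leb2) = (\<integral>\<^sup>+v. G v \<partial>lborel)"
    unfolding G_def by (subst lborel.nn_integral_fst[symmetric]) auto
  also have "\<dots> = (\<integral>\<^sup>+v. G (ln 2 + 1 * v) \<partial>lborel)"
    by (subst nn_integral_real_affine[of _ 1 "ln 2"]) auto
  also have "\<dots> = ennreal (4 * pi * exp (- a / 2)) * 1"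
    using assms by (simp add: G nn_integral_cmult nn_integral_kern)
  finally show "(\<integral>\<^sup>+x. ennreal (case_prod (kern_majorant a) x) \<partial>leb2) < \<infinity>" by simp
qed (auto simp: kern_majorant_def)

lemma norm_psi: "norm (psi a v r) = sqrt (a\<^sup>2 + r\<^sup>2) * exp (- v)"
proof -
  have "norm (of_real a + \<i> * complex_of_real r) = sqrt (a\<^sup>2 + r\<^sup>2)" by (simp add: cmod_def)
  then show ?thesis unfolding psi_def norm_mult by (simp only: norm_of_real abs_exp_cancel)
qed

text \<open>Powers of \<open>e\<^sup>-\<^sup>v\<close> are thus controlled by powers of \<open>\<bar>psi\<bar>\<close>, so that one family of bounds suffices.\<close>

lemma exp_le_psi:
  assumes "a > 0"
  shows "exp (- v) \<le> norm (psi a v r) / a"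
proof -
  have "a \<le> sqrt (a\<^sup>2 + r\<^sup>2)" using assms by (intro real_le_rsqrt) simp
  then have "a * exp (- v) \<le> norm (psi a v r)" unfolding norm_psi by (intro mult_right_mono) auto
  then show ?thesis using assms by (simp add: field_simps)
qed

text \<open>With \<open>R = (a\<^sup>2 + r\<^sup>2) e\<^sup>-\<^sup>v\<close> one has \<open>\<bar>psi\<bar> \<le> R / a\<close>, and half of the exponent \<open>R / 2\<close> absorbs the power
of \<open>R\<close>.\<close>

lemma psi_power_kern_bound:
  assumes "a > 0"
  obtains C where "C \<ge> 0" "\<And>v r. norm (psi a v r) ^ k * kern a v r \<le> C * kern_majorant a v r"
proof
  let ?C = "1 / (2 * pi) * exp a * ((4 / a) ^ k * fact k)"
  show "?C \<ge> 0" using assms by simp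
  fix v r
  define R where "R = (a\<^sup>2 + r\<^sup>2) * exp (- v)"
  have R0: "R \<ge> 0" by (simp add: R_def)
  define q where "q = sqrt (a\<^sup>2 + r\<^sup>2)"
  have q: "a \<le> q" using assms unfolding q_def by (intro real_le_rsqrt) simp
  have "q * a \<le> q * q" using q assms by (intro mult_left_mono) auto
  then have "q * a * exp (- v) \<le> R" unfolding R_def q_def by (simp add: mult_right_mono)
  then have "norm (psi a v r) \<le> R / a" using assms
    unfolding norm_psi q_def[symmetric] by (simp add: field_simps)
  then have "norm (psi a v r) ^ k \<le> (4 / a * (R / 4)) ^ k" by (intro power_mono) auto
  also have "\<dots> = (4 / a) ^ k * (R / 4) ^ k" by (rule power_mult_distrib)
  also have "\<dots> \<le> (4 / a) ^ k * (fact k * exp (R / 4))"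
    using assms R0 by (intro mult_left_mono power_le_fact_exp) auto
  finally have 1: "norm (psi a v r) ^ k \<le> (4 / a) ^ k * fact k * exp (R / 4)" by simp
  have "kern a v r = 1 / (2 * pi) * exp a * (exp (- 1/2 * exp v) * exp (- R / 2))"
    unfolding kern_def mult.assoc exp_add[symmetric] R_def[symmetric] by (simp add: field_simps)
  then have "norm (psi a v r) ^ k * kern a v r \<le> (4 / a) ^ k * fact k * exp (R / 4) * (1 / (2 * pi) * exp a * (exp (- 1/2 * exp v) * exp (- R / 2)))"
    by (simp only:) (intro mult_right_mono 1, simp)
  also have "\<dots> = ?C * (exp (- 1/2 * exp v) * (exp (R / 4) * exp (- R / 2)))" by simp
  also have "exp (R / 4) * exp (- R / 2) = exp (- R / 4)" unfolding exp_add[symmetric] by simp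
  also have "?C * (exp (- 1/2 * exp v) * exp (- R / 4)) \<le> ?C * (exp (- 1/4 * exp v) * exp (- R / 4))"
    using assms by (intro mult_left_mono mult_right_mono) auto
  also have "exp (- 1/4 * exp v) * exp (- R / 4) = kern_majorant a v r"
    unfolding kern_majorant_def R_def exp_add[symmetric] by (simp add: field_simps)
  finally show "norm (psi a v r) ^ k * kern a v r \<le> ?C * kern_majorant a v r" .
qed

lemma integrable_psi_kern_bound:
  fixes F :: "real \<times> real \<Rightarrow> complex"
  assumes "a > 0" and [measurable]: "F \<in> borel_measurable leb2"
    and b: "\<And>v r. norm (F (v, r)) \<le> c * norm (psi a v r) ^ k * kern a v r"
  shows "integrable leb2 F"
proof -
  obtain C where C: "C \<ge> 0" "\<And>v r. norm (psi a v r) ^ k * kern a v r \<le> C * kern_majorant a v r"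
    using psi_power_kern_bound[OF assms(1)] by blast
  have "norm (F (v, r)) \<le> norm (\<bar>c\<bar> * C * kern_majorant a v r)" for v r
  proof -
    have "norm (F (v, r)) \<le> c * (norm (psi a v r) ^ k * kern a v r)" using b[of v r] by (simp add: mult.assoc)
    also have "\<dots> \<le> \<bar>c\<bar> * (norm (psi a v r) ^ k * kern a v r)"
      using kern_pos[of a v r] by (intro mult_right_mono) auto
    also have "\<dots> \<le> \<bar>c\<bar> * (C * kern_majorant a v r)" by (intro mult_left_mono C) auto
    finally show ?thesis by (simp add: mult.assoc)
  qed
  then show ?thesis
    by (intro Bochner_Integration.integrable_bound[OF integrable_mult_right[OF integrable_kern_majorant[OF assms(1)], of "\<bar>c\<bar> * C"]])
       (auto simp: mult.assoc)
qed

lemma kern_majorant_limits: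
  assumes "a > 0"
  shows "((\<lambda>v. kern_majorant a v r) \<longlongrightarrow> 0) at_top" "((\<lambda>v. kern_majorant a v r) \<longlongrightarrow> 0) at_bot"
    "((\<lambda>r. kern_majorant a v r) \<longlongrightarrow> 0) at_top" "((\<lambda>r. kern_majorant a v r) \<longlongrightarrow> 0) at_bot"
proof -
  have T: "((\<lambda>x. exp (- 1/4 * f x)) \<longlongrightarrow> 0) G" if "filterlim f at_top G" for f :: "real \<Rightarrow> real" and G
    by (rule filterlim_compose[OF exp_at_bot]) (rule filterlim_tendsto_neg_mult_at_bot[OF tendsto_const _ that], simp)
  have p: "a\<^sup>2 + r\<^sup>2 > 0" using assms by (simp add: add_pos_nonneg)
  have up: "filterlim (\<lambda>v::real. exp (- v)) at_top at_bot"
    by (rule filterlim_compose[OF exp_at_top filterlim_uminus_at_top_at_bot])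
  have sq: "filterlim (\<lambda>r::real. (a\<^sup>2 + r\<^sup>2) * exp (- v)) at_top F" if "filterlim (\<lambda>r::real. r\<^sup>2) at_top F" for F
  proof -
    have "filterlim (\<lambda>r. a\<^sup>2 + r\<^sup>2) at_top F" using that by (rule filterlim_tendsto_add_at_top[OF tendsto_const])
    then have "filterlim (\<lambda>r. exp (- v) * (a\<^sup>2 + r\<^sup>2)) at_top F"
      by (rule filterlim_tendsto_pos_mult_at_top[OF tendsto_const, rotated]) simp
    then show ?thesis by (simp add: mult.commute)
  qed
  have "filterlim (\<lambda>v. exp v + (a\<^sup>2 + r\<^sup>2) * exp (- v)) at_top at_top"
    by (rule filterlim_at_top_mono[OF exp_at_top]) (use p in auto)
  then show "((\<lambda>v. kern_majorant a v r) \<longlongrightarrow> 0) at_top" unfolding kern_majorant_def by (rule T)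
  have "filterlim (\<lambda>v. (a\<^sup>2 + r\<^sup>2) * exp (- v)) at_top at_bot"
    by (rule filterlim_tendsto_pos_mult_at_top[OF tendsto_const p up])
  then have "filterlim (\<lambda>v. exp v + (a\<^sup>2 + r\<^sup>2) * exp (- v)) at_top at_bot"
    by (rule filterlim_at_top_mono) auto
  then show "((\<lambda>v. kern_majorant a v r) \<longlongrightarrow> 0) at_bot" unfolding kern_majorant_def by (rule T)
  have "filterlim (\<lambda>r::real. r\<^sup>2) at_top at_top" by (intro filterlim_pow_at_top filterlim_ident) auto
  from sq[OF this] show "((\<lambda>r. kern_majorant a v r) \<longlongrightarrow> 0) at_top" unfolding kern_majorant_def
    by (intro T filterlim_tendsto_add_at_top[OF tendsto_const])
  have "filterlim (\<lambda>r::real. r\<^sup>2) at_top at_bot"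
    by (rule filterlim_pow_at_bot_even) (auto intro: filterlim_ident)
  from sq[OF this] show "((\<lambda>r. kern_majorant a v r) \<longlongrightarrow> 0) at_bot" unfolding kern_majorant_def
    by (intro T filterlim_tendsto_add_at_top[OF tendsto_const])
qed

lemma kern_has_derivative:
  "((\<lambda>v. kern a v r) has_real_derivative kern a v r * (- 1/2 * (exp v - (a\<^sup>2 + r\<^sup>2) * exp (- v)))) (at v)"
  "((\<lambda>r. kern a v r) has_real_derivative kern a v r * (- r * exp (- v))) (at r)"
  unfolding kern_def by (auto intro!: derivative_eq_intros simp: field_simps)

text \<open>The moments do not change from order \<open>m\<close> to order \<open>m + 2\<close> because \<open>(\<psi>\<^sup>2 - 1) \<psi>\<^sup>m kern\<close> is a divergence. \<open>DX\<close> is the derivative in \<open>v\<close> of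
\<open>e\<^sup>-\<^sup>v \<psi>\<^sup>m kern\<close> and \<open>DY\<close> is the derivative in \<open>r\<close> of \<open>\<psi>\<^bsup>m+1\<^esup> kern\<close>. The complex factor is chosen so that
\<open>\<bar>a + \<i> r\<bar>\<^sup>2 + 2 \<i> r (a + \<i> r) = (a + \<i> r)\<^sup>2\<close> turns a square of the modulus into a square.\<close>

lemma psi_recursion_identity:
  fixes m :: nat
  defines "DX \<equiv> \<lambda>a v r. of_real (exp (- v)) * psi a v r ^ m * of_real (kern a v r) *
      of_real (- 1 - real m - 1/2 * exp v + 1/2 * ((a\<^sup>2 + r\<^sup>2) * exp (- v)))"
    and "DY \<equiv> \<lambda>a v r. (of_nat (Suc m) * \<i> * of_real (exp (- v)) * psi a v r ^ m
      - psi a v r ^ Suc m * of_real (r * exp (- v))) * of_real (kern a v r)"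
  shows "2 * DX a v r - 2 * \<i> * DY a v r = psi a v r ^ (m + 2) * of_real (kern a v r) - psi a v r ^ m * of_real (kern a v r)"
proof -
  define E where "E = complex_of_real (exp (- v))"
  define H where "H = complex_of_real (exp v)"
  define p where "p = psi a v r ^ m"
  define K where "K = complex_of_real (kern a v r)"
  define z where "z = psi a v r"
  have EH: "E * H = 1" unfolding E_def H_def by (simp add: exp_minus flip: of_real_mult)
  have z: "z = (of_real a + \<i> * of_real r) * E" by (simp add: z_def psi_def E_def)
  have "2 * DX a v r - 2 * \<i> * DY a v r =
    E * p * K * (- 2 - 2 * of_nat m - H + (of_real a ^ 2 + of_real r ^ 2) * E) - 2 * \<i> * ((of_nat m + 1) * \<i> * E * p - z * p * (of_real r * E)) * K"
    unfolding DX_def DY_def by (simp add: E_def H_def p_def K_def z_def algebra_simps)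
  also have "\<dots> = z * z * p * K - (E * H) * (p * K)"
    unfolding z by (simp add: algebra_simps power2_eq_square)
  finally show ?thesis unfolding EH by (simp add: z_def p_def K_def power_add power2_eq_square mult_ac)
qed

text \<open>Both derivatives integrate to 0 along almost every line, since the functions vanish at infinity and
the derivatives are integrable.\<close>

lemma psi_moment_step:
  assumes a: "a > 0"
  shows "(\<integral>(v, r). psi a v r ^ (m + 2) * of_real (kern a v r) \<partial>leb2)
       = (\<integral>(v, r). psi a v r ^ m * of_real (kern a v r) \<partial>leb2)"
proof -
  let ?L = "leb2"
  define X where "X = (\<lambda>v r. of_real (exp (- v)) * psi a v r ^ m * of_real (kern a v r))"
  define Y where "Y = (\<lambda>v r. psi a v r ^ Suc m * of_real (kern a v r))"
  define DX where "DX = (\<lambda>v r. of_real (exp (- v)) * psi a v r ^ m * of_real (kern a v r) *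
      of_real (- 1 - real m - 1/2 * exp v + 1/2 * ((a\<^sup>2 + r\<^sup>2) * exp (- v))))"
  define DY where "DY = (\<lambda>v r. (of_nat (Suc m) * \<i> * of_real (exp (- v)) * psi a v r ^ m
      - psi a v r ^ Suc m * of_real (r * exp (- v))) * of_real (kern a v r))"
  have kp: "kern a v r \<ge> 0" for v r using kern_pos[of a v r] by simp
  have np: "norm (psi a v r) \<ge> 0" for v r by simp
  have I1: "integrable ?L (\<lambda>(v, r). psi a v r ^ n * of_real (kern a v r))" for n
    by (rule integrable_psi_kern_bound[OF a, where c=1 and k=n]) (auto simp: norm_mult norm_power kp)
  have I2: "integrable ?L (\<lambda>(v, r). of_real (exp (- v)) * psi a v r ^ n * of_real (kern a v r))" for n
  proof (rule integrable_psi_kern_bound[OF a, where c="1/a" and k="Suc n"])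
    fix v r
    have "exp (- v) * (norm (psi a v r) ^ n * kern a v r) \<le> norm (psi a v r) / a * (norm (psi a v r) ^ n * kern a v r)"
      by (intro mult_right_mono exp_le_psi a mult_nonneg_nonneg zero_le_power kp np)
    then show "norm (case (v, r) of (v, r) \<Rightarrow> of_real (exp (- v)) * psi a v r ^ n * of_real (kern a v r)) \<le> 1/a * norm (psi a v r) ^ Suc n * kern a v r"
      by (simp add: norm_mult norm_power kp mult.assoc)
  qed simp
  have I3: "integrable ?L (\<lambda>(v, r). of_real ((a\<^sup>2 + r\<^sup>2) * exp (- v) * exp (- v)) * (psi a v r ^ m * of_real (kern a v r)))"
  proof (rule integrable_psi_kern_bound[OF a, where c="1" and k="m+2"])
    fix v r
    have "(a\<^sup>2 + r\<^sup>2) * exp (- v) * exp (- v) = norm (psi a v r) ^ 2"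
      unfolding norm_psi power_mult_distrib by (simp add: power2_eq_square[of "exp _"])
    then show "norm (case (v, r) of (v, r) \<Rightarrow> of_real ((a\<^sup>2 + r\<^sup>2) * exp (- v) * exp (- v)) * (psi a v r ^ m * of_real (kern a v r))) \<le> 1 * norm (psi a v r) ^ (m+2) * kern a v r"
      by (simp add: norm_mult norm_power kp power_add power2_eq_square mult_ac del: of_real_mult of_real_add)
  qed simp
  have I4: "integrable ?L (\<lambda>(v, r). of_real (r * exp (- v)) * (psi a v r ^ Suc m * of_real (kern a v r)))"
  proof (rule integrable_psi_kern_bound[OF a, where c="1" and k="Suc (Suc m)"])
    fix v r
    have "\<bar>r\<bar> \<le> sqrt (a\<^sup>2 + r\<^sup>2)" by (intro real_le_rsqrt) simp
    then have "\<bar>r * exp (- v)\<bar> \<le> norm (psi a v r)" unfolding norm_psi abs_mult by (simp add: mult_right_mono)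
    then have "\<bar>r * exp (- v)\<bar> * (norm (psi a v r) ^ Suc m * kern a v r) \<le> norm (psi a v r) * (norm (psi a v r) ^ Suc m * kern a v r)"
      by (intro mult_right_mono mult_nonneg_nonneg zero_le_power kp np)
    then show "norm (case (v, r) of (v, r) \<Rightarrow> of_real (r * exp (- v)) * (psi a v r ^ Suc m * of_real (kern a v r))) \<le> 1 * norm (psi a v r) ^ Suc (Suc m) * kern a v r"
      by (simp add: norm_mult norm_power kp mult.assoc del: of_real_mult)
  qed simp
  have DXi: "integrable ?L (\<lambda>(v, r). DX v r)"
  proof -
    have e: "exp (- v) * exp v = 1" for v :: real by (simp add: exp_minus)
    have key: "DX v r = of_real (- 1 - real m) * (of_real (exp (- v)) * psi a v r ^ m * of_real (kern a v r))
       + (- 1/2 * (psi a v r ^ m * of_real (kern a v r))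
         + 1/2 * (of_real ((a\<^sup>2 + r\<^sup>2) * exp (- v) * exp (- v)) * (psi a v r ^ m * of_real (kern a v r))))" for v r
    proof -
      have "DX v r = of_real (exp (- v) * (- 1 - real m - 1/2 * exp v + 1/2 * ((a\<^sup>2 + r\<^sup>2) * exp (- v)))) * (psi a v r ^ m * of_real (kern a v r))"
        by (simp add: DX_def)
      also have "exp (- v) * (- 1 - real m - 1/2 * exp v + 1/2 * ((a\<^sup>2 + r\<^sup>2) * exp (- v)))
         = (- 1 - real m) * exp (- v) + (- 1/2 * (exp (- v) * exp v) + 1/2 * ((a\<^sup>2 + r\<^sup>2) * exp (- v) * exp (- v)))"
        by (simp add: algebra_simps)
      finally show ?thesis unfolding e by (simp add: algebra_simps)
    qed
    have "(\<lambda>(v, r). DX v r) = (\<lambda>x. of_real (- 1 - real m) * (case x of (v, r) \<Rightarrow> of_real (exp (- v)) * psi a v r ^ m * of_real (kern a v r))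
       + (- 1/2 * (case x of (v, r) \<Rightarrow> psi a v r ^ m * of_real (kern a v r))
         + 1/2 * (case x of (v, r) \<Rightarrow> of_real ((a\<^sup>2 + r\<^sup>2) * exp (- v) * exp (- v)) * (psi a v r ^ m * of_real (kern a v r)))))"
      by (rule ext, clarify) (simp only: prod.case key)
    then show ?thesis using I1[of m] I2[of m] I3
      by (simp only:) (intro Bochner_Integration.integrable_add integrable_mult_right)
  qed
  have DYi: "integrable ?L (\<lambda>(v, r). DY v r)"
  proof -
    have "(\<lambda>(v, r). DY v r) = (\<lambda>x. (of_nat (Suc m) * \<i>) * (case x of (v, r) \<Rightarrow> of_real (exp (- v)) * psi a v r ^ m * of_real (kern a v r))
       - (case x of (v, r) \<Rightarrow> of_real (r * exp (- v)) * (psi a v r ^ Suc m * of_real (kern a v r))))"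
      by (rule ext) (auto simp: DY_def algebra_simps)
    then show ?thesis using I2[of m] I4
      by (simp only:) (intro Bochner_Integration.integrable_diff integrable_mult_right)
  qed
  have Xb: "norm (X v r) \<le> 1/a * (norm (psi a v r) ^ Suc m * kern a v r)" for v r
  proof -
    have "exp (- v) * (norm (psi a v r) ^ m * kern a v r) \<le> norm (psi a v r) / a * (norm (psi a v r) ^ m * kern a v r)"
      by (intro mult_right_mono exp_le_psi a mult_nonneg_nonneg zero_le_power kp np)
    then show ?thesis by (simp add: X_def norm_mult norm_power kp mult.assoc)
  qed
  obtain C where C: "C \<ge> 0" "\<And>v r. norm (psi a v r) ^ Suc m * kern a v r \<le> C * kern_majorant a v r"
    using psi_power_kern_bound[OF a] by blast
  have Xl: "norm (X v r) \<le> kern_majorant a v r * (1/a * C)" for v r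
    using Xb[of v r] mult_left_mono[OF C(2)[of v r], of "1/a"] a by (simp add: mult_ac)
  have Yl: "norm (Y v r) \<le> kern_majorant a v r * C" for v r
    using C(2)[of v r] by (simp add: Y_def norm_mult norm_power kp mult_ac)
  have IX: "(\<integral>v. DX v r \<partial>lborel) = 0" if "integrable lborel (\<lambda>v. DX v r)" for r
  proof (rule integral_derivative_vanishing[where F="\<lambda>v. X v r", OF _ _ that])
    fix v
    define Z where "Z = (of_real a + \<i> * of_real r :: complex) ^ m"
    have ex: "exp (- v) * exp (- v) ^ m = exp (- (real (Suc m) * v))" for v :: real
      by (simp add: exp_of_nat_mult[symmetric] exp_add[symmetric] algebra_simps)
    have Xr: "X v r = of_real (exp (- (real (Suc m) * v)) * kern a v r) * Z" for v
      unfolding ex[symmetric] X_def psi_def Z_def power_mult_distrib by simp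
    have "((\<lambda>v. exp (- (real (Suc m) * v)) * kern a v r) has_real_derivative
       (exp (- (real (Suc m) * v)) * kern a v r) * (- 1 - real m - 1/2 * exp v + 1/2 * ((a\<^sup>2 + r\<^sup>2) * exp (- v)))) (at v)"
      by (rule derivative_eq_intros kern_has_derivative refl | simp)+ (simp add: field_simps)
    then have "((\<lambda>v. of_real (exp (- (real (Suc m) * v)) * kern a v r) * Z) has_vector_derivative
       of_real ((exp (- (real (Suc m) * v)) * kern a v r) * (- 1 - real m - 1/2 * exp v + 1/2 * ((a\<^sup>2 + r\<^sup>2) * exp (- v)))) * Z) (at v)"
      by (intro has_vector_derivative_mult_left has_vector_derivative_of_real)
        (simp add: has_real_derivative_iff_has_vector_derivative)
    moreover have "DX v r = X v r * of_real (- 1 - real m - 1/2 * exp v + 1/2 * ((a\<^sup>2 + r\<^sup>2) * exp (- v)))"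
      by (simp only: DX_def X_def)
    ultimately show "((\<lambda>v. X v r) has_vector_derivative DX v r) (at v)"
      by (simp add: Xr[abs_def] mult_ac)
    show "isCont (\<lambda>v. DX v r) v" unfolding DX_def psi_def kern_def by (intro continuous_intros)
  next
    show "((\<lambda>v. X v r) \<longlongrightarrow> 0) at_bot"
      by (rule tendsto_0_le[OF kern_majorant_limits(2)[OF a], where K="1/a * C"]) (use Xl in \<open>auto simp: kern_majorant_def intro!: always_eventually\<close>)
    show "((\<lambda>v. X v r) \<longlongrightarrow> 0) at_top"
      by (rule tendsto_0_le[OF kern_majorant_limits(1)[OF a], where K="1/a * C"]) (use Xl in \<open>auto simp: kern_majorant_def intro!: always_eventually\<close>)
  qed
  have IY: "(\<integral>r. DY v r \<partial>lborel) = 0" if "integrable lborel (\<lambda>r. DY v r)" for v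
  proof (rule integral_derivative_vanishing[where F="\<lambda>r. Y v r", OF _ _ that])
    fix r
    define E where "E = complex_of_real (exp (- v))"
    have "((\<lambda>w. (of_real a + \<i> * w) * E) has_field_derivative \<i> * E) (at (of_real r))"
      by (auto intro!: derivative_eq_intros)
    from DERIV_power_Suc[OF this, of m]
    have "((\<lambda>w. ((of_real a + \<i> * w) * E) ^ Suc m) has_field_derivative of_nat (Suc m) * \<i> * E * psi a v r ^ m) (at (of_real r))"
      unfolding psi_def E_def[symmetric] by (simp only: of_nat_Suc mult_ac)
    from has_vector_derivative_real_field[OF this]
    have "((\<lambda>r. psi a v r ^ Suc m) has_vector_derivative of_nat (Suc m) * \<i> * E * psi a v r ^ m) (at r)"
      by (simp add: psi_def E_def)
    from has_vector_derivative_mult[OF this has_vector_derivative_of_real[OF kern_has_derivative(2)]]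
    have "((\<lambda>r. psi a v r ^ Suc m * of_real (kern a v r)) has_vector_derivative
       (psi a v r ^ Suc m * of_real (kern a v r * (- r * exp (- v))) + of_nat (Suc m) * \<i> * E * psi a v r ^ m * of_real (kern a v r))) (at r)" .
    then show "((\<lambda>r. Y v r) has_vector_derivative DY v r) (at r)"
      by (simp add: Y_def DY_def E_def algebra_simps)
    show "isCont (\<lambda>r. DY v r) r" unfolding DY_def psi_def kern_def by (intro continuous_intros)
  next
    show "((\<lambda>r. Y v r) \<longlongrightarrow> 0) at_bot"
      by (rule tendsto_0_le[OF kern_majorant_limits(4)[OF a], where K=C]) (use Yl in \<open>auto simp: kern_majorant_def intro!: always_eventually\<close>)
    show "((\<lambda>r. Y v r) \<longlongrightarrow> 0) at_top"
      by (rule tendsto_0_le[OF kern_majorant_limits(3)[OF a], where K=C]) (use Yl in \<open>auto simp: kern_majorant_def intro!: always_eventually\<close>)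
  qed
  have "(\<integral>(v, r). DX v r \<partial>?L) = (\<integral>r. \<integral>v. DX v r \<partial>lborel \<partial>lborel)"
    using lborel_pair.integral_snd[OF DXi] by simp
  also have "\<dots> = 0"
  proof (rule integral_eq_zero_AE)
    show "AE r in lborel. (\<integral>v. DX v r \<partial>lborel) = 0"
      using lborel_pair.AE_integrable_snd[OF DXi] by eventually_elim (rule IX)
  qed
  finally have 1: "(\<integral>(v, r). DX v r \<partial>?L) = 0" by simp
  have "(\<integral>(v, r). DY v r \<partial>?L) = (\<integral>v. \<integral>r. DY v r \<partial>lborel \<partial>lborel)"
    using lborel_pair.integral_fst[OF DYi] by simp
  also have "\<dots> = 0"
  proof (rule integral_eq_zero_AE)
    show "AE v in lborel. (\<integral>r. DY v r \<partial>lborel) = 0"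
      using lborel_pair.AE_integrable_fst[OF DYi] by eventually_elim (rule IY)
  qed
  finally have 2: "(\<integral>(v, r). DY v r \<partial>?L) = 0" by simp
  have "(\<integral>x. 2 * (case x of (v, r) \<Rightarrow> DX v r) - 2 * \<i> * (case x of (v, r) \<Rightarrow> DY v r) \<partial>?L) = 0"
    using DXi DYi by (subst Bochner_Integration.integral_diff) (simp_all add: 1 2)
  also have "(\<lambda>x. 2 * (case x of (v, r) \<Rightarrow> DX v r) - 2 * \<i> * (case x of (v, r) \<Rightarrow> DY v r))
     = (\<lambda>x. (case x of (v, r) \<Rightarrow> psi a v r ^ (m + 2) * of_real (kern a v r)) - (case x of (v, r) \<Rightarrow> psi a v r ^ m * of_real (kern a v r)))"
    by (rule ext, clarify) (simp only: prod.case DX_def DY_def psi_recursion_identity)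
  also have "(\<integral>x. (case x of (v, r) \<Rightarrow> psi a v r ^ (m + 2) * of_real (kern a v r)) - (case x of (v, r) \<Rightarrow> psi a v r ^ m * of_real (kern a v r)) \<partial>?L)
    = (\<integral>(v, r). psi a v r ^ (m + 2) * of_real (kern a v r) \<partial>?L) - (\<integral>(v, r). psi a v r ^ m * of_real (kern a v r) \<partial>?L)"
    by (rule Bochner_Integration.integral_diff[OF I1 I1])
  finally show ?thesis by simp
qed

text \<open>The recursion has step 2 and links orders of equal parity only; order 1 needs its own integral. That
one is real, because the Gaussian variable \<open>r\<close> has mean 0.\<close>

lemma psi_moments:
  assumes a: "a > 0"
  shows "integrable leb2 (\<lambda>(v, r). psi a v r ^ m * of_real (kern a v r))"
    and "(\<integral>(v, r). psi a v r ^ m * of_real (kern a v r) \<partial>leb2) = 1"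
proof -
  let ?L = "leb2"
  have kp: "kern a v r \<ge> 0" for v r using kern_pos[of a v r] by simp
  have I: "integrable ?L (\<lambda>(v, r). psi a v r ^ n * of_real (kern a v r))" for n
    by (rule integrable_psi_kern_bound[OF a, where c=1 and k=n]) (auto simp: norm_mult norm_power kp)
  show "integrable ?L (\<lambda>(v, r). psi a v r ^ m * of_real (kern a v r))" by (rule I)
  have [measurable]: "kern_v a \<in> borel_measurable borel" unfolding kern_v_def by measurable
  have kmp: "kern_v a v \<ge> 0" for v by (simp add: kern_v_def)
  have inner0: "(\<integral>r. complex_of_real (kern a v r) \<partial>lborel) = of_real (kern_v a v)" for v
    unfolding kern_normal by simp
  have inner1: "(\<integral>r. psi a v r * of_real (kern a v r) \<partial>lborel) = of_real (a * exp (- v) * kern_v a v)" for v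
  proof -
    have "(\<lambda>r. psi a v r * of_real (kern a v r)) = (\<lambda>r. of_real (a * exp (- v) * kern_v a v) * of_real (normal_density 0 (exp (v/2)) r)
      + \<i> * of_real (exp (- v) * kern_v a v) * of_real (normal_density 0 (exp (v/2)) r * r))"
      by (rule ext) (simp add: psi_def kern_normal algebra_simps)
    moreover have "has_bochner_integral lborel (\<lambda>r. normal_density 0 (exp (v/2)) r * r) 0"
      by (rule normal_moment_nz_1) simp
    then have "integrable lborel (\<lambda>r. normal_density 0 (exp (v/2)) r * r)" "(\<integral>r. normal_density 0 (exp (v/2)) r * r \<partial>lborel) = 0"
      by (auto simp: has_bochner_integral_iff)
    ultimately show ?thesis
      by (simp only:) (subst Bochner_Integration.integral_add; simp del: of_real_mult add: integral_complex_of_real)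
  qed
  have km0: "(\<integral>v. kern_v a v \<partial>lborel) = 1"
    using nn_integral_kern_v(1)[OF a] kmp by (subst integral_eq_nn_integral) auto
  have km1: "(\<integral>v. a * exp (- v) * kern_v a v \<partial>lborel) = 1"
    using nn_integral_kern_v(2)[OF a] kmp a by (subst integral_eq_nn_integral) auto
  note fst = lborel_pair.integral_fst[OF I]
  show "(\<integral>(v, r). psi a v r ^ m * of_real (kern a v r) \<partial>?L) = 1"
  proof (induction m rule: induct_nat_012)
    case 0
    show ?case by (subst fst[symmetric]) (simp only: power_0 mult_1_left inner0, simp only: integral_complex_of_real km0 of_real_1)
  next
    case 1
    show ?case by (subst fst[symmetric]) (simp only: One_nat_def[symmetric] power_one_right inner1, simp only: integral_complex_of_real km1 of_real_1)
  next
    case (ge2 n)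
    then show ?case using psi_moment_step[OF a, of n] by simp
  qed
qed

lemma psi_poly_integral:
  assumes a: "a > 0"
  shows "(\<integral>(v, r). of_real (kern a v r) * poly p (psi a v r) \<partial>leb2) = poly p 1"
proof -
  let ?L = "leb2"
  have "(\<integral>(v, r). of_real (kern a v r) * poly p (psi a v r) \<partial>?L)
     = (\<integral>x. (\<Sum>i\<le>degree p. coeff p i * (case x of (v, r) \<Rightarrow> psi a v r ^ i * of_real (kern a v r))) \<partial>?L)"
    by (intro Bochner_Integration.integral_cong refl) (auto simp: poly_altdef sum_distrib_left mult_ac)
  also have "\<dots> = (\<Sum>i\<le>degree p. coeff p i * 1)"
    using psi_moments[OF a] by (subst Bochner_Integration.integral_sum) (auto simp: )
  finally show ?thesis by (simp add: poly_altdef)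
qed

section \<open>Elimination as an identity of measures\<close>

abbreviation coord_leb :: "'v set \<Rightarrow> ('v \<Rightarrow> real) measure" where
  "coord_leb V \<equiv> (\<Pi>\<^sub>M i\<in>V. lborel)"

definition leb_us :: "'v set \<Rightarrow> (('v \<Rightarrow> real) \<times> ('v \<Rightarrow> real)) measure" where
  "leb_us V = coord_leb V \<Otimes>\<^sub>M coord_leb V"

definition mu_pin :: "'v set \<Rightarrow> ('v \<Rightarrow> 'v \<Rightarrow> real) \<Rightarrow> ('v \<Rightarrow> real) \<Rightarrow> (('v \<Rightarrow> real) \<times> ('v \<Rightarrow> real)) measure" where
  "mu_pin V W \<eta> = density (leb_us V) (\<lambda>p. ennreal (dens_pin V W \<eta> (fst p) (snd p)))"

lemma sigma_finite_coord_leb: "finite V \<Longrightarrow> sigma_finite_measure (coord_leb V)"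
proof -
  assume "finite V"
  interpret product_sigma_finite "\<lambda>_::'a. lborel :: real measure" by standard
  show ?thesis by (rule sigma_finite) fact
qed

lemma sigma_finite_leb_us: "finite V \<Longrightarrow> sigma_finite_measure (leb_us V)"
  unfolding leb_us_def by (intro sigma_finite_pair_measure sigma_finite_coord_leb)

lemma leb_us_coord [measurable]:
  "i \<in> V \<Longrightarrow> (\<lambda>p. fst p i) \<in> borel_measurable (leb_us V)"
  "i \<in> V \<Longrightarrow> (\<lambda>p. snd p i) \<in> borel_measurable (leb_us V)"
  unfolding leb_us_def by measurable

lemma upd_measurable:
  assumes "f \<in> N \<rightarrow>\<^sub>M coord_leb V" "g \<in> borel_measurable N"
  shows "(\<lambda>z. (f z)(x := g z)) \<in> N \<rightarrow>\<^sub>M coord_leb (insert x V)"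
  by (rule measurable_fun_upd[OF _ assms(1)]) (use assms(2) in auto)

lemma det_on_measurable:
  assumes "finite I" "\<And>i j. i \<in> I \<Longrightarrow> j \<in> I \<Longrightarrow> (\<lambda>z. A z i j) \<in> borel_measurable N"
  shows "(\<lambda>z. det_on I (A z)) \<in> borel_measurable N"
  unfolding det_on_def
  by (intro borel_measurable_sum borel_measurable_times borel_measurable_const borel_measurable_prod)
     (auto intro!: assms simp: permutes_in_image)

lemma dens_pin_measurable:
  assumes "finite V" "\<And>i. i \<in> V \<Longrightarrow> (\<lambda>z. u z i) \<in> borel_measurable N" "\<And>i. i \<in> V \<Longrightarrow> (\<lambda>z. s z i) \<in> borel_measurable N"
  shows "(\<lambda>z. dens_pin V W \<eta> (u z) (s z)) \<in> borel_measurable N"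
proof -
  have h: "(\<lambda>z. A_pin V W \<eta> (u z) i j) \<in> borel_measurable N" if "i \<in> V" "j \<in> V" for i j
    unfolding A_pin_def local_field_def using that assms
    by (cases "i = j") (auto intro!: borel_measurable_sum borel_measurable_times borel_measurable_add borel_measurable_exp[THEN measurable_compose[rotated]])
  have [measurable]: "(\<lambda>z. det_on V (A_pin V W \<eta> (u z))) \<in> borel_measurable N"
    by (intro det_on_measurable assms h)
  have p: "(\<lambda>z. pair_energy (u z i) (s z i) (u z j) (s z j)) \<in> borel_measurable N"
    "(\<lambda>z. pair_energy (u z i) (s z i) 0 0) \<in> borel_measurable N" if "i \<in> V" "j \<in> V" for i j
    using assms(2,3)[OF that(1)] assms(2,3)[OF that(2)] unfolding pair_energy_def cosh_def by measurable
  have [measurable]: "(\<lambda>z. energy V W \<eta> (u z) (s z)) \<in> borel_measurable N"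
    unfolding energy_def using p
    by (intro borel_measurable_add borel_measurable_times borel_measurable_sum borel_measurable_const) auto
  have [measurable]: "(\<lambda>z. (\<Prod>i\<in>V. exp (- u z i) / (2 * pi))) \<in> borel_measurable N"
  proof (rule borel_measurable_prod)
    fix i assume "i \<in> V"
    note [measurable] = assms(2)[OF this]
    show "(\<lambda>z. exp (- u z i) / (2 * pi)) \<in> borel_measurable N" by measurable
  qed
  show ?thesis unfolding dens_pin_def by measurable
qed

lemma dens_pin_leb_us: "finite V \<Longrightarrow> (\<lambda>p. dens_pin V W \<eta> (fst p) (snd p)) \<in> borel_measurable (leb_us V)"
  by (rule dens_pin_measurable) auto

lemma dens_pin_nonneg: "pinned V W \<eta> \<Longrightarrow> dens_pin V W \<eta> u s \<ge> 0"
  unfolding dens_pin_def using det_A_pin_pos[of V W \<eta> u]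
  by (intro mult_nonneg_nonneg prod_nonneg) auto

text \<open>The fields at \<open>x\<close> become the innermost variables, ready for a change of variables with the other
fields fixed.\<close>

lemma nn_integral_leb_us_insert:
  fixes V :: "'v set" and F :: "('v \<Rightarrow> real) \<times> ('v \<Rightarrow> real) \<Rightarrow> ennreal"
  assumes V: "finite V" "x \<notin> V" and F: "F \<in> borel_measurable (leb_us (insert x V))"
  shows "(\<integral>\<^sup>+p. F p \<partial>leb_us (insert x V))
    = (\<integral>\<^sup>+p. \<integral>\<^sup>+a. \<integral>\<^sup>+b. F ((fst p)(x := a), (snd p)(x := b)) \<partial>lborel \<partial>lborel \<partial>leb_us V)"
proof -
  interpret product_sigma_finite "\<lambda>_::'v. lborel :: real measure" by standard
  interpret V: sigma_finite_measure "coord_leb V" by (rule sigma_finite_coord_leb[OF V(1)])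
  interpret iV: sigma_finite_measure "coord_leb (insert x V)" by (rule sigma_finite_coord_leb) (use V in simp)
  interpret LV: pair_sigma_finite lborel "coord_leb V" ..
  have F' [measurable]: "F \<in> borel_measurable (coord_leb (insert x V) \<Otimes>\<^sub>M coord_leb (insert x V))"
    using F by (simp add: leb_us_def)
  have FF: "(\<lambda>z. F (f z, g z)) \<in> borel_measurable N" if "f \<in> N \<rightarrow>\<^sub>M coord_leb (insert x V)" "g \<in> N \<rightarrow>\<^sub>M coord_leb (insert x V)" for f g and N :: "'z measure"
    using that by measurable
  have "(\<integral>\<^sup>+p. F p \<partial>leb_us (insert x V)) = (\<integral>\<^sup>+U. \<integral>\<^sup>+S. F (U, S) \<partial>coord_leb (insert x V) \<partial>coord_leb (insert x V))"
    unfolding leb_us_def by (rule iV.nn_integral_fst[symmetric]) measurable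
  also have "\<dots> = (\<integral>\<^sup>+u. \<integral>\<^sup>+a. \<integral>\<^sup>+S. F (u(x := a), S) \<partial>coord_leb (insert x V) \<partial>lborel \<partial>coord_leb V)"
    by (rule product_nn_integral_insert[OF V]) measurable
  also have "\<dots> = (\<integral>\<^sup>+u. \<integral>\<^sup>+a. \<integral>\<^sup>+s. \<integral>\<^sup>+b. F (u(x := a), s(x := b)) \<partial>lborel \<partial>coord_leb V \<partial>lborel \<partial>coord_leb V)"
  proof (rule nn_integral_cong, rule nn_integral_cong)
    fix u and a :: real assume "u \<in> space (coord_leb V)"
    then have "u(x := a) \<in> space (coord_leb (insert x V))" by (auto simp: space_PiM PiE_def extensional_def)
    then have "(\<lambda>S. F (u(x := a), S)) \<in> borel_measurable (coord_leb (insert x V))"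
      by (intro FF measurable_const) auto
    then show "(\<integral>\<^sup>+S. F (u(x := a), S) \<partial>coord_leb (insert x V)) = (\<integral>\<^sup>+s. \<integral>\<^sup>+b. F (u(x := a), s(x := b)) \<partial>lborel \<partial>coord_leb V)"
      by (rule product_nn_integral_insert[OF V])
  qed
  also have "\<dots> = (\<integral>\<^sup>+u. \<integral>\<^sup>+s. \<integral>\<^sup>+a. \<integral>\<^sup>+b. F (u(x := a), s(x := b)) \<partial>lborel \<partial>lborel \<partial>coord_leb V \<partial>coord_leb V)"
  proof (rule nn_integral_cong, rule LV.Fubini'[symmetric])
    fix u :: "'v \<Rightarrow> real" assume u: "u \<in> space (coord_leb V)"
    have "(\<lambda>z. F (u(x := fst (fst z)), (snd (fst z))(x := snd z))) \<in> borel_measurable ((lborel \<Otimes>\<^sub>M coord_leb V) \<Otimes>\<^sub>M lborel)"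
      by (intro FF upd_measurable) (use u in measurable)
    then show "(\<lambda>(a, s). \<integral>\<^sup>+b. F (u(x := a), s(x := b)) \<partial>lborel) \<in> borel_measurable (lborel \<Otimes>\<^sub>M coord_leb V)"
      unfolding case_prod_beta by (intro lborel.borel_measurable_nn_integral) (simp add: case_prod_beta)
  qed
  also have "\<dots> = (\<integral>\<^sup>+p. \<integral>\<^sup>+a. \<integral>\<^sup>+b. F ((fst p)(x := a), (snd p)(x := b)) \<partial>lborel \<partial>lborel \<partial>leb_us V)"
  proof -
    have m: "(\<lambda>z. F ((fst (fst (fst z)))(x := snd (fst z)), (snd (fst (fst z)))(x := snd z))) \<in> borel_measurable (((coord_leb V \<Otimes>\<^sub>M coord_leb V) \<Otimes>\<^sub>M lborel) \<Otimes>\<^sub>M lborel)"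
      by (intro FF upd_measurable) measurable
    have "(\<lambda>p. \<integral>\<^sup>+a. \<integral>\<^sup>+b. F ((fst p)(x := a), (snd p)(x := b)) \<partial>lborel \<partial>lborel) \<in> borel_measurable (coord_leb V \<Otimes>\<^sub>M coord_leb V)"
      by (intro lborel.borel_measurable_nn_integral) (use m in \<open>simp add: case_prod_beta\<close>)
    from V.nn_integral_fst[OF this] show ?thesis unfolding leb_us_def by simp
  qed
  finally show ?thesis .
qed

text \<open>The change from \<open>(u\<^sub>x, s\<^sub>x)\<close> to \<open>(v, r)\<close>, where \<open>c\<close> and \<open>T\<close> depend on the other fields only.\<close>

lemma nn_integral_affine2:
  fixes c T :: real and f :: "real \<Rightarrow> real \<Rightarrow> ennreal"
  assumes f: "case_prod f \<in> borel_measurable leb2" and c: "c > 0"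
  shows "(\<integral>\<^sup>+a. \<integral>\<^sup>+b. f a b \<partial>lborel \<partial>lborel)
    = (\<integral>\<^sup>+v. \<integral>\<^sup>+r. ennreal (1 / c) * f (ln c - v) ((r + T) / c) \<partial>lborel \<partial>lborel)"
proof -
  have [measurable]: "case_prod f \<in> borel_measurable (borel \<Otimes>\<^sub>M borel)" using f by simp
  have fm: "f a \<in> borel_measurable borel" for a using f by simp
  have i: "(\<integral>\<^sup>+b. f a b \<partial>lborel) = (\<integral>\<^sup>+r. ennreal (1 / c) * f a ((r + T) / c) \<partial>lborel)" for a
  proof -
    have [measurable]: "f a \<in> borel_measurable borel" by (rule fm)
    have "(\<integral>\<^sup>+b. f a b \<partial>lborel) = ennreal \<bar>1 / c\<bar> * (\<integral>\<^sup>+r. f a (T / c + 1 / c * r) \<partial>lborel)"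
      by (rule nn_integral_real_affine[OF fm]) (use c in simp)
    also have "\<dots> = (\<integral>\<^sup>+r. ennreal (1 / c) * f a ((r + T) / c) \<partial>lborel)"
      using c by (subst nn_integral_cmult[symmetric]) (auto simp: add_divide_distrib add.commute)
    finally show ?thesis .
  qed
  have "(\<integral>\<^sup>+a. \<integral>\<^sup>+b. f a b \<partial>lborel \<partial>lborel) = (\<integral>\<^sup>+a. \<integral>\<^sup>+r. ennreal (1 / c) * f a ((r + T) / c) \<partial>lborel \<partial>lborel)"
    by (simp add: i)
  also have "\<dots> = ennreal \<bar>-1\<bar> * (\<integral>\<^sup>+v. \<integral>\<^sup>+r. ennreal (1 / c) * f (ln c + (-1) * v) ((r + T) / c) \<partial>lborel \<partial>lborel)"
    by (rule nn_integral_real_affine) auto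
  finally show ?thesis by simp
qed

definition reinsert :: "'v set \<Rightarrow> ('v \<Rightarrow> 'v \<Rightarrow> real) \<Rightarrow> ('v \<Rightarrow> real) \<Rightarrow> 'v \<Rightarrow> (real \<times> real) \<times> (('v \<Rightarrow> real) \<times> ('v \<Rightarrow> real)) \<Rightarrow> ('v \<Rightarrow> real) \<times> ('v \<Rightarrow> real)" where
  "reinsert V W \<eta> x = (\<lambda>(vr, us). ((fst us)(x := reinsert_u V W \<eta> x (fst vr) (fst us)), (snd us)(x := reinsert_s V W \<eta> x (snd vr) (fst us) (snd us))))"

lemma reinsert_measurable:
  "reinsert V W \<eta> x \<in> leb2 \<Otimes>\<^sub>M leb_us V \<rightarrow>\<^sub>M leb_us (insert x V)"
proof -
  have [measurable]: "(\<lambda>z. fst (snd z) j) \<in> borel_measurable (leb2 \<Otimes>\<^sub>M leb_us V)"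
    if "j \<in> V" for j
    by (rule measurable_compose[OF measurable_snd leb_us_coord(1)[OF that]])
  have [measurable]: "(\<lambda>z. snd (snd z) j) \<in> borel_measurable (leb2 \<Otimes>\<^sub>M leb_us V)"
    if "j \<in> V" for j
    by (rule measurable_compose[OF measurable_snd leb_us_coord(2)[OF that]])
  have S: "(\<lambda>z. \<Sum>j\<in>V. W x j * exp (fst (snd z) j)) \<in> borel_measurable (leb2 \<Otimes>\<^sub>M leb_us V)"
    "(\<lambda>z. \<Sum>j\<in>V. W x j * (exp (fst (snd z) j) * snd (snd z) j)) \<in> borel_measurable (leb2 \<Otimes>\<^sub>M leb_us V)"
    by (intro borel_measurable_sum; measurable)+
  note [measurable] = S
  have m: "(\<lambda>z. fst (snd z)) \<in> leb2 \<Otimes>\<^sub>M leb_us V \<rightarrow>\<^sub>M coord_leb V"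
    "(\<lambda>z. snd (snd z)) \<in> leb2 \<Otimes>\<^sub>M leb_us V \<rightarrow>\<^sub>M coord_leb V"
    unfolding leb_us_def by measurable
  have "(\<lambda>z. reinsert_u V W \<eta> x (fst (fst z)) (fst (snd z))) \<in> borel_measurable (leb2 \<Otimes>\<^sub>M leb_us V)"
    "(\<lambda>z. reinsert_s V W \<eta> x (snd (fst z)) (fst (snd z)) (snd (snd z))) \<in> borel_measurable (leb2 \<Otimes>\<^sub>M leb_us V)"
    unfolding reinsert_u_def reinsert_s_def by measurable
  note e = upd_measurable[OF m(1) this(1), of x] upd_measurable[OF m(2) this(2), of x]
  from e show ?thesis unfolding reinsert_def case_prod_beta leb_us_def[of "insert x V"]
    by (rule measurable_Pair)
qed

text \<open>Measurability of \<open>d\<close> is obtained indirectly: by the elimination formula it is a quotient of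
measurable functions, which avoids a study of the joint dependence of the reduced model on its
weights.\<close>

lemma nn_integral_mu_pin_insert:
  fixes V :: "'v set" and G :: "('v \<Rightarrow> real) \<times> ('v \<Rightarrow> real) \<Rightarrow> ennreal"
  assumes p: "pinned (insert x V) W \<eta>" and x: "x \<notin> V" and G: "G \<in> borel_measurable (leb_us (insert x V))"
  defines "d \<equiv> \<lambda>z. kern (\<eta> x + (\<Sum>j\<in>V. W x j)) (fst (fst z)) (snd (fst z)) * dens_pin V (elim_W W x (exp (fst (fst z)))) (elim_pin W \<eta> x (exp (fst (fst z)))) (fst (snd z)) (snd (snd z))"
  shows "d \<in> borel_measurable (leb2 \<Otimes>\<^sub>M leb_us V)"
    and "(\<integral>\<^sup>+p. ennreal (dens_pin (insert x V) W \<eta> (fst p) (snd p)) * G p \<partial>leb_us (insert x V))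
      = (\<integral>\<^sup>+z. ennreal (d z) * G (reinsert V W \<eta> x z) \<partial>(leb2 \<Otimes>\<^sub>M leb_us V))"
proof -
  have V: "finite V" using pinned_finite[OF p] by simp
  interpret L: sigma_finite_measure "leb_us V" by (rule sigma_finite_leb_us[OF V])
  interpret LL: sigma_finite_measure "leb2"
    by (intro sigma_finite_pair_measure sigma_finite_lborel)
  interpret P: pair_sigma_finite "leb2" "leb_us V" ..
  let ?M = "leb2 \<Otimes>\<^sub>M leb_us V :: ((real \<times> real) \<times> (('v \<Rightarrow> real) \<times> ('v \<Rightarrow> real))) measure"
  define c where "c = (\<lambda>u. \<eta> x + (\<Sum>j\<in>V. W x j * exp (u j)))"
  define T where "T = (\<lambda>u s. \<Sum>j\<in>V. W x j * (exp (u j) * s j))"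
  define D where "D = (\<lambda>p. dens_pin (insert x V) W \<eta> (fst p) (snd p))"
  have c: "c u > 0" for u unfolding c_def using pinned_weighted_pos[OF p x] by simp
  have D [measurable]: "D \<in> borel_measurable (leb_us (insert x V))"
    unfolding D_def using dens_pin_leb_us[of "insert x V" W \<eta>] V by simp
  note [measurable] = reinsert_measurable[of V W \<eta> x] G
  have [measurable]: "(\<lambda>z. fst (snd z) j) \<in> borel_measurable ?M" if "j \<in> V" for j
    using leb_us_coord(1)[OF that] by (rule measurable_compose[OF measurable_snd])
  have cm [measurable]: "(\<lambda>z. c (fst (snd z))) \<in> borel_measurable ?M"
    unfolding c_def by (intro borel_measurable_add borel_measurable_const borel_measurable_sum) measurable
  have d: "d z = 1 / c (fst (snd z)) * D (reinsert V W \<eta> x z)" for z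
    using dens_pin_elim[OF p x, of "fst (snd z)" "fst (fst z)" "snd (snd z)" "snd (fst z)"] c[of "fst (snd z)"]
    by (simp add: d_def D_def reinsert_def case_prod_beta c_def)
  have "(\<lambda>z. 1 / c (fst (snd z)) * D (reinsert V W \<eta> x z)) \<in> borel_measurable ?M" by measurable
  moreover have "d = (\<lambda>z. 1 / c (fst (snd z)) * D (reinsert V W \<eta> x z))" by (rule ext) (rule d)
  ultimately show dm [measurable]: "d \<in> borel_measurable ?M" by (simp only:)
  define H where "H = (\<lambda>p. ennreal (D p) * G p)"
  have [measurable]: "H \<in> borel_measurable (leb_us (insert x V))" unfolding H_def by measurable
  have Hm: "(\<lambda>z. ennreal (d z) * G (reinsert V W \<eta> x z)) \<in> borel_measurable ?M" by measurable
  have "(\<integral>\<^sup>+p. H p \<partial>leb_us (insert x V))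
    = (\<integral>\<^sup>+p. \<integral>\<^sup>+a. \<integral>\<^sup>+b. H ((fst p)(x := a), (snd p)(x := b)) \<partial>lborel \<partial>lborel \<partial>leb_us V)"
    by (rule nn_integral_leb_us_insert[OF V x]) measurable
  also have "\<dots> = (\<integral>\<^sup>+p. \<integral>\<^sup>+v. \<integral>\<^sup>+r. ennreal (d ((v, r), p)) * G (reinsert V W \<eta> x ((v, r), p)) \<partial>lborel \<partial>lborel \<partial>leb_us V)"
  proof (rule nn_integral_cong)
    fix p assume "p \<in> space (leb_us V)"
    then have sp: "fst p \<in> space (coord_leb V)" "snd p \<in> space (coord_leb V)" by (auto simp: leb_us_def space_pair_measure)
    have "(\<lambda>z. H ((fst p)(x := fst z), (snd p)(x := snd z))) \<in> borel_measurable leb2"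
    proof -
      have "(\<lambda>z. ((fst p)(x := fst z), (snd p)(x := snd z))) \<in> leb2 \<rightarrow>\<^sub>M leb_us (insert x V)"
        unfolding leb_us_def by (intro measurable_Pair upd_measurable measurable_const sp) measurable
      then show ?thesis by measurable
    qed
    then have "(\<integral>\<^sup>+a. \<integral>\<^sup>+b. H ((fst p)(x := a), (snd p)(x := b)) \<partial>lborel \<partial>lborel)
      = (\<integral>\<^sup>+v. \<integral>\<^sup>+r. ennreal (1 / c (fst p)) * H ((fst p)(x := ln (c (fst p)) - v), (snd p)(x := (r + T (fst p) (snd p)) / c (fst p))) \<partial>lborel \<partial>lborel)"
      by (intro nn_integral_affine2 c) (simp add: case_prod_beta)
    also have "\<dots> = (\<integral>\<^sup>+v. \<integral>\<^sup>+r. ennreal (d ((v, r), p)) * G (reinsert V W \<eta> x ((v, r), p)) \<partial>lborel \<partial>lborel)"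
    proof (intro nn_integral_cong)
      fix v r
      have e: "((fst p)(x := ln (c (fst p)) - v), (snd p)(x := (r + T (fst p) (snd p)) / c (fst p))) = reinsert V W \<eta> x ((v, r), p)"
        by (simp add: reinsert_def reinsert_u_def reinsert_s_def c_def T_def)
      show "ennreal (1 / c (fst p)) * H ((fst p)(x := ln (c (fst p)) - v), (snd p)(x := (r + T (fst p) (snd p)) / c (fst p)))
         = ennreal (d ((v, r), p)) * G (reinsert V W \<eta> x ((v, r), p))"
        unfolding e H_def d fst_conv snd_conv using c[of "fst p"]
          by (subst ennreal_mult') (simp_all add: mult.assoc)
    qed
    finally show "(\<integral>\<^sup>+a. \<integral>\<^sup>+b. H ((fst p)(x := a), (snd p)(x := b)) \<partial>lborel \<partial>lborel)
      = (\<integral>\<^sup>+v. \<integral>\<^sup>+r. ennreal (d ((v, r), p)) * G (reinsert V W \<eta> x ((v, r), p)) \<partial>lborel \<partial>lborel)" .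
  qed
  also have "\<dots> = (\<integral>\<^sup>+p. \<integral>\<^sup>+vr. ennreal (d (vr, p)) * G (reinsert V W \<eta> x (vr, p)) \<partial>leb2 \<partial>leb_us V)"
  proof (rule nn_integral_cong)
    fix p assume p: "p \<in> space (leb_us V)"
    have "(\<lambda>vr. ennreal (d (vr, p)) * G (reinsert V W \<eta> x (vr, p))) \<in> borel_measurable leb2"
      using measurable_compose[OF measurable_Pair2'[OF p] Hm] by simp
    from lborel.nn_integral_fst[OF this]
    show "(\<integral>\<^sup>+v. \<integral>\<^sup>+r. ennreal (d ((v, r), p)) * G (reinsert V W \<eta> x ((v, r), p)) \<partial>lborel \<partial>lborel)
      = (\<integral>\<^sup>+vr. ennreal (d (vr, p)) * G (reinsert V W \<eta> x (vr, p)) \<partial>leb2)" .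
  qed
  also have "\<dots> = (\<integral>\<^sup>+z. ennreal (d z) * G (reinsert V W \<eta> x z) \<partial>?M)"
    using P.nn_integral_snd[OF Hm] by simp
  finally show "(\<integral>\<^sup>+p. ennreal (dens_pin (insert x V) W \<eta> (fst p) (snd p)) * G p \<partial>leb_us (insert x V))
      = (\<integral>\<^sup>+z. ennreal (d z) * G (reinsert V W \<eta> x z) \<partial>?M)" by (simp add: H_def D_def)
qed

lemma mu_pin_insert:
  fixes V :: "'v set"
  assumes p: "pinned (insert x V) W \<eta>" and x: "x \<notin> V"
  shows "mu_pin (insert x V) W \<eta> = distr (density (leb2 \<Otimes>\<^sub>M leb_us V)
     (\<lambda>z. ennreal (kern (\<eta> x + (\<Sum>j\<in>V. W x j)) (fst (fst z)) (snd (fst z)) * dens_pin V (elim_W W x (exp (fst (fst z)))) (elim_pin W \<eta> x (exp (fst (fst z)))) (fst (snd z)) (snd (snd z)))))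
     (leb_us (insert x V)) (reinsert V W \<eta> x)" (is "_ = distr (density ?M ?d) _ ?e")
proof (rule measure_eqI)
  have V: "finite V" using pinned_finite[OF p] by simp
  show "sets (mu_pin (insert x V) W \<eta>) = sets (distr (density ?M ?d) (leb_us (insert x V)) ?e)" by (simp add: mu_pin_def)
  fix A assume "A \<in> sets (mu_pin (insert x V) W \<eta>)"
  then have A [measurable]: "A \<in> sets (leb_us (insert x V))" by (simp add: mu_pin_def)
  note dm = nn_integral_mu_pin_insert(1)[OF p x borel_measurable_const[of 0]]
  note em [measurable] = reinsert_measurable[of V W \<eta> x]
  have "emeasure (mu_pin (insert x V) W \<eta>) A = (\<integral>\<^sup>+p. ennreal (dens_pin (insert x V) W \<eta> (fst p) (snd p)) * indicator A p \<partial>leb_us (insert x V))"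
    unfolding mu_pin_def using dens_pin_leb_us[of "insert x V" W \<eta>] V
    by (subst emeasure_density) (auto intro!: measurable_compose[OF _ measurable_ennreal])
  also have "\<dots> = (\<integral>\<^sup>+z. ?d z * indicator A (?e z) \<partial>?M)"
    by (rule nn_integral_mu_pin_insert(2)[OF p x]) simp
  also have "\<dots> = (\<integral>\<^sup>+z. ?d z * indicator (?e -` A \<inter> space ?M) z \<partial>?M)"
    by (intro nn_integral_cong) (simp add: indicator_def)
  also have "\<dots> = emeasure (density ?M ?d) (?e -` A \<inter> space ?M)"
    using dm measurable_sets[OF em A]
    by (subst emeasure_density) (auto intro!: measurable_compose[OF _ measurable_ennreal])
  also have "\<dots> = emeasure (distr (density ?M ?d) (leb_us (insert x V)) ?e) A"
    by (subst emeasure_distr) simp_all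
  finally show "emeasure (mu_pin (insert x V) W \<eta>) A = emeasure (distr (density ?M ?d) (leb_us (insert x V)) ?e) A" .
qed

text \<open>The Bochner form of elimination. Integrability of the inner integrals is a conclusion, valid for
almost every \<open>(v, r)\<close>; inductions over the vertices therefore only ever assume integrability of the
functions that they integrate.\<close>

lemma mu_pin_integral_insert:
  fixes V :: "'v set" and G :: "('v \<Rightarrow> real) \<times> ('v \<Rightarrow> real) \<Rightarrow> complex"
  assumes p: "pinned (insert x V) W \<eta>" and x: "x \<notin> V" and G: "integrable (mu_pin (insert x V) W \<eta>) G"
  defines "a \<equiv> \<eta> x + (\<Sum>j\<in>V. W x j)"
    and "\<nu> \<equiv> \<lambda>vr. mu_pin V (elim_W W x (exp (fst vr))) (elim_pin W \<eta> x (exp (fst vr)))"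
  shows "AE vr in leb2. integrable (\<nu> vr) (\<lambda>us. G (reinsert V W \<eta> x (vr, us)))"
    and "(\<lambda>vr. complex_of_real (kern a (fst vr) (snd vr)) * (\<integral>us. G (reinsert V W \<eta> x (vr, us)) \<partial>\<nu> vr)) \<in> borel_measurable leb2"
    and "(\<integral>p. G p \<partial>mu_pin (insert x V) W \<eta>) = (\<integral>vr. complex_of_real (kern a (fst vr) (snd vr)) * (\<integral>us. G (reinsert V W \<eta> x (vr, us)) \<partial>\<nu> vr) \<partial>leb2)"
proof -
  have V: "finite V" using pinned_finite[OF p] by simp
  interpret L: sigma_finite_measure "leb_us V" by (rule sigma_finite_leb_us[OF V])
  interpret LL: sigma_finite_measure "leb2"
    by (intro sigma_finite_pair_measure sigma_finite_lborel)
  interpret P: pair_sigma_finite "leb2" "leb_us V" ..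
  let ?M = "leb2 \<Otimes>\<^sub>M leb_us V :: ((real \<times> real) \<times> (('v \<Rightarrow> real) \<times> ('v \<Rightarrow> real))) measure"
  define D where "D = (\<lambda>(vr :: real \<times> real) us. dens_pin V (elim_W W x (exp (fst vr))) (elim_pin W \<eta> x (exp (fst vr))) (fst us) (snd us))"
  define d where "d = (\<lambda>z::(real \<times> real) \<times> (('v \<Rightarrow> real) \<times> ('v \<Rightarrow> real)). kern a (fst (fst z)) (snd (fst z)) * D (fst z) (snd z))"
  define G' where "G' = (\<lambda>z. G (reinsert V W \<eta> x z))"
  have G'_eq: "G (reinsert V W \<eta> x z) = G' z" for z by (simp add: G'_def)
  have p': "pinned V (elim_W W x (exp v)) (elim_pin W \<eta> x (exp v))" for v using pinned_elim[OF p x] by simp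
  have D0: "D vr us \<ge> 0" for vr us unfolding D_def by (rule dens_pin_nonneg[OF p'])
  have d0: "d z \<ge> 0" for z unfolding d_def using D0 kern_pos by (intro mult_nonneg_nonneg) (auto intro: less_imp_le)
  have dm [measurable]: "d \<in> borel_measurable ?M"
    using nn_integral_mu_pin_insert(1)[OF p x borel_measurable_const[of 0]] by (simp add: d_def D_def a_def)
  note [measurable] = reinsert_measurable[of V W \<eta> x]
  have Gm [measurable]: "G \<in> borel_measurable (leb_us (insert x V))"
    using borel_measurable_integrable[OF G] by (simp add: mu_pin_def)
  have G'm [measurable]: "G' \<in> borel_measurable ?M" unfolding G'_def by measurable
  have eq: "mu_pin (insert x V) W \<eta> = distr (density ?M (\<lambda>z. ennreal (d z))) (leb_us (insert x V)) (reinsert V W \<eta> x)"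
    unfolding mu_pin_insert[OF p x] d_def D_def a_def ..
  have "integrable (density ?M (\<lambda>z. ennreal (d z))) G'"
    using G unfolding eq G'_def by (subst (asm) integrable_distr_eq) simp_all
  then have Gi: "integrable ?M (\<lambda>z. d z *\<^sub>R G' z)" using d0 by (subst (asm) integrable_density) auto
  have Dm: "(\<lambda>us. D vr us) \<in> borel_measurable (leb_us V)" for vr
    unfolding D_def by (rule dens_pin_leb_us[OF V])
  have G'vm: "(\<lambda>us. G' (vr, us)) \<in> borel_measurable (leb_us V)" for vr
    by (rule measurable_compose[OF measurable_Pair1' G'm]) (simp add: space_pair_measure)
  have nu: "\<nu> vr = density (leb_us V) (\<lambda>us. ennreal (D vr us))" for vr
    unfolding \<nu>_def mu_pin_def D_def ..
  have int: "(\<integral>us. G' (vr, us) \<partial>\<nu> vr) = (\<integral>us. D vr us *\<^sub>R G' (vr, us) \<partial>leb_us V)" for vr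
    unfolding nu by (rule integral_density) (use Dm G'vm D0 in auto)
  have int2: "complex_of_real (kern a (fst vr) (snd vr)) * (\<integral>us. G' (vr, us) \<partial>\<nu> vr) = (\<integral>us. d (vr, us) *\<^sub>R G' (vr, us) \<partial>leb_us V)" for vr
    unfolding int integral_mult_right_zero[symmetric] by (simp add: d_def scaleR_conv_of_real mult.assoc)
  have inte: "integrable (\<nu> vr) (\<lambda>us. G' (vr, us))" if "integrable (leb_us V) (\<lambda>us. d (vr, us) *\<^sub>R G' (vr, us))" for vr
  proof -
    have k: "kern a (fst vr) (snd vr) > 0" by (rule kern_pos)
    have "integrable (leb_us V) (\<lambda>us. (1 / kern a (fst vr) (snd vr)) *\<^sub>R (d (vr, us) *\<^sub>R G' (vr, us)))"
      by (intro integrable_scaleR_right that)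
    then have "integrable (leb_us V) (\<lambda>us. D vr us *\<^sub>R G' (vr, us))" using k by (simp add: d_def)
    then show ?thesis unfolding nu using Dm G'vm D0 by (subst integrable_density) auto
  qed
  show "AE vr in leb2. integrable (\<nu> vr) (\<lambda>us. G (reinsert V W \<eta> x (vr, us)))"
    using P.AE_integrable_fst'[OF Gi] unfolding G'_eq by eventually_elim (rule inte)
  show "(\<lambda>vr. complex_of_real (kern a (fst vr) (snd vr)) * (\<integral>us. G (reinsert V W \<eta> x (vr, us)) \<partial>\<nu> vr)) \<in> borel_measurable leb2"
    unfolding G'_eq int2 by (rule borel_measurable_integrable[OF P.integrable_fst'[OF Gi]])
  have "(\<integral>p. G p \<partial>mu_pin (insert x V) W \<eta>) = (\<integral>z. G' z \<partial>density ?M (\<lambda>z. ennreal (d z)))"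
    unfolding eq G'_def by (rule integral_distr) simp_all
  also have "\<dots> = (\<integral>z. d z *\<^sub>R G' z \<partial>?M)" using d0 by (intro integral_density) auto
  also have "\<dots> = (\<integral>vr. \<integral>us. d (vr, us) *\<^sub>R G' (vr, us) \<partial>leb_us V \<partial>leb2)"
    by (rule P.integral_fst'[OF Gi, symmetric])
  finally show "(\<integral>p. G p \<partial>mu_pin (insert x V) W \<eta>) = (\<integral>vr. complex_of_real (kern a (fst vr) (snd vr)) * (\<integral>us. G (reinsert V W \<eta> x (vr, us)) \<partial>\<nu> vr) \<partial>leb2)"
    unfolding G'_eq int2 .
qed

section \<open>Moments of zeta, and wiring\<close>

text \<open>Polynomials in the coordinates of \<open>\<zeta>\<close>. The class is closed under substitution of an affine expression
for one coordinate, which is what elimination does to a polynomial.\<close>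

inductive polyfun :: "(('v \<Rightarrow> complex) \<Rightarrow> complex) \<Rightarrow> bool" where
  polyfun_const: "polyfun (\<lambda>_. c)"
| polyfun_coord: "polyfun (\<lambda>\<zeta>. \<zeta> j)"
| polyfun_add: "polyfun P \<Longrightarrow> polyfun Q \<Longrightarrow> polyfun (\<lambda>\<zeta>. P \<zeta> + Q \<zeta>)"
| polyfun_mult: "polyfun P \<Longrightarrow> polyfun Q \<Longrightarrow> polyfun (\<lambda>\<zeta>. P \<zeta> * Q \<zeta>)"

lemma polyfun_sum: "finite A \<Longrightarrow> (\<And>i. i \<in> A \<Longrightarrow> polyfun (P i)) \<Longrightarrow> polyfun (\<lambda>\<zeta>. \<Sum>i\<in>A. P i \<zeta>)"
  by (induction A rule: finite_induct) (auto intro: polyfun.intros)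

lemma polyfun_prod: "finite A \<Longrightarrow> (\<And>i. i \<in> A \<Longrightarrow> polyfun (P i)) \<Longrightarrow> polyfun (\<lambda>\<zeta>. \<Prod>i\<in>A. P i \<zeta>)"
  by (induction A rule: finite_induct) (auto intro: polyfun.intros)

lemma polyfun_substitute:
  assumes "polyfun P" "polyfun Q"
  shows "polyfun (\<lambda>\<zeta>. P (\<zeta>(x := Q \<zeta>)))"
  using assms(1)
proof induction
  case (polyfun_coord j)
  show ?case using assms(2) by (cases "j = x") (auto intro: polyfun.intros)
qed (auto intro: polyfun.intros)

lemma polyfun_affine:
  assumes "finite V"
  shows "polyfun (\<lambda>\<zeta>. (c + (\<Sum>j\<in>V. w j * \<zeta> j)) * d)"
  by (rule polyfun_mult[OF polyfun_add[OF polyfun_const polyfun_sum[OF assms polyfun_mult[OF polyfun_const polyfun_coord]]] polyfun_const])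

lemma polyfun_line:
  assumes "polyfun P"
  shows "\<exists>p. \<forall>t. P (\<xi>(x := t)) = poly p t"
  using assms
proof induction
  case (polyfun_const c)
  show ?case by (rule exI[of _ "[:c:]"]) simp
next
  case (polyfun_coord j)
  show ?case by (rule exI[of _ "if j = x then [:0, 1:] else [:\<xi> j:]"]) simp
next
  case (polyfun_add P Q)
  then show ?case by (metis poly_add)
next
  case (polyfun_mult P Q)
  then show ?case by (metis poly_mult)
qed

text \<open>The kernels of the eliminated vertices are probability densities.\<close>

lemma emeasure_mu_pin_space:
  assumes "pinned V W \<eta>"
  shows "emeasure (mu_pin V W \<eta>) (space (mu_pin V W \<eta>)) = 1"
proof -
  have "(\<integral>\<^sup>+p. ennreal (dens_pin V W \<eta> (fst p) (snd p)) \<partial>leb_us V) = 1"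
  proof -
    have "finite V" using assms by (rule pinned_finite)
    then show ?thesis using assms
    proof (induction V arbitrary: W \<eta>)
      case empty
      have d: "dens_pin {} W \<eta> u s = 1" for u s by (simp add: dens_pin_def det_on_def energy_def)
      interpret product_sigma_finite "\<lambda>_::'a. lborel :: real measure" by standard
      interpret sigma_finite_measure "coord_leb ({} :: 'a set)" by (rule sigma_finite_coord_leb) simp
      have "emeasure (leb_us ({} :: 'a set)) (space (leb_us {})) = 1"
        unfolding leb_us_def space_pair_measure
        by (subst emeasure_pair_measure_Times) (simp_all add: space_PiM PiM_empty)
      then show ?case by (simp add: d)
    next
      case (insert x V)
      note p = insert.prems and x = insert.hyps(2)
      interpret L: sigma_finite_measure "leb_us V" by (rule sigma_finite_leb_us[OF insert.hyps(1)])
      let ?a = "\<eta> x + (\<Sum>j\<in>V. W x j)"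
      let ?D = "\<lambda>vr us. dens_pin V (elim_W W x (exp (fst vr))) (elim_pin W \<eta> x (exp (fst vr))) (fst us) (snd us)"
      have a: "?a > 0" using pinned_weighted_pos[OF p x, of "\<lambda>_. 1"] by simp
      note E = nn_integral_mu_pin_insert[OF p x borel_measurable_const[of 1]]
      have k0: "0 \<le> kern ?a v r" for v r using kern_pos[of ?a v r] by simp
      have "(\<integral>\<^sup>+p. ennreal (dens_pin (insert x V) W \<eta> (fst p) (snd p)) \<partial>leb_us (insert x V))
        = (\<integral>\<^sup>+z. ennreal (kern ?a (fst (fst z)) (snd (fst z)) * ?D (fst z) (snd z)) \<partial>(leb2 \<Otimes>\<^sub>M leb_us V))"
        using E(2) by (simp only: mult_1_right)
      also have "\<dots> = (\<integral>\<^sup>+vr. \<integral>\<^sup>+us. ennreal (kern ?a (fst vr) (snd vr) * ?D vr us) \<partial>leb_us V \<partial>leb2)"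
        using L.nn_integral_fst[OF measurable_compose[OF E(1) measurable_ennreal]] by (simp only: fst_conv snd_conv)
      also have "\<dots> = (\<integral>\<^sup>+vr. ennreal (kern ?a (fst vr) (snd vr)) \<partial>leb2)"
      proof (rule nn_integral_cong)
        fix vr :: "real \<times> real"
        have "(\<integral>\<^sup>+us. ennreal (kern ?a (fst vr) (snd vr) * ?D vr us) \<partial>leb_us V)
          = (\<integral>\<^sup>+us. ennreal (kern ?a (fst vr) (snd vr)) * ennreal (?D vr us) \<partial>leb_us V)"
          by (simp add: ennreal_mult' k0)
        also have "\<dots> = ennreal (kern ?a (fst vr) (snd vr)) * (\<integral>\<^sup>+us. ennreal (?D vr us) \<partial>leb_us V)"
          by (rule nn_integral_cmult) (rule measurable_compose[OF dens_pin_leb_us[OF insert.hyps(1)] measurable_ennreal])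
        also have "(\<integral>\<^sup>+us. ennreal (?D vr us) \<partial>leb_us V) = 1"
          by (rule insert.IH) (rule pinned_elim[OF p x], simp)
        finally show "(\<integral>\<^sup>+us. ennreal (kern ?a (fst vr) (snd vr) * ?D vr us) \<partial>leb_us V) = ennreal (kern ?a (fst vr) (snd vr))" by simp
      qed
      also have "\<dots> = 1"
      proof -
        have "(\<lambda>vr. ennreal (kern ?a (fst vr) (snd vr))) \<in> borel_measurable leb2"
          using measurable_compose[OF kern_borel[of ?a] measurable_ennreal] by (simp add: case_prod_beta)
        from lborel.nn_integral_fst[OF this] show ?thesis using nn_integral_kern[OF a] by simp
      qed
      finally show ?case .
    qed
  qed
  moreover have "emeasure (mu_pin V W \<eta>) (space (mu_pin V W \<eta>)) = (\<integral>\<^sup>+p. ennreal (dens_pin V W \<eta> (fst p) (snd p)) * indicator (space (leb_us V)) p \<partial>leb_us V)"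
    unfolding mu_pin_def space_density
    by (rule emeasure_density[OF measurable_compose[OF dens_pin_leb_us[OF pinned_finite[OF assms]] measurable_ennreal] sets.top])
  moreover have "\<dots> = (\<integral>\<^sup>+p. ennreal (dens_pin V W \<eta> (fst p) (snd p)) \<partial>leb_us V)"
    by (rule nn_integral_cong) simp
  ultimately show ?thesis by simp
qed

lemma zeta_reinsert:
  assumes "pinned (insert x V) W \<eta>" "x \<notin> V"
  shows "zeta (insert x V) (fst (reinsert V W \<eta> x (vr, us))) (snd (reinsert V W \<eta> x (vr, us)))
    = (zeta V (fst us) (snd us))(x := (of_real (\<eta> x) + \<i> * of_real (snd vr) + (\<Sum>j\<in>V. of_real (W x j) * zeta V (fst us) (snd us) j)) / of_real (exp (fst vr)))"
proof -
  have e: "fst (reinsert V W \<eta> x (vr, us)) = (fst us)(x := reinsert_u V W \<eta> x (fst vr) (fst us))"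
    "snd (reinsert V W \<eta> x (vr, us)) = (snd us)(x := reinsert_s V W \<eta> x (snd vr) (fst us) (snd us))"
    by (simp_all add: reinsert_def case_prod_beta)
  show ?thesis unfolding e by (rule coords_reinsert(5)[OF assms])
qed

text \<open>By induction the reduced model replaces the remaining \<open>\<zeta>\<^sub>j\<close> by 1 in a polynomial in which \<open>\<zeta>\<^sub>x\<close> has
been expressed through them. Then \<open>\<zeta>\<^sub>x\<close> is \<open>psi\<close>, and all its moments are 1.\<close>

lemma zeta_polynomial_integral:
  assumes "pinned V W \<eta>" "polyfun P" "integrable (mu_pin V W \<eta>) (\<lambda>p. P (zeta V (fst p) (snd p)))"
  shows "(\<integral>p. P (zeta V (fst p) (snd p)) \<partial>mu_pin V W \<eta>) = P (\<lambda>_. 1)"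
proof -
  have "finite V" using assms(1) by (rule pinned_finite)
  then show ?thesis using assms
  proof (induction V arbitrary: W \<eta> P)
    case empty
    interpret prob_space "mu_pin {} W \<eta>" using emeasure_mu_pin_space[OF empty.prems(1)] by (rule prob_spaceI)
    have "zeta {} u s = (\<lambda>_. 1)" for u s :: "'a \<Rightarrow> real" by (simp add: zeta_def fun_eq_iff)
    then show ?case by (simp add: prob_space)
  next
    case (insert x V)
    note p = insert.prems(1) and x = insert.hyps(2) and I = insert.prems(3)
    let ?a = "\<eta> x + (\<Sum>j\<in>V. W x j)"
    define Q where "Q = (\<lambda>(vr :: real \<times> real) \<zeta>. (of_real (\<eta> x) + \<i> * of_real (snd vr) + (\<Sum>j\<in>V. of_real (W x j) * \<zeta> j)) * (1 / complex_of_real (exp (fst vr))))"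
    define P' where "P' = (\<lambda>vr \<zeta>. P (\<zeta>(x := Q vr \<zeta>)))"
    define \<nu> where "\<nu> = (\<lambda>vr :: real \<times> real. mu_pin V (elim_W W x (exp (fst vr))) (elim_pin W \<eta> x (exp (fst vr))))"
    have a: "?a > 0" using pinned_weighted_pos[OF p x, of "\<lambda>_. 1"] by simp
    have pf: "polyfun (P' vr)" for vr
      unfolding P'_def Q_def by (rule polyfun_substitute[OF insert.prems(2) polyfun_affine[OF insert.hyps(1)]])
    have e: "P (zeta (insert x V) (fst (reinsert V W \<eta> x (vr, us))) (snd (reinsert V W \<eta> x (vr, us)))) = P' vr (zeta V (fst us) (snd us))" for vr us
      unfolding zeta_reinsert[OF p x] P'_def Q_def divide_inverse mult_1_left ..
    note E = mu_pin_integral_insert[OF p x I, unfolded e]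
    obtain q where q: "\<And>t. P ((\<lambda>_. 1)(x := t)) = poly q t" using polyfun_line[OF insert.prems(2)] by blast
    have P'1: "P' vr (\<lambda>_. 1) = poly q (psi ?a (fst vr) (snd vr))" for vr
    proof -
      have "1 / complex_of_real (exp (fst vr)) = of_real (exp (- fst vr))"
        by (simp only: exp_minus of_real_inverse) (simp only: inverse_eq_divide)
      then have "Q vr (\<lambda>_. 1) = psi ?a (fst vr) (snd vr)"
        unfolding Q_def psi_def by (simp only: mult_1_right of_real_sum of_real_add add_ac)
      then show ?thesis unfolding P'_def q by (simp only:)
    qed
    have "AE vr in leb2. (\<integral>us. P' vr (zeta V (fst us) (snd us)) \<partial>\<nu> vr) = P' vr (\<lambda>_. 1)"
      using E(1)
    proof eventually_elim
      case (elim vr)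
      show ?case using elim unfolding \<nu>_def
        by (intro insert.IH pinned_elim[OF p x] pf) auto
    qed
    then have AE: "AE vr in leb2. complex_of_real (kern ?a (fst vr) (snd vr)) * (\<integral>us. P' vr (zeta V (fst us) (snd us)) \<partial>\<nu> vr)
       = complex_of_real (kern ?a (fst vr) (snd vr)) * poly q (psi ?a (fst vr) (snd vr))"
      by eventually_elim (simp add: P'1)
    have m: "(\<lambda>vr. complex_of_real (kern ?a (fst vr) (snd vr)) * poly q (psi ?a (fst vr) (snd vr))) \<in> borel_measurable leb2"
      unfolding poly_altdef psi_def kern_def by measurable
    have "(\<integral>p. P (zeta (insert x V) (fst p) (snd p)) \<partial>mu_pin (insert x V) W \<eta>)
      = (\<integral>vr. complex_of_real (kern ?a (fst vr) (snd vr)) * poly q (psi ?a (fst vr) (snd vr)) \<partial>leb2)"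
      unfolding E(3) by (rule Bochner_Integration.integral_cong_AE[OF E(2) m AE[unfolded \<nu>_def]])
    also have "\<dots> = poly q 1" using psi_poly_integral[OF a, of q] by (simp only: case_prod_beta')
    also have "\<dots> = P (\<lambda>_. 1)" unfolding q[symmetric] by (simp add: fun_upd_def)
    finally show ?case .
  qed
qed

text \<open>The pinning on \<open>S\<close> after the vertices of \<open>V - S\<close> have been identified with the root.\<close>

definition wire_pin :: "'v set \<Rightarrow> 'v set \<Rightarrow> ('v \<Rightarrow> 'v \<Rightarrow> real) \<Rightarrow> ('v \<Rightarrow> real) \<Rightarrow> 'v \<Rightarrow> real" where
  "wire_pin V S W \<eta> i = \<eta> i + (\<Sum>j\<in>V - S. W i j)"

text \<open>An exit from \<open>T \<subseteq> S\<close> in \<open>V\<close> is a pinned vertex, an edge inside \<open>S\<close>, or an edge to \<open>V - S\<close>; the last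
becomes pinning.\<close>

lemma pinned_wire_pin:
  assumes p: "pinned V W \<eta>" and S: "S \<subseteq> V"
  shows "pinned S W (wire_pin V S W \<eta>)"
proof -
  have fin: "finite V" by (rule pinned_finite[OF p])
  have w: "W i j \<ge> 0" if "i \<in> V" "j \<in> V" for i j using pinned_nonneg[OF p] that by auto
  have s: "(\<Sum>j\<in>V - S. W i j) \<ge> 0" if "i \<in> V" for i using w that by (intro sum_nonneg) auto
  show ?thesis unfolding pinned_def
  proof (intro conjI ballI allI impI)
    show "finite S" using fin S by (rule finite_subset[rotated])
    show "W i j = W j i" if "i \<in> S" "j \<in> S" for i j
      using pinned_nonneg(3)[OF p, of i j] that S by auto
    show "W i j \<ge> 0" if "i \<in> S" "j \<in> S" for i j
      using w that S by auto
    show "wire_pin V S W \<eta> i \<ge> 0" if "i \<in> S" for i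
      using pinned_nonneg(1)[OF p, of i] s[of i] that S by (auto simp: wire_pin_def)
  next
    fix T assume T: "T \<subseteq> S" "T \<noteq> {}"
    then have "T \<subseteq> V" using S by auto
    from p this T(2) show "\<exists>i\<in>T. 0 < wire_pin V S W \<eta> i \<or> (\<exists>j\<in>S - T. 0 < W i j)"
    proof (rule pinned_cut)
      fix i assume "i \<in> T" "\<eta> i > 0"
      then show ?thesis using s[of i] T S by (auto simp: wire_pin_def intro!: bexI[of _ i])
    next
      fix i j assume ij: "i \<in> T" "j \<in> V - T" "W i j > 0"
      show ?thesis
      proof (cases "j \<in> S")
        case True then show ?thesis using ij by blast
      next
        case False
        then have "(\<Sum>j\<in>V - S. W i j) > 0" using ij w T S fin by (intro sum_pos2[of _ j]) auto
        then show ?thesis using ij pinned_nonneg(1)[OF p, of i] T S by (auto simp: wire_pin_def intro!: bexI[of _ i])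
      qed
    qed
  qed
qed

lemma restrict_reinsert:
  assumes p: "pinned (insert x V) W \<eta>" and x: "x \<notin> V" and S: "S \<subseteq> V"
  shows "restrict (beta_at (insert x V) W \<eta> (fst (reinsert V W \<eta> x (vr, us)))) (insert x S)
      = (restrict (beta_at V (elim_W W x (exp (fst vr))) (elim_pin W \<eta> x (exp (fst vr))) (fst us)) S)(x := 1/2 * (W x x + exp (fst vr)))"
    and "restrict (theta_at (insert x V) W \<eta> (fst (reinsert V W \<eta> x (vr, us))) (snd (reinsert V W \<eta> x (vr, us)))) (insert x S)
      = (\<lambda>i\<in>S. restrict (theta_at V (elim_W W x (exp (fst vr))) (elim_pin W \<eta> x (exp (fst vr))) (fst us) (snd us)) S i - W i x * snd vr / exp (fst vr))(x := snd vr)"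
proof -
  have e: "fst (reinsert V W \<eta> x (vr, us)) = (fst us)(x := reinsert_u V W \<eta> x (fst vr) (fst us))"
    "snd (reinsert V W \<eta> x (vr, us)) = (snd us)(x := reinsert_s V W \<eta> x (snd vr) (fst us) (snd us))"
    by (simp_all add: reinsert_def case_prod_beta)
  show "restrict (beta_at (insert x V) W \<eta> (fst (reinsert V W \<eta> x (vr, us)))) (insert x S)
      = (restrict (beta_at V (elim_W W x (exp (fst vr))) (elim_pin W \<eta> x (exp (fst vr))) (fst us)) S)(x := 1/2 * (W x x + exp (fst vr)))"
    unfolding e using S x by (auto simp: fun_eq_iff restrict_def coords_reinsert(1)[OF p x] coords_reinsert(2)[OF p x] simp del: fun_upd_apply split: if_splits) (auto simp: coords_reinsert(1)[OF p x])
  show "restrict (theta_at (insert x V) W \<eta> (fst (reinsert V W \<eta> x (vr, us))) (snd (reinsert V W \<eta> x (vr, us)))) (insert x S)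
      = (\<lambda>i\<in>S. restrict (theta_at V (elim_W W x (exp (fst vr))) (elim_pin W \<eta> x (exp (fst vr))) (fst us) (snd us)) S i - W i x * snd vr / exp (fst vr))(x := snd vr)"
    unfolding e using S x by (auto simp: fun_eq_iff restrict_def coords_reinsert(3)[OF p x] coords_reinsert(4)[OF p x])
qed

text \<open>The first factor tests an event of the smaller \<open>\<sigma>\<close>-algebra, the second one is the process.\<close>

definition observable :: "'v set \<Rightarrow> ('v \<Rightarrow> 'v \<Rightarrow> real) \<Rightarrow> ('v \<Rightarrow> real) \<Rightarrow> 'v set \<Rightarrow>
    (('v \<Rightarrow> real) \<Rightarrow> ('v \<Rightarrow> real) \<Rightarrow> complex) \<Rightarrow> (('v \<Rightarrow> complex) \<Rightarrow> complex) \<Rightarrow> ('v \<Rightarrow> real) \<times> ('v \<Rightarrow> real) \<Rightarrow> complex" where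
  "observable V W \<eta> S \<Phi> P p =
     \<Phi> (restrict (beta_at V W \<eta> (fst p)) S) (restrict (theta_at V W \<eta> (fst p) (snd p)) S) * P (zeta V (fst p) (snd p))"

text \<open>The test function \<open>\<Phi>\<close> of the full fields, read as a function of the fields of the reduced model. The
shift of \<open>\<theta>\<close> undoes the change of the right-hand side under elimination.\<close>

definition elim_test :: "('v \<Rightarrow> 'v \<Rightarrow> real) \<Rightarrow> 'v \<Rightarrow> 'v set \<Rightarrow> real \<times> real \<Rightarrow>
    (('v \<Rightarrow> real) \<Rightarrow> ('v \<Rightarrow> real) \<Rightarrow> complex) \<Rightarrow> ('v \<Rightarrow> real) \<Rightarrow> ('v \<Rightarrow> real) \<Rightarrow> complex" where
  "elim_test W x S vr \<Phi> b t = \<Phi> (b(x := 1/2 * (W x x + exp (fst vr))))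
     ((\<lambda>i\<in>S. t i - W i x * snd vr / exp (fst vr))(x := snd vr))"

text \<open>The polynomial after \<open>\<zeta>\<^sub>x\<close> has been replaced by its affine expression in the other coordinates.\<close>

definition elim_poly :: "'v set \<Rightarrow> ('v \<Rightarrow> 'v \<Rightarrow> real) \<Rightarrow> ('v \<Rightarrow> real) \<Rightarrow> 'v \<Rightarrow> real \<times> real \<Rightarrow>
    (('v \<Rightarrow> complex) \<Rightarrow> complex) \<Rightarrow> ('v \<Rightarrow> complex) \<Rightarrow> complex" where
  "elim_poly V W \<eta> x vr P \<zeta> = P (\<zeta>(x := (of_real (\<eta> x) + \<i> * of_real (snd vr)
     + (\<Sum>j\<in>V. of_real (W x j) * \<zeta> j)) * (1 / complex_of_real (exp (fst vr)))))"

lemma polyfun_elim_poly: "finite V \<Longrightarrow> polyfun P \<Longrightarrow> polyfun (elim_poly V W \<eta> x vr P)"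
  unfolding elim_poly_def[abs_def] by (rule polyfun_substitute[OF _ polyfun_affine])

lemma observable_reinsert:
  assumes p: "pinned (insert x V) W \<eta>" and x: "x \<notin> V" and S: "S \<subseteq> V"
  shows "observable (insert x V) W \<eta> (insert x S) \<Phi> P (reinsert V W \<eta> x (vr, us))
    = observable V (elim_W W x (exp (fst vr))) (elim_pin W \<eta> x (exp (fst vr))) S (elim_test W x S vr \<Phi>) (elim_poly V W \<eta> x vr P) us"
  unfolding observable_def restrict_reinsert[OF p x S] zeta_reinsert[OF p x] elim_test_def elim_poly_def divide_inverse mult_1_left ..

lemma observable_empty: "observable V W \<eta> {} \<Phi> P p = \<Phi> (\<lambda>_. undefined) (\<lambda>_. undefined) * P (zeta V (fst p) (snd p))"
  by (simp add: observable_def restrict_def)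

text \<open>Elimination of \<open>x\<close> commutes with wiring, as far as the pinning is concerned.\<close>

lemma elim_pin_wire_pin:
  assumes "x \<notin> S" "x \<notin> V"
  shows "elim_pin W (wire_pin (insert x V) (insert x S) W \<eta>) x h = wire_pin V S (elim_W W x h) (elim_pin W \<eta> x h)"
proof
  fix i
  have VS: "insert x V - insert x S = V - S" using assms by auto
  have "elim_pin W (wire_pin (insert x V) (insert x S) W \<eta>) x h i = (\<eta> i + (\<Sum>j\<in>V - S. W i j)) + W i x * (\<eta> x + (\<Sum>j\<in>V - S. W x j)) / h"
    by (simp only: elim_pin_def wire_pin_def VS)
  also have "\<dots> = (\<eta> i + W i x * \<eta> x / h) + ((\<Sum>j\<in>V - S. W i j) + W i x / h * (\<Sum>j\<in>V - S. W x j))"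
    by (simp add: distrib_left add_divide_distrib)
  also have "(\<Sum>j\<in>V - S. W i j) + W i x / h * (\<Sum>j\<in>V - S. W x j) = (\<Sum>j\<in>V - S. elim_W W x h i j)"
    unfolding sum_distrib_left sum.distrib[symmetric] elim_W_def by simp
  finally show "elim_pin W (wire_pin (insert x V) (insert x S) W \<eta>) x h i = wire_pin V S (elim_W W x h) (elim_pin W \<eta> x h) i"
    by (simp only: wire_pin_def elim_pin_def)
qed

text \<open>Elimination of \<open>x\<close> commutes with wiring also for \<open>\<zeta>\<^sub>x\<close>: the wired vertices contribute through the
pinning instead of the sum, with \<open>\<zeta> = 1\<close>.\<close>

lemma elim_poly_wire_pin:
  assumes "x \<notin> S" "x \<notin> V" "S \<subseteq> V" "finite V"
  shows "elim_poly S W (wire_pin (insert x V) (insert x S) W \<eta>) x vr P (zeta S u s) = elim_poly V W \<eta> x vr P (zeta S u s)"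
proof -
  have VS: "insert x V - insert x S = V - S" using assms by auto
  have "(\<Sum>j\<in>V. complex_of_real (W x j) * zeta S u s j)
      = (\<Sum>j\<in>V - S. complex_of_real (W x j) * zeta S u s j) + (\<Sum>j\<in>S. complex_of_real (W x j) * zeta S u s j)"
    by (rule sum.subset_diff[OF assms(3,4)])
  also have "(\<Sum>j\<in>V - S. complex_of_real (W x j) * zeta S u s j) = complex_of_real (\<Sum>j\<in>V - S. W x j)"
    unfolding of_real_sum by (rule sum.cong[OF refl]) (simp add: zeta_def)
  finally show ?thesis unfolding elim_poly_def wire_pin_def VS by (simp only: of_real_add add_ac)
qed

text \<open>The martingale property for one pair of vertex sets, for all weights and observables at once.
Elimination changes the weights and the observable, so the induction over \<open>S\<close> needs all of them.\<close>

definition wiring_id :: "'v set \<Rightarrow> 'v set \<Rightarrow> bool" where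
  "wiring_id V S \<longleftrightarrow> (\<forall>W \<eta> \<Phi> P. pinned V W \<eta> \<longrightarrow> polyfun P \<longrightarrow>
     integrable (mu_pin V W \<eta>) (observable V W \<eta> S \<Phi> P) \<longrightarrow>
     integrable (mu_pin S W (wire_pin V S W \<eta>)) (observable S W (wire_pin V S W \<eta>) S \<Phi> P) \<longrightarrow>
     (\<integral>p. observable V W \<eta> S \<Phi> P p \<partial>mu_pin V W \<eta>)
      = (\<integral>p. observable S W (wire_pin V S W \<eta>) S \<Phi> P p \<partial>mu_pin S W (wire_pin V S W \<eta>)))"

lemma wiring_idD:
  assumes "wiring_id V S" "pinned V W \<eta>" "polyfun P"
    and "integrable (mu_pin V W \<eta>) (observable V W \<eta> S \<Phi> P)"
    and "integrable (mu_pin S W (wire_pin V S W \<eta>)) (observable S W (wire_pin V S W \<eta>) S \<Phi> P)"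
  shows "(\<integral>p. observable V W \<eta> S \<Phi> P p \<partial>mu_pin V W \<eta>)
    = (\<integral>p. observable S W (wire_pin V S W \<eta>) S \<Phi> P p \<partial>mu_pin S W (wire_pin V S W \<eta>))"
  by (rule assms(1)[unfolded wiring_id_def, rule_format, OF assms(2-5)])

text \<open>Both sides are a constant times the expectation of a polynomial in \<open>\<zeta>\<close>.\<close>

lemma wiring_id_empty: "wiring_id V {}"
  unfolding wiring_id_def
proof (intro allI impI)
  fix W \<eta> \<Phi> and P :: "('a \<Rightarrow> complex) \<Rightarrow> complex"
  assume p: "pinned V W \<eta>" and P: "polyfun P"
    and I1: "integrable (mu_pin V W \<eta>) (observable V W \<eta> {} \<Phi> P)"
    and I2: "integrable (mu_pin {} W (wire_pin V {} W \<eta>)) (observable {} W (wire_pin V {} W \<eta>) {} \<Phi> P)"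
  let ?c = "\<Phi> (\<lambda>_. undefined) (\<lambda>_. undefined)"
  have pf: "polyfun (\<lambda>\<zeta>. ?c * P \<zeta>)" by (rule polyfun_mult[OF polyfun_const P])
  note p0 = pinned_wire_pin[OF p empty_subsetI]
  show "(\<integral>p. observable V W \<eta> {} \<Phi> P p \<partial>mu_pin V W \<eta>)
      = (\<integral>p. observable {} W (wire_pin V {} W \<eta>) {} \<Phi> P p \<partial>mu_pin {} W (wire_pin V {} W \<eta>))"
    unfolding observable_empty
    using zeta_polynomial_integral[OF p pf I1[unfolded observable_empty[abs_def]]]
      zeta_polynomial_integral[OF p0 pf I2[unfolded observable_empty[abs_def]]] by (simp only:)
qed

text \<open>Eliminate \<open>x\<close> from both models. The kernels coincide because the total weight at \<open>x\<close> is the same in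
both, and for almost every \<open>(v, r)\<close> the inner integrals are related by the induction hypothesis.\<close>

lemma wiring_id_insert:
  assumes xV: "x \<notin> V" and xS: "x \<notin> S" and SV: "S \<subseteq> V" and red: "wiring_id V S"
  shows "wiring_id (insert x V) (insert x S)"
  unfolding wiring_id_def
proof (intro allI impI)
  fix W \<eta> \<Phi> and P :: "('a \<Rightarrow> complex) \<Rightarrow> complex"
  let ?\<eta> = "wire_pin (insert x V) (insert x S) W \<eta>"
  assume p: "pinned (insert x V) W \<eta>" and pf: "polyfun P"
    and I1: "integrable (mu_pin (insert x V) W \<eta>) (observable (insert x V) W \<eta> (insert x S) \<Phi> P)"
    and I2: "integrable (mu_pin (insert x S) W ?\<eta>) (observable (insert x S) W ?\<eta> (insert x S) \<Phi> P)"
  have VS: "insert x V - insert x S = V - S" using xV xS by blast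
  have finV: "finite V" using pinned_finite[OF p] by simp
  have pS: "pinned (insert x S) W ?\<eta>" by (rule pinned_wire_pin[OF p]) (use SV in blast)
  let ?a = "\<eta> x + (\<Sum>j\<in>V. W x j)"
  have aS: "?\<eta> x + (\<Sum>j\<in>S. W x j) = ?a"
    by (simp only: wire_pin_def VS sum.subset_diff[OF SV finV] add.assoc)
  note EV = mu_pin_integral_insert[OF p xV I1, unfolded observable_reinsert[OF p xV SV]]
  note ES = mu_pin_integral_insert[OF pS xS I2, unfolded observable_reinsert[OF pS xS subset_refl] aS elim_pin_wire_pin[OF xS xV]]
  have obs: "observable S A B S (elim_test W x S vr \<Phi>) (elim_poly S W ?\<eta> x vr P) us
    = observable S A B S (elim_test W x S vr \<Phi>) (elim_poly V W \<eta> x vr P) us" for A B vr us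
    unfolding observable_def elim_poly_wire_pin[OF xS xV SV finV] ..
  note ES' = ES[unfolded obs]
  have AE: "AE vr in leb2.
     complex_of_real (kern ?a (fst vr) (snd vr)) * (\<integral>us. observable V (elim_W W x (exp (fst vr))) (elim_pin W \<eta> x (exp (fst vr))) S (elim_test W x S vr \<Phi>) (elim_poly V W \<eta> x vr P) us
          \<partial>mu_pin V (elim_W W x (exp (fst vr))) (elim_pin W \<eta> x (exp (fst vr))))
   = complex_of_real (kern ?a (fst vr) (snd vr)) * (\<integral>us. observable S (elim_W W x (exp (fst vr))) (wire_pin V S (elim_W W x (exp (fst vr))) (elim_pin W \<eta> x (exp (fst vr)))) S (elim_test W x S vr \<Phi>) (elim_poly V W \<eta> x vr P) us
          \<partial>mu_pin S (elim_W W x (exp (fst vr))) (wire_pin V S (elim_W W x (exp (fst vr))) (elim_pin W \<eta> x (exp (fst vr)))))"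
    using EV(1) ES'(1)
  proof eventually_elim
    case (elim vr)
    have pe: "pinned V (elim_W W x (exp (fst vr))) (elim_pin W \<eta> x (exp (fst vr)))"
      by (rule pinned_elim[OF p xV]) simp
    show ?case
      by (simp only: wiring_idD[OF red pe polyfun_elim_poly[OF finV pf] elim(1) elim(2)])
  qed
  show "(\<integral>p. observable (insert x V) W \<eta> (insert x S) \<Phi> P p \<partial>mu_pin (insert x V) W \<eta>)
      = (\<integral>p. observable (insert x S) W ?\<eta> (insert x S) \<Phi> P p \<partial>mu_pin (insert x S) W ?\<eta>)"
    unfolding EV(3) ES'(3) by (rule Bochner_Integration.integral_cong_AE[OF EV(2) ES'(2) AE])
qed

lemma wiring_id_subset:
  assumes "finite S" "S \<subseteq> V"
  shows "wiring_id V S"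
  using assms
proof (induction S arbitrary: V)
  case empty
  show ?case by (rule wiring_id_empty)
next
  case (insert x S)
  have "wiring_id (insert x (V - {x})) (insert x S)"
    using insert by (intro wiring_id_insert insert.IH) auto
  moreover have "insert x (V - {x}) = V" using insert.prems by blast
  ultimately show ?case by simp
qed

section \<open>Integrability of polynomials in zeta\<close>

text \<open>Growth slower than any exponential of \<open>Q\<close>. This class of functions is closed under products, which
saves all bookkeeping of constants and powers.\<close>

definition controlled :: "('x \<Rightarrow> real) \<Rightarrow> ('x \<Rightarrow> 'b::real_normed_algebra_1) \<Rightarrow> bool" where
  "controlled Q f \<longleftrightarrow> (\<forall>\<epsilon>>0. \<exists>C\<ge>0. \<forall>x. norm (f x) \<le> C * exp (\<epsilon> * Q x))"

lemma controlledE: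
  assumes "controlled Q f" "\<epsilon> > 0"
  obtains C where "C \<ge> 0" "\<And>x. norm (f x) \<le> C * exp (\<epsilon> * Q x)"
  using assms unfolding controlled_def by blast

lemma controlled_const:
  assumes "\<And>x. Q x \<ge> 0"
  shows "controlled Q (\<lambda>_. c)"
  unfolding controlled_def
proof (intro allI impI exI[of _ "norm c"] conjI)
  fix \<epsilon> :: real and x assume "\<epsilon> > 0"
  then have "1 \<le> exp (\<epsilon> * Q x)" using assms[of x] by simp
  then show "norm c \<le> norm c * exp (\<epsilon> * Q x)" by (metis mult.right_neutral mult_left_mono norm_ge_zero)
qed simp

lemma controlled_add:
  assumes "controlled Q f" "controlled Q g"
  shows "controlled Q (\<lambda>x. f x + g x)"
  unfolding controlled_def
proof (intro allI impI)
  fix \<epsilon> :: real assume e: "\<epsilon> > 0"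
  obtain C where C: "C \<ge> 0" "\<And>x. norm (f x) \<le> C * exp (\<epsilon> * Q x)" using controlledE[OF assms(1) e] by blast
  obtain D where D: "D \<ge> 0" "\<And>x. norm (g x) \<le> D * exp (\<epsilon> * Q x)" using controlledE[OF assms(2) e] by blast
  have "norm (f x + g x) \<le> (C + D) * exp (\<epsilon> * Q x)" for x
    using norm_triangle_ineq[of "f x" "g x"] C(2)[of x] D(2)[of x] by (simp add: distrib_right)
  then show "\<exists>C\<ge>0. \<forall>x. norm (f x + g x) \<le> C * exp (\<epsilon> * Q x)" using C D by (intro exI[of _ "C + D"]) auto
qed

lemma controlled_mult:
  assumes "controlled Q f" "controlled Q g"
  shows "controlled Q (\<lambda>x. f x * g x)"
  unfolding controlled_def
proof (intro allI impI)
  fix \<epsilon> :: real assume "\<epsilon> > 0"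
  then have e: "\<epsilon> / 2 > 0" by simp
  obtain C where C: "C \<ge> 0" "\<And>x. norm (f x) \<le> C * exp (\<epsilon> / 2 * Q x)" using controlledE[OF assms(1) e] by blast
  obtain D where D: "D \<ge> 0" "\<And>x. norm (g x) \<le> D * exp (\<epsilon> / 2 * Q x)" using controlledE[OF assms(2) e] by blast
  have "norm (f x * g x) \<le> C * D * exp (\<epsilon> * Q x)" for x
  proof -
    have "norm (f x * g x) \<le> norm (f x) * norm (g x)" by (rule norm_mult_ineq)
    also have "\<dots> \<le> (C * exp (\<epsilon> / 2 * Q x)) * (D * exp (\<epsilon> / 2 * Q x))"
      using C D by (intro mult_mono) auto
    also have "\<dots> = C * D * (exp (\<epsilon> / 2 * Q x) * exp (\<epsilon> / 2 * Q x))" by simp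
    also have "exp (\<epsilon> / 2 * Q x) * exp (\<epsilon> / 2 * Q x) = exp (\<epsilon> * Q x)" unfolding exp_add[symmetric] by simp
    finally show ?thesis .
  qed
  then show "\<exists>C\<ge>0. \<forall>x. norm (f x * g x) \<le> C * exp (\<epsilon> * Q x)" using C D by (intro exI[of _ "C * D"]) auto
qed

lemma controlled_le:
  assumes "controlled Q g" "\<And>x. norm (f x) \<le> norm (g x)"
  shows "controlled Q f"
  using assms unfolding controlled_def by (meson order_trans)

lemma controlled_self:
  assumes "\<And>x. Q x \<ge> 0"
  shows "controlled Q Q"
  unfolding controlled_def
proof (intro allI impI)
  fix \<epsilon> :: real assume e: "\<epsilon> > 0"
  have "norm (Q x) \<le> 1 / \<epsilon> * exp (\<epsilon> * Q x)" for x
  proof -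
    have "\<epsilon> * Q x \<le> exp (\<epsilon> * Q x)" using exp_ge_add_one_self[of "\<epsilon> * Q x"] by linarith
    then show ?thesis using e assms[of x] by (simp add: field_simps)
  qed
  then show "\<exists>C\<ge>0. \<forall>x. norm (Q x) \<le> C * exp (\<epsilon> * Q x)" using e by (intro exI[of _ "1 / \<epsilon>"]) auto
qed

text \<open>Across an edge, \<open>\<bar>a - b\<bar>\<close> is at most logarithmic in \<open>Q\<close> because the energy contains \<open>cosh (a - b)\<close>, and
\<open>(s - t)\<^sup>2\<close> is at most \<open>Q\<close> times \<open>e\<^bsup>-a-b\<^esup>\<close>. For \<open>b = t = 0\<close> the lemma covers an edge to the root.\<close>

lemma controlled_edge:
  fixes a b s t Q :: "'x \<Rightarrow> real"
  assumes Q: "\<And>x. Q x \<ge> 0" and K: "K \<ge> 0"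
    and e: "\<And>x. pair_energy (a x) (s x) (b x) (t x) \<le> K * Q x"
    and b: "controlled Q (\<lambda>x. exp \<bar>b x\<bar>)" and t: "controlled Q t"
  shows "controlled Q (\<lambda>x. exp \<bar>a x\<bar>)" and "controlled Q s"
proof -
  have 1: "controlled Q (\<lambda>x. exp \<bar>b x\<bar> * (2 * (1 + K * Q x)))"
    by (intro controlled_mult[OF b] controlled_mult[OF controlled_const[OF Q]] controlled_add[OF controlled_const[OF Q]] controlled_self[OF Q])
  have A: "exp \<bar>a x\<bar> \<le> exp \<bar>b x\<bar> * (2 * (1 + K * Q x))" for x
  proof -
    have "cosh (a x - b x) - 1 \<le> pair_energy (a x) (s x) (b x) (t x)" by (simp add: pair_energy_def)
    then have "cosh (a x - b x) \<le> 1 + K * Q x" using e[of x] by simp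
    moreover have "exp \<bar>a x - b x\<bar> \<le> 2 * cosh (a x - b x)" by (auto simp: cosh_def abs_if)
    ultimately have 2: "exp \<bar>a x - b x\<bar> \<le> 2 * (1 + K * Q x)" by simp
    have "exp \<bar>a x\<bar> \<le> exp (\<bar>b x\<bar> + \<bar>a x - b x\<bar>)" by simp
    also have "\<dots> = exp \<bar>b x\<bar> * exp \<bar>a x - b x\<bar>" by (rule exp_add)
    also have "\<dots> \<le> exp \<bar>b x\<bar> * (2 * (1 + K * Q x))" using 2 by (intro mult_left_mono) auto
    finally show ?thesis .
  qed
  show a: "controlled Q (\<lambda>x. exp \<bar>a x\<bar>)"
    by (rule controlled_le[OF 1]) (use A in \<open>simp add: order_trans[OF _ abs_ge_self]\<close>)
  have 3: "controlled Q (\<lambda>x. \<bar>t x\<bar> + (1 + 2 * (K * Q x) * (exp \<bar>a x\<bar> * exp \<bar>b x\<bar>)))"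
    by (intro controlled_add controlled_mult a b controlled_const[OF Q] controlled_self[OF Q] controlled_le[OF t]) simp
  have B: "\<bar>s x\<bar> \<le> \<bar>t x\<bar> + (1 + 2 * (K * Q x) * (exp \<bar>a x\<bar> * exp \<bar>b x\<bar>))" for x
  proof -
    have "1 / 2 * (s x - t x)\<^sup>2 * exp (a x + b x) \<le> pair_energy (a x) (s x) (b x) (t x)"
      using cosh_real_ge_1[of "a x - b x"] by (simp add: pair_energy_def)
    then have "(s x - t x)\<^sup>2 * exp (a x + b x) \<le> 2 * (K * Q x)" using e[of x] by simp
    then have "(s x - t x)\<^sup>2 * exp (a x + b x) * exp (- (a x + b x)) \<le> 2 * (K * Q x) * exp (- (a x + b x))"
      by (intro mult_right_mono) auto
    moreover have "exp (a x + b x) * exp (- (a x + b x)) = 1" by (simp only: exp_minus) simp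
    ultimately have "(s x - t x)\<^sup>2 \<le> 2 * (K * Q x) * exp (- (a x + b x))" by (simp only: mult.assoc mult_1_right)
    also have "\<dots> \<le> 2 * (K * Q x) * (exp \<bar>a x\<bar> * exp \<bar>b x\<bar>)"
      unfolding exp_add[symmetric] using K Q by (intro mult_left_mono) auto
    finally have 4: "(s x - t x)\<^sup>2 \<le> 2 * (K * Q x) * (exp \<bar>a x\<bar> * exp \<bar>b x\<bar>)" .
    have "0 \<le> (\<bar>s x - t x\<bar> - 1)\<^sup>2" by simp
    then have "2 * \<bar>s x - t x\<bar> \<le> 1 + (s x - t x)\<^sup>2" by (simp add: power2_diff)
    then have "\<bar>s x - t x\<bar> \<le> 1 + (s x - t x)\<^sup>2" by (simp add: abs_if split: if_splits)
    then show ?thesis using 4 by linarith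
  qed
  show "controlled Q s"
    by (rule controlled_le[OF 3]) (use B in \<open>simp add: order_trans[OF _ abs_ge_self]\<close>)
qed

lemma energy_ge:
  assumes p: "pinned V W \<eta>" and i: "i \<in> V"
  shows "0 \<le> energy V W \<eta> u s" and "\<eta> i * pair_energy (u i) (s i) 0 0 \<le> energy V W \<eta> u s"
    and "j \<in> V \<Longrightarrow> W i j * pair_energy (u i) (s i) (u j) (s j) \<le> 2 * energy V W \<eta> u s"
proof -
  have fin: "finite V" by (rule pinned_finite[OF p])
  have w: "0 \<le> W i j * pair_energy (u i) (s i) (u j) (s j)" if "i \<in> V" "j \<in> V" for i j
    using pinned_nonneg(2)[OF p] that pair_energy_nonneg by simp
  have h: "0 \<le> \<eta> i * pair_energy (u i) (s i) 0 0" if "i \<in> V" for i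
    using pinned_nonneg(1)[OF p] that pair_energy_nonneg by simp
  have r: "0 \<le> (\<Sum>j\<in>V. W i j * pair_energy (u i) (s i) (u j) (s j))" if "i \<in> V" for i
    using w that by (intro sum_nonneg) auto
  have A: "0 \<le> (\<Sum>i\<in>V. \<Sum>j\<in>V. W i j * pair_energy (u i) (s i) (u j) (s j))" by (rule sum_nonneg) (rule r)
  have B: "0 \<le> (\<Sum>i\<in>V. \<eta> i * pair_energy (u i) (s i) 0 0)" using h by (intro sum_nonneg) auto
  show "0 \<le> energy V W \<eta> u s" unfolding energy_def using A B by simp
  have "\<eta> i * pair_energy (u i) (s i) 0 0 \<le> (\<Sum>i\<in>V. \<eta> i * pair_energy (u i) (s i) 0 0)"
    using fin i h by (intro member_le_sum) auto
  then show "\<eta> i * pair_energy (u i) (s i) 0 0 \<le> energy V W \<eta> u s" unfolding energy_def using A by simp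
  show "W i j * pair_energy (u i) (s i) (u j) (s j) \<le> 2 * energy V W \<eta> u s" if j: "j \<in> V"
  proof -
    have "W i j * pair_energy (u i) (s i) (u j) (s j) \<le> (\<Sum>j\<in>V. W i j * pair_energy (u i) (s i) (u j) (s j))"
      using fin j w i by (intro member_le_sum) auto
    also have "\<dots> \<le> (\<Sum>i\<in>V. \<Sum>j\<in>V. W i j * pair_energy (u i) (s i) (u j) (s j))"
      using fin i r by (intro member_le_sum[of i V "\<lambda>i. \<Sum>j\<in>V. W i j * pair_energy (u i) (s i) (u j) (s j)"]) auto
    finally show ?thesis unfolding energy_def using B by simp
  qed
qed

text \<open>The set of vertices for which the bounds fail has no exit, so it is empty by the cut condition.\<close>

lemma controlled_vertex:
  fixes V :: "'v set"
  assumes p: "pinned V W \<eta>"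
  defines "Q \<equiv> \<lambda>p :: ('v \<Rightarrow> real) \<times> ('v \<Rightarrow> real). energy V W \<eta> (fst p) (snd p)"
  assumes i: "i \<in> V"
  shows "controlled Q (\<lambda>p. exp \<bar>fst p i\<bar>)" "controlled Q (\<lambda>p. snd p i)"
proof -
  define G where "G = {i \<in> V. controlled Q (\<lambda>p. exp \<bar>fst p i\<bar>) \<and> controlled Q (\<lambda>p. snd p i)}"
  have Q: "Q x \<ge> 0" for x unfolding Q_def by (rule energy_ge(1)[OF p i])
  have "V - G = {}"
  proof (rule ccontr)
    assume "V - G \<noteq> {}"
    from p Diff_subset this show False
    proof (rule pinned_cut)
      fix k assume k: "k \<in> V - G" "\<eta> k > 0"
      have e: "pair_energy (fst x k) (snd x k) 0 0 \<le> 1 / \<eta> k * Q x" for x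
        using energy_ge(2)[OF p, of k "fst x" "snd x"] k by (simp add: Q_def field_simps)
      have "controlled Q (\<lambda>p. exp \<bar>fst p k\<bar>)" "controlled Q (\<lambda>p. snd p k)"
        by (rule controlled_edge[where b="\<lambda>_. 0" and t="\<lambda>_. 0", OF Q _ e]; use k in \<open>simp add: controlled_const[OF Q]\<close>)+
      then show False using k by (auto simp: G_def)
    next
      fix k j assume k: "k \<in> V - G" "j \<in> V - (V - G)" "W k j > 0"
      then have j: "j \<in> V" "controlled Q (\<lambda>p. exp \<bar>fst p j\<bar>)" "controlled Q (\<lambda>p. snd p j)" by (auto simp: G_def)
      have e: "pair_energy (fst x k) (snd x k) (fst x j) (snd x j) \<le> 2 / W k j * Q x" for x
        using energy_ge(3)[OF p, of k j "fst x" "snd x"] k j by (simp add: Q_def field_simps)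
      have K: "0 \<le> 2 / W k j" using k by simp
      have "controlled Q (\<lambda>p. exp \<bar>fst p k\<bar>)" "controlled Q (\<lambda>p. snd p k)"
        by (rule controlled_edge[where a="\<lambda>p. fst p k" and s="\<lambda>p. snd p k" and b="\<lambda>p. fst p j" and t="\<lambda>p. snd p j", OF Q K e j(2,3)])+
      then show False using k by (auto simp: G_def)
    qed
  qed
  then have "i \<in> G" using i by auto
  then show "controlled Q (\<lambda>p. exp \<bar>fst p i\<bar>)" "controlled Q (\<lambda>p. snd p i)" by (auto simp: G_def)
qed

lemma energy_nonneg: "pinned V W \<eta> \<Longrightarrow> 0 \<le> energy V W \<eta> u s"
proof (cases "V = {}")
  case True then show ?thesis by (simp add: energy_def)
next
  case False
  assume "pinned V W \<eta>"
  moreover obtain i where "i \<in> V" using False by blast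
  ultimately show ?thesis by (rule energy_ge(1))
qed

lemma controlled_polyfun:
  fixes V :: "'v set"
  assumes p: "pinned V W \<eta>" and P: "polyfun P"
  shows "controlled (\<lambda>p. energy V W \<eta> (fst p) (snd p)) (\<lambda>p. P (zeta V (fst p) (snd p)))"
  using P
proof induction
  case (polyfun_const c)
  show ?case by (rule controlled_const[OF energy_nonneg[OF p]])
next
  case (polyfun_coord j)
  let ?Q = "\<lambda>p. energy V W \<eta> (fst p) (snd p)"
  show ?case
  proof (cases "j \<in> V")
    case False
    then show ?thesis using controlled_const[OF energy_nonneg[OF p]] by (simp add: zeta_def)
  next
    case True
    note c = controlled_vertex[OF p True]
    have "controlled ?Q (\<lambda>p. exp \<bar>fst p j\<bar> * (1 + \<bar>snd p j\<bar>))"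
      by (intro controlled_mult c(1) controlled_add controlled_const[OF energy_nonneg[OF p]] controlled_le[OF c(2)]) simp
    then show ?thesis
    proof (rule controlled_le)
      fix x :: "('v \<Rightarrow> real) \<times> ('v \<Rightarrow> real)"
      have "norm (1 + \<i> * complex_of_real (snd x j)) \<le> 1 + \<bar>snd x j\<bar>"
        by (rule order_trans[OF norm_triangle_ineq]) (simp add: norm_mult)
      then have "exp (fst x j) * norm (1 + \<i> * complex_of_real (snd x j)) \<le> exp \<bar>fst x j\<bar> * (1 + \<bar>snd x j\<bar>)"
        by (intro mult_mono) auto
      then show "norm (zeta V (fst x) (snd x) j) \<le> norm (exp \<bar>fst x j\<bar> * (1 + \<bar>snd x j\<bar>))"
        using True by (simp add: zeta_def norm_mult)
    qed
  qed
qed (auto intro: controlled_add controlled_mult)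

lemma polyfun_zeta_measurable:
  assumes "polyfun P"
  shows "(\<lambda>p. P (zeta V (fst p) (snd p))) \<in> borel_measurable (leb_us V)"
  using assms
proof induction
  case (polyfun_coord j)
  show ?case
  proof (cases "j \<in> V")
    case True
    note [measurable] = leb_us_coord[OF True]
    show ?thesis using True unfolding zeta_def by simp
  qed (simp add: zeta_def)
qed auto

text \<open>The determinant is homogeneous in the weights and the energy is linear in them.\<close>

lemma dens_pin_half:
  assumes "finite V"
  shows "dens_pin V W \<eta> u s = 2 ^ card V * exp (- 1/2 * energy V W \<eta> u s) * dens_pin V (\<lambda>i j. W i j / 2) (\<lambda>i. \<eta> i / 2) u s"
proof -
  have f: "local_field V (\<lambda>i j. W i j / 2) (\<lambda>i. \<eta> i / 2) u i = local_field V W \<eta> u i / 2" for i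
    by (simp add: local_field_def add_divide_distrib sum_divide_distrib)
  have "A_pin V W \<eta> u = (\<lambda>i j. 2 * A_pin V (\<lambda>i j. W i j / 2) (\<lambda>i. \<eta> i / 2) u i j)"
    by (intro ext) (simp add: A_pin_def f)
  then have d: "det_on V (A_pin V W \<eta> u) = 2 ^ card V * det_on V (A_pin V (\<lambda>i j. W i j / 2) (\<lambda>i. \<eta> i / 2) u)"
    by (simp add: det_on_smult[OF assms])
  have e: "energy V (\<lambda>i j. W i j / 2) (\<lambda>i. \<eta> i / 2) u s = energy V W \<eta> u s / 2"
    by (simp add: energy_def add_divide_distrib sum_divide_distrib)
  have "exp (- energy V W \<eta> u s) = exp (- 1/2 * energy V W \<eta> u s) * exp (- (energy V W \<eta> u s / 2))"
    unfolding exp_add[symmetric] by simp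
  then show ?thesis unfolding dens_pin_def d e by simp
qed

lemma pinned_half: "pinned V W \<eta> \<Longrightarrow> pinned V (\<lambda>i j. W i j / 2) (\<lambda>i. \<eta> i / 2)"
  unfolding pinned_def by simp

text \<open>The factor \<open>exp(-energy/2)\<close> gained by halving the weights bounds the polynomial, and the model with
halved weights has mass 1.\<close>

lemma integrable_polyfun_zeta:
  assumes p: "pinned V W \<eta>" and P: "polyfun P"
  shows "integrable (mu_pin V W \<eta>) (\<lambda>p. P (zeta V (fst p) (snd p)))"
proof (rule integrableI_bounded)
  have V: "finite V" by (rule pinned_finite[OF p])
  let ?W = "\<lambda>i j. W i j / 2" and ?\<eta> = "\<lambda>i. \<eta> i / 2"
  note p2 = pinned_half[OF p]
  note m = polyfun_zeta_measurable[OF P, of V]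
  show "(\<lambda>p. P (zeta V (fst p) (snd p))) \<in> borel_measurable (mu_pin V W \<eta>)" using m by (simp add: mu_pin_def)
  obtain C where C: "C \<ge> 0" "\<And>x. norm (P (zeta V (fst x) (snd x))) \<le> C * exp (1/2 * energy V W \<eta> (fst x) (snd x))"
    using controlledE[OF controlled_polyfun[OF p P], of "1/2"] by auto
  have dm: "(\<lambda>p. ennreal (dens_pin V A B (fst p) (snd p))) \<in> borel_measurable (leb_us V)" for A B
    by (rule measurable_compose[OF dens_pin_leb_us[OF V] measurable_ennreal])
  have nm: "(\<lambda>p. ennreal (norm (P (zeta V (fst p) (snd p))))) \<in> borel_measurable (leb_us V)"
    using m by measurable
  have "(\<integral>\<^sup>+x. ennreal (norm (P (zeta V (fst x) (snd x)))) \<partial>mu_pin V W \<eta>)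
    = (\<integral>\<^sup>+x. ennreal (dens_pin V W \<eta> (fst x) (snd x)) * ennreal (norm (P (zeta V (fst x) (snd x)))) \<partial>leb_us V)"
    unfolding mu_pin_def by (rule nn_integral_density[OF dm nm])
  also have "\<dots> \<le> (\<integral>\<^sup>+x. ennreal (C * 2 ^ card V) * ennreal (dens_pin V ?W ?\<eta> (fst x) (snd x)) \<partial>leb_us V)"
  proof (rule nn_integral_mono)
    fix x
    let ?d = "dens_pin V ?W ?\<eta> (fst x) (snd x)" and ?E = "energy V W \<eta> (fst x) (snd x)"
    have d0: "0 \<le> ?d" by (rule dens_pin_nonneg[OF p2])
    have "dens_pin V W \<eta> (fst x) (snd x) * norm (P (zeta V (fst x) (snd x))) \<le> dens_pin V W \<eta> (fst x) (snd x) * (C * exp (1/2 * ?E))"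
      by (rule mult_left_mono[OF C(2) dens_pin_nonneg[OF p]])
    also have "\<dots> = C * 2 ^ card V * ?d * (exp (- 1/2 * ?E) * exp (1/2 * ?E))"
      unfolding dens_pin_half[OF V, of W] by (simp only: mult_ac)
    also have "exp (- 1/2 * ?E) * exp (1/2 * ?E) = 1" unfolding exp_add[symmetric] by simp
    finally have "dens_pin V W \<eta> (fst x) (snd x) * norm (P (zeta V (fst x) (snd x))) \<le> C * 2 ^ card V * ?d" by simp
    then show "ennreal (dens_pin V W \<eta> (fst x) (snd x)) * ennreal (norm (P (zeta V (fst x) (snd x)))) \<le> ennreal (C * 2 ^ card V) * ennreal ?d"
      using C(1) d0 dens_pin_nonneg[OF p, of "fst x" "snd x"]
      by (subst (1 2) ennreal_mult[symmetric]) (auto intro!: ennreal_leI)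
  qed
  also have "\<dots> = ennreal (C * 2 ^ card V) * (\<integral>\<^sup>+x. ennreal (dens_pin V ?W ?\<eta> (fst x) (snd x)) \<partial>leb_us V)"
    by (rule nn_integral_cmult[OF dm])
  also have "(\<integral>\<^sup>+x. ennreal (dens_pin V ?W ?\<eta> (fst x) (snd x)) \<partial>leb_us V) = emeasure (mu_pin V ?W ?\<eta>) (space (mu_pin V ?W ?\<eta>))"
  proof -
    have "emeasure (mu_pin V ?W ?\<eta>) (space (mu_pin V ?W ?\<eta>)) = (\<integral>\<^sup>+p. ennreal (dens_pin V ?W ?\<eta> (fst p) (snd p)) * indicator (space (leb_us V)) p \<partial>leb_us V)"
      unfolding mu_pin_def space_density by (rule emeasure_density[OF dm sets.top])
    moreover have "\<dots> = (\<integral>\<^sup>+p. ennreal (dens_pin V ?W ?\<eta> (fst p) (snd p)) \<partial>leb_us V)"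
      by (rule nn_integral_cong) simp
    ultimately show ?thesis by simp
  qed
  also have "\<dots> = 1" by (rule emeasure_mu_pin_space[OF p2])
  finally show "(\<integral>\<^sup>+x. ennreal (norm (P (zeta V (fst x) (snd x)))) \<partial>mu_pin V W \<eta>) < \<infinity>"
    using le_less_trans by fastforce
qed

section \<open>Inverting the matrix measurably\<close>

text \<open>Gaussian elimination for the linear system. Everything depends on a parameter \<open>z\<close>, because the
reduced weights do. A recursive construction of the solution shows that it can be chosen
measurably, which is not visible from the existence of an inverse.\<close>

lemma A_pin_solve_measurable:
  fixes V :: "'v set" and W :: "'z \<Rightarrow> 'v \<Rightarrow> 'v \<Rightarrow> real"
  assumes "finite V" and "\<And>z. pinned V (W z) (\<eta> z)"
    and "\<And>i j. i \<in> V \<Longrightarrow> j \<in> V \<Longrightarrow> (\<lambda>z. W z i j) \<in> borel_measurable N"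
    and "\<And>i. i \<in> V \<Longrightarrow> (\<lambda>z. \<eta> z i) \<in> borel_measurable N"
    and "\<And>i. i \<in> V \<Longrightarrow> (\<lambda>z. u z i) \<in> borel_measurable N"
    and "\<And>i. i \<in> V \<Longrightarrow> (\<lambda>z. c z i) \<in> borel_measurable N"
  shows "\<exists>y. (\<forall>i\<in>V. (\<lambda>z. y z i) \<in> borel_measurable N) \<and>
     (\<forall>z. \<forall>i\<in>V. (\<Sum>j\<in>V. A_pin V (W z) (\<eta> z) (u z) i j * y z j) = c z i)"
  using assms
proof (induction V arbitrary: W \<eta> c)
  case empty
  then show ?case by auto
next
  case (insert x V)
  note p = insert.prems(1) and x = insert.hyps(2) and fin = insert.hyps(1)
  note Wm = insert.prems(2) and em = insert.prems(3) and um = insert.prems(4) and cm = insert.prems(5)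
  define g where "g = (\<lambda>z. \<eta> z x + (\<Sum>j\<in>V. W z x j * exp (u z j)))"
  define h where "h = (\<lambda>z. g z * exp (- u z x))"
  have g: "g z > 0" for z unfolding g_def using pinned_weighted_pos[OF p x] by simp
  have h: "h z > 0" for z unfolding h_def using g by simp
  have uh: "exp (u z x) * h z = \<eta> z x + (\<Sum>j\<in>V. W z x j * exp (u z j))" for z
  proof -
    have "exp (u z x) * h z = g z * (exp (u z x) * exp (- u z x))" by (simp add: h_def)
    also have "exp (u z x) * exp (- u z x) = 1" unfolding exp_add[symmetric] by simp
    finally show ?thesis by (simp add: g_def)
  qed
  note S = A_pin_schur[OF p x h uh]
  let ?A = "\<lambda>z. A_pin (insert x V) (W z) (\<eta> z) (u z)"
  have gm [measurable]: "g \<in> borel_measurable N"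
    unfolding g_def using Wm em um
    by (intro borel_measurable_add borel_measurable_sum borel_measurable_times borel_measurable_exp[THEN measurable_compose[rotated]]) auto
  have [measurable]: "(\<lambda>z. u z x) \<in> borel_measurable N" by (rule um) simp
  have hm [measurable]: "h \<in> borel_measurable N" unfolding h_def by measurable
  have Axx: "?A z x x = exp (u z x) * (exp (u z x) * h z)" for z by (rule S(1))
  have Axm [measurable]: "(\<lambda>z. ?A z x x) \<in> borel_measurable N" unfolding Axx by measurable
  have Ajm: "(\<lambda>z. ?A z x j) \<in> borel_measurable N" "(\<lambda>z. ?A z j x) \<in> borel_measurable N" if "j \<in> V" for j
  proof -
    have [measurable]: "(\<lambda>z. W z x j) \<in> borel_measurable N" "(\<lambda>z. W z j x) \<in> borel_measurable N" "(\<lambda>z. u z j) \<in> borel_measurable N"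
      using Wm um that by auto
    have ne: "x \<noteq> j" "j \<noteq> x" using that x by auto
    show "(\<lambda>z. ?A z x j) \<in> borel_measurable N" "(\<lambda>z. ?A z j x) \<in> borel_measurable N"
      unfolding A_pin_def using ne by simp_all
  qed
  let ?c = "\<lambda>z i. c z i - ?A z i x * c z x / ?A z x x"
  have "\<exists>y. (\<forall>i\<in>V. (\<lambda>z. y z i) \<in> borel_measurable N) \<and>
     (\<forall>z. \<forall>i\<in>V. (\<Sum>j\<in>V. A_pin V (elim_W (W z) x (h z)) (elim_pin (W z) (\<eta> z) x (h z)) (u z) i j * y z j) = ?c z i)"
  proof (rule insert.IH)
    show "pinned V (elim_W (W z) x (h z)) (elim_pin (W z) (\<eta> z) x (h z))" for z by (rule pinned_elim[OF p x h])
    show "(\<lambda>z. elim_W (W z) x (h z) i j) \<in> borel_measurable N" if "i \<in> V" "j \<in> V" for i j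
    proof -
      have [measurable]: "(\<lambda>z. W z i j) \<in> borel_measurable N" "(\<lambda>z. W z i x) \<in> borel_measurable N" "(\<lambda>z. W z x j) \<in> borel_measurable N"
        using Wm that by auto
      show ?thesis unfolding elim_W_def by measurable
    qed
    show "(\<lambda>z. elim_pin (W z) (\<eta> z) x (h z) i) \<in> borel_measurable N" if "i \<in> V" for i
    proof -
      have [measurable]: "(\<lambda>z. \<eta> z i) \<in> borel_measurable N" "(\<lambda>z. W z i x) \<in> borel_measurable N" "(\<lambda>z. \<eta> z x) \<in> borel_measurable N"
        using Wm em that by auto
      show ?thesis unfolding elim_pin_def by measurable
    qed
    show "(\<lambda>z. u z i) \<in> borel_measurable N" if "i \<in> V" for i using um that by simp
    show "(\<lambda>z. ?c z i) \<in> borel_measurable N" if "i \<in> V" for i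
    proof -
      note [measurable] = Ajm(2)[OF that]
      have [measurable]: "(\<lambda>z. c z i) \<in> borel_measurable N" "(\<lambda>z. c z x) \<in> borel_measurable N" using cm that by auto
      show ?thesis by measurable
    qed
  qed
  then obtain y where ym: "\<And>i. i \<in> V \<Longrightarrow> (\<lambda>z. y z i) \<in> borel_measurable N"
    and y: "\<And>z i. i \<in> V \<Longrightarrow> (\<Sum>j\<in>V. A_pin V (elim_W (W z) x (h z)) (elim_pin (W z) (\<eta> z) x (h z)) (u z) i j * y z j) = ?c z i"
    by blast
  \<comment> \<open>back substitution in row \<open>x\<close>\<close>
  define yx where "yx = (\<lambda>z. (c z x - (\<Sum>j\<in>V. ?A z x j * y z j)) / ?A z x x)"
  define Y where "Y = (\<lambda>z. (y z)(x := yx z))"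
  have [measurable]: "(\<lambda>z. c z x) \<in> borel_measurable N" using cm by simp
  have [measurable]: "(\<lambda>z. \<Sum>j\<in>V. ?A z x j * y z j) \<in> borel_measurable N"
    by (intro borel_measurable_sum borel_measurable_times Ajm ym)
  have yxm: "yx \<in> borel_measurable N" unfolding yx_def by measurable
  have Ym: "(\<lambda>z. Y z i) \<in> borel_measurable N" if "i \<in> insert x V" for i
    using that yxm ym by (cases "i = x") (auto simp: Y_def)
  have nz: "?A z x x \<noteq> 0" for z unfolding Axx using h[of z] by simp
  have YV: "(\<Sum>j\<in>insert x V. ?A z i j * Y z j) = ?A z i x * yx z + (\<Sum>j\<in>V. ?A z i j * y z j)" for z i
  proof -
    have "(\<Sum>j\<in>V. ?A z i j * Y z j) = (\<Sum>j\<in>V. ?A z i j * y z j)"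
      by (rule sum.cong[OF refl]) (use x in \<open>auto simp: Y_def\<close>)
    moreover have "Y z x = yx z" by (simp add: Y_def)
    ultimately show ?thesis by (simp only: sum.insert[OF fin x])
  qed
  have "(\<Sum>j\<in>insert x V. ?A z i j * Y z j) = c z i" if i: "i \<in> insert x V" for z i
  proof (cases "i = x")
    case True
    then show ?thesis unfolding True YV yx_def using nz[of z] by simp
  next
    case False
    then have iV: "i \<in> V" using i by simp
    have "(\<Sum>j\<in>V. ?A z i j * y z j) = (\<Sum>j\<in>V. A_pin V (elim_W (W z) x (h z)) (elim_pin (W z) (\<eta> z) x (h z)) (u z) i j * y z j + ?A z i x / ?A z x x * (?A z x j * y z j))"
      by (rule sum.cong[OF refl]) (simp only: S(2)[OF iV, symmetric], simp add: algebra_simps)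
    also have "\<dots> = ?c z i + ?A z i x / ?A z x x * (\<Sum>j\<in>V. ?A z x j * y z j)"
      unfolding sum.distrib sum_distrib_left[symmetric] y[OF iV] ..
    finally have e: "(\<Sum>j\<in>V. ?A z i j * y z j) = ?c z i + ?A z i x / ?A z x x * (\<Sum>j\<in>V. ?A z x j * y z j)" .
    show ?thesis unfolding YV yx_def e by (simp add: diff_divide_distrib right_diff_distrib)
  qed
  then show ?case using Ym by (intro exI[of _ Y]) blast
qed

text \<open>For a symmetric matrix a right inverse is, transposed, a left inverse. Hence the inverse exists and
is unique on the index set, and the choice in \<^const>\<open>matrix_inv_on\<close> has to agree with it.\<close>

lemma matrix_inv_on_eq:
  assumes fin: "finite I" and sym: "\<And>i j. i \<in> I \<Longrightarrow> j \<in> I \<Longrightarrow> A i j = A j i"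
    and B: "\<And>i j. i \<in> I \<Longrightarrow> j \<in> I \<Longrightarrow> (\<Sum>k\<in>I. A i k * B k j) = (if i = j then 1 else 0)"
  shows "\<And>i j. i \<in> I \<Longrightarrow> j \<in> I \<Longrightarrow> matrix_inv_on I A i j = B i j"
    and "\<And>i j. i \<in> I \<Longrightarrow> j \<in> I \<Longrightarrow> (\<Sum>k\<in>I. B i k * A k j) = (if i = j then 1 else 0)"
proof -
  have left: "L i j = R i j" if i: "i \<in> I" and j: "j \<in> I"
    and L: "\<And>i j. i \<in> I \<Longrightarrow> j \<in> I \<Longrightarrow> (\<Sum>k\<in>I. L i k * A k j) = (if i = j then 1 else 0)"
    and R: "\<And>i j. i \<in> I \<Longrightarrow> j \<in> I \<Longrightarrow> (\<Sum>k\<in>I. A i k * R k j) = (if i = j then 1 else 0)" for L R i j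
  proof -
    have "L i j = (\<Sum>k\<in>I. if k = j then L i k else 0)" using fin j by simp
    also have "\<dots> = (\<Sum>k\<in>I. L i k * (if k = j then 1 else 0))" by (intro sum.cong refl) simp
    also have "\<dots> = (\<Sum>k\<in>I. L i k * (\<Sum>l\<in>I. A k l * R l j))" by (intro sum.cong refl) (simp add: R j)
    also have "\<dots> = (\<Sum>k\<in>I. \<Sum>l\<in>I. L i k * A k l * R l j)" by (simp add: sum_distrib_left mult.assoc)
    also have "\<dots> = (\<Sum>l\<in>I. \<Sum>k\<in>I. L i k * A k l * R l j)" by (rule sum.swap)
    also have "\<dots> = (\<Sum>l\<in>I. (\<Sum>k\<in>I. L i k * A k l) * R l j)" by (simp add: sum_distrib_right)
    also have "\<dots> = (\<Sum>l\<in>I. (if i = l then 1 else 0) * R l j)" by (intro sum.cong refl) (simp add: L i)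
    also have "\<dots> = (\<Sum>l\<in>I. if i = l then R l j else 0)" by (intro sum.cong refl) simp
    also have "\<dots> = R i j" using fin i by simp
    finally show ?thesis .
  qed
  have Bt: "(\<Sum>k\<in>I. B k i * A k j) = (if i = j then 1 else 0)" if "i \<in> I" "j \<in> I" for i j
  proof -
    have "(\<Sum>k\<in>I. B k i * A k j) = (\<Sum>k\<in>I. A j k * B k i)" by (rule sum.cong[OF refl]) (simp only: sym[OF _ that(2)] mult.commute)
    then show ?thesis using B[OF that(2,1)] by auto
  qed
  have Bsym: "B j i = B i j" if "i \<in> I" "j \<in> I" for i j
    by (rule left[where L="\<lambda>i j. B j i" and R=B, OF that Bt B])
  show BA: "(\<Sum>k\<in>I. B i k * A k j) = (if i = j then 1 else 0)" if "i \<in> I" "j \<in> I" for i j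
  proof -
    have "(\<Sum>k\<in>I. B i k * A k j) = (\<Sum>k\<in>I. B k i * A k j)"
      by (rule sum.cong[OF refl]) (simp only: Bsym[OF that(1)])
    then show ?thesis using Bt[OF that] by (simp only:)
  qed
  have inv: "\<forall>i\<in>I. \<forall>j\<in>I. (\<Sum>k\<in>I. A i k * matrix_inv_on I A k j) = (if i = j then 1 else 0) \<and>
     (\<Sum>k\<in>I. matrix_inv_on I A i k * A k j) = (if i = j then 1 else 0)"
    unfolding matrix_inv_on_def by (rule someI[of _ B]) (intro ballI conjI B BA)
  show "matrix_inv_on I A i j = B i j" if "i \<in> I" "j \<in> I" for i j
  proof (rule left[where L="matrix_inv_on I A" and R=B, OF that _ B])
    fix k l assume "k \<in> I" "l \<in> I"
    with inv show "(\<Sum>m\<in>I. matrix_inv_on I A k m * A m l) = (if k = l then 1 else 0)" by blast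
  qed
qed

lemma A_pin_sym: "pinned V W \<eta> \<Longrightarrow> i \<in> V \<Longrightarrow> j \<in> V \<Longrightarrow> A_pin V W \<eta> u i j = A_pin V W \<eta> u j i"
  using pinned_nonneg(3)[of V W \<eta> i j] by (auto simp: A_pin_def add.commute)

lemma A_pin_inverse_measurable:
  fixes V :: "'v set"
  assumes "finite V" and p: "\<And>z. pinned V W (\<eta> z)"
    and m: "\<And>i. i \<in> V \<Longrightarrow> (\<lambda>z. \<eta> z i) \<in> borel_measurable N" "\<And>i. i \<in> V \<Longrightarrow> (\<lambda>z. u z i) \<in> borel_measurable N"
    and ij: "i \<in> V" "j \<in> V"
  shows "(\<lambda>z. matrix_inv_on V (A_pin V W (\<eta> z) (u z)) i j) \<in> borel_measurable N"
    and "(\<Sum>k\<in>V. matrix_inv_on V (A_pin V W (\<eta> z) (u z)) i k * A_pin V W (\<eta> z) (u z) k j) = (if i = j then 1 else 0)"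
proof -
  have "\<exists>y. (\<forall>i\<in>V. (\<lambda>z. y z i) \<in> borel_measurable N) \<and>
     (\<forall>z. \<forall>i\<in>V. (\<Sum>k\<in>V. A_pin V W (\<eta> z) (u z) i k * y z k) = (if i = j then 1 else 0))" for j
    by (rule A_pin_solve_measurable[OF assms(1), of "\<lambda>_. W" \<eta> N u "\<lambda>_ i. if i = j then 1 else 0"]) (use p m in auto)
  then obtain y where y: "\<And>j i. i \<in> V \<Longrightarrow> (\<lambda>z. y j z i) \<in> borel_measurable N"
    "\<And>j z i. i \<in> V \<Longrightarrow> (\<Sum>k\<in>V. A_pin V W (\<eta> z) (u z) i k * y j z k) = (if i = j then 1 else 0)"
    by metis
  note M = matrix_inv_on_eq[where A="A_pin V W (\<eta> z) (u z)" and B="\<lambda>k j. y j z k" for z, OF assms(1) A_pin_sym[OF p] y(2)]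
  have e: "matrix_inv_on V (A_pin V W (\<eta> z) (u z)) i j = y j z i" if "i \<in> V" "j \<in> V" for i j z
    by (rule M(1)) (use that in auto)
  show "(\<lambda>z. matrix_inv_on V (A_pin V W (\<eta> z) (u z)) i j) \<in> borel_measurable N"
    unfolding e[OF ij] by (rule y(1)[OF ij(1)])
  have "(\<Sum>k\<in>V. matrix_inv_on V (A_pin V W (\<eta> z) (u z)) i k * A_pin V W (\<eta> z) (u z) k j) = (\<Sum>k\<in>V. y k z i * A_pin V W (\<eta> z) (u z) k j)"
    by (rule sum.cong[OF refl]) (simp add: e ij)
  also have "\<dots> = (if i = j then 1 else 0)" by (rule M(2)) (use ij in auto)
  finally show "(\<Sum>k\<in>V. matrix_inv_on V (A_pin V W (\<eta> z) (u z)) i k * A_pin V W (\<eta> z) (u z) k j) = (if i = j then 1 else 0)" .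
qed

text \<open>This is \<open>\<theta> = diag(e\<^sup>-\<^sup>u) A s\<close>.\<close>

lemma A_pin_apply_s:
  assumes "finite V" "i \<in> V"
  shows "(\<Sum>j\<in>V. A_pin V W \<eta> u i j * s j) = exp (u i) * theta_at V W \<eta> u s i"
proof -
  have "(\<Sum>j\<in>V. A_pin V W \<eta> u i j * s j) = exp (u i) * local_field V W \<eta> u i * s i + (\<Sum>j\<in>V-{i}. - W i j * exp (u i + u j) * s j)"
  proof -
    have "(\<Sum>j\<in>V-{i}. A_pin V W \<eta> u i j * s j) = (\<Sum>j\<in>V-{i}. - W i j * exp (u i + u j) * s j)"
      by (rule sum.cong[OF refl]) (auto simp: A_pin_def)
    then show ?thesis unfolding sum.remove[OF assms] by (simp add: A_pin_def)
  qed
  also have "\<dots> = exp (u i) * (\<eta> i * s i + (\<Sum>j\<in>V-{i}. W i j * exp (u j) * (s i - s j)))"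
  proof -
    have 1: "(\<Sum>j\<in>V-{i}. - W i j * exp (u i + u j) * s j) = - (exp (u i) * (\<Sum>j\<in>V-{i}. W i j * exp (u j) * s j))"
      unfolding sum_distrib_left sum_negf[symmetric] by (rule sum.cong[OF refl]) (simp add: exp_add)
    have 2: "(\<Sum>j\<in>V-{i}. W i j * exp (u j) * (s i - s j)) = (\<Sum>j\<in>V-{i}. W i j * exp (u j)) * s i - (\<Sum>j\<in>V-{i}. W i j * exp (u j) * s j)"
      unfolding right_diff_distrib sum_subtractf sum_distrib_right ..
    show ?thesis unfolding 1 2 local_field_def by (simp add: algebra_simps)
  qed
  also have "(\<Sum>j\<in>V-{i}. W i j * exp (u j) * (s i - s j)) = (\<Sum>j\<in>V. W i j * exp (u j) * (s i - s j))"
    using assms by (subst sum.remove[of V i]) auto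
  finally show ?thesis by (simp add: theta_at_def)
qed

section \<open>Finite weighted graphs as pinned models\<close>

lemma mu_pin_model_cong:
  assumes "\<And>i j. i \<in> V \<Longrightarrow> j \<in> V \<Longrightarrow> W i j = W' i j" "\<And>i. i \<in> V \<Longrightarrow> \<eta> i = \<eta>' i"
  shows "mu_pin V W \<eta> = mu_pin V W' \<eta>'"
    and "i \<in> V \<Longrightarrow> beta_at V W \<eta> u i = beta_at V W' \<eta>' u i"
    and "i \<in> V \<Longrightarrow> theta_at V W \<eta> u s i = theta_at V W' \<eta>' u s i"
proof -
  have h: "A_pin V W \<eta> u i j = A_pin V W' \<eta>' u i j" if "i \<in> V" "j \<in> V" for i j and u :: "'a \<Rightarrow> real"
    using assms that by (auto simp: A_pin_def local_field_def intro!: sum.cong)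
  have "energy V W \<eta> u s = energy V W' \<eta>' u s" for u s
    unfolding energy_def using assms by (intro arg_cong2[where f="(+)"] arg_cong2[where f="(*)"] sum.cong refl) auto
  then have "dens_pin V W \<eta> u s = dens_pin V W' \<eta>' u s" for u s
    unfolding dens_pin_def using det_on_cong[of V "A_pin V W \<eta> u" "A_pin V W' \<eta>' u", OF h] by simp
  then show "mu_pin V W \<eta> = mu_pin V W' \<eta>'" by (simp add: mu_pin_def)
  show "beta_at V W \<eta> u i = beta_at V W' \<eta>' u i" if "i \<in> V"
    using assms that by (simp add: beta_at_def cong: sum.cong)
  show "theta_at V W \<eta> u s i = theta_at V W' \<eta>' u s i" if "i \<in> V"
    using assms that by (simp add: theta_at_def cong: sum.cong)
qed

lemma observable_cong:
  assumes "\<And>i j. i \<in> V \<Longrightarrow> j \<in> V \<Longrightarrow> W i j = W' i j" "\<And>i. i \<in> V \<Longrightarrow> \<eta> i = \<eta>' i" "S \<subseteq> V"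
  shows "observable V W \<eta> S \<Phi> P = observable V W' \<eta>' S \<Phi> P"
proof
  fix p
  have "restrict (beta_at V W \<eta> (fst p)) S = restrict (beta_at V W' \<eta>' (fst p)) S"
    "restrict (theta_at V W \<eta> (fst p) (snd p)) S = restrict (theta_at V W' \<eta>' (fst p) (snd p)) S"
    using assms(3) by (auto intro!: restrict_ext mu_pin_model_cong(2,3) assms(1,2))
  then show "observable V W \<eta> S \<Phi> P p = observable V W' \<eta>' S \<Phi> P p" by (simp add: observable_def)
qed

lemma finite_weighted_graphD:
  assumes "finite_weighted_graph V \<delta> E W"
  shows "finite V" "\<delta> \<notin> V" "e \<in> E \<Longrightarrow> e \<subseteq> insert \<delta> V \<and> card e = 2"
    and "i \<in> insert \<delta> V \<Longrightarrow> j \<in> insert \<delta> V \<Longrightarrow> W i j = W j i"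
    and "i \<in> insert \<delta> V \<Longrightarrow> j \<in> insert \<delta> V \<Longrightarrow> {i, j} \<in> E \<Longrightarrow> W i j > 0"
    and "i \<in> insert \<delta> V \<Longrightarrow> j \<in> insert \<delta> V \<Longrightarrow> {i, j} \<notin> E \<Longrightarrow> W i j = 0"
    and "i \<in> insert \<delta> V \<Longrightarrow> j \<in> insert \<delta> V \<Longrightarrow> (i, j) \<in> {(a, b). {a, b} \<in> E}\<^sup>*"
    and "i \<in> insert \<delta> V \<Longrightarrow> W i i = 0"
    and "i \<in> insert \<delta> V \<Longrightarrow> j \<in> insert \<delta> V \<Longrightarrow> W i j \<ge> 0"
proof -
  note d = assms[unfolded finite_weighted_graph_def]
  show "finite V" "\<delta> \<notin> V" using d by auto
  show e: "e \<in> E \<Longrightarrow> e \<subseteq> insert \<delta> V \<and> card e = 2" for e using d by blast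
  show "i \<in> insert \<delta> V \<Longrightarrow> j \<in> insert \<delta> V \<Longrightarrow> W i j = W j i" using d by blast
  show pos: "i \<in> insert \<delta> V \<Longrightarrow> j \<in> insert \<delta> V \<Longrightarrow> {i, j} \<in> E \<Longrightarrow> W i j > 0" for i j using d by blast
  show zero: "i \<in> insert \<delta> V \<Longrightarrow> j \<in> insert \<delta> V \<Longrightarrow> {i, j} \<notin> E \<Longrightarrow> W i j = 0" for i j using d by blast
  show "i \<in> insert \<delta> V \<Longrightarrow> j \<in> insert \<delta> V \<Longrightarrow> (i, j) \<in> {(a, b). {a, b} \<in> E}\<^sup>*" using d by blast
  show "W i i = 0" if "i \<in> insert \<delta> V"
  proof (rule zero[OF that that])
    show "{i, i} \<notin> E" using e[of "{i, i}"] by auto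
  qed
  show "W i j \<ge> 0" if "i \<in> insert \<delta> V" "j \<in> insert \<delta> V"
    using pos[OF that] zero[OF that] by fastforce
qed

text \<open>A path from \<open>S\<close> to its complement crosses the boundary.\<close>

lemma rtrancl_leaves:
  assumes "(i, j) \<in> r\<^sup>*" "i \<in> S" "j \<notin> S"
  shows "\<exists>a b. (a, b) \<in> r \<and> a \<in> S \<and> b \<notin> S"
  using assms by (induction rule: rtrancl_induct) blast+

lemma finite_weighted_graph_pinned:
  assumes "finite_weighted_graph V \<delta> E W"
  shows "pinned V W (\<lambda>i. W i \<delta>)"
proof -
  note d = finite_weighted_graphD[OF assms]
  show ?thesis unfolding pinned_def
  proof (intro conjI ballI allI impI)
    show "finite V" by (rule d(1))
    show "W i j = W j i" if "i \<in> V" "j \<in> V" for i j using d(4)[of i j] that by simp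
    show "W i j \<ge> 0" if "i \<in> V" "j \<in> V" for i j using d(9)[of i j] that by simp
    show "W i \<delta> \<ge> 0" if "i \<in> V" for i using d(9)[of i \<delta>] that by simp
  next
    fix S assume S: "S \<subseteq> V" "S \<noteq> {}"
    then obtain i where i: "i \<in> S" by blast
    then have "(i, \<delta>) \<in> {(a, b). {a, b} \<in> E}\<^sup>*" using S by (intro d(7)) auto
    then obtain a b where ab: "{a, b} \<in> E" "a \<in> S" "b \<notin> S"
      using rtrancl_leaves[of i \<delta> _ S] i S d(2) by blast
    have aV: "a \<in> insert \<delta> V" "b \<in> insert \<delta> V" using d(3)[OF ab(1)] by auto
    have "W a b > 0" by (rule d(5)[OF aV ab(1)])
    then show "\<exists>i\<in>S. 0 < W i \<delta> \<or> (\<exists>j\<in>V - S. 0 < W i j)" using ab aV by (cases "b = \<delta>") auto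
  qed
qed

text \<open>Each edge is counted twice in the double sum, once for each orientation.\<close>

lemma sum_edge_value:
  fixes k :: "'v \<Rightarrow> 'v \<Rightarrow> real"
  assumes U: "finite U" and E: "\<And>e. e \<in> E \<Longrightarrow> e \<subseteq> U \<and> card e = 2"
    and k: "\<And>i j. k i j = k j i" and z: "\<And>i j. i \<in> U \<Longrightarrow> j \<in> U \<Longrightarrow> {i, j} \<notin> E \<Longrightarrow> k i j = 0"
  shows "(\<Sum>e\<in>E. edge_value k e) = 1 / 2 * (\<Sum>i\<in>U. \<Sum>j\<in>U. k i j)"
proof -
  define P where "P = {(i, j). i \<in> U \<and> j \<in> U \<and> {i, j} \<in> E}"
  have P: "P \<subseteq> U \<times> U" by (auto simp: P_def)
  have finP: "finite P" by (rule finite_subset[OF P]) (use U in simp)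
  have finE: "finite E" by (rule finite_subset[of E "Pow U"]) (use E U in auto)
  have "(\<Sum>i\<in>U. \<Sum>j\<in>U. k i j) = (\<Sum>p\<in>U \<times> U. k (fst p) (snd p))" by (simp add: sum.cartesian_product case_prod_beta)
  also have "\<dots> = (\<Sum>p\<in>P. k (fst p) (snd p))"
  proof (rule sum.mono_neutral_right[OF _ P])
    show "finite (U \<times> U)" using U by simp
    show "\<forall>p\<in>U \<times> U - P. k (fst p) (snd p) = 0"
    proof
      fix p assume "p \<in> U \<times> U - P"
      then show "k (fst p) (snd p) = 0" by (intro z) (auto simp: P_def)
    qed
  qed
  also have "\<dots> = (\<Sum>e\<in>E. \<Sum>p\<in>{p \<in> P. {fst p, snd p} = e}. k (fst p) (snd p))"
    by (rule sum.group[symmetric, OF finP finE]) (auto simp: P_def)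
  also have "\<dots> = (\<Sum>e\<in>E. 2 * edge_value k e)"
  proof (rule sum.cong[OF refl])
    fix e assume e: "e \<in> E"
    then obtain a b where ab: "e = {a, b}" "a \<noteq> b" using E[OF e] by (meson card_2_iff)
    have "{p \<in> P. {fst p, snd p} = e} = {(a, b), (b, a)}"
      using e ab E[OF e] by (auto simp: P_def doubleton_eq_iff insert_commute)
    then show "(\<Sum>p\<in>{p \<in> P. {fst p, snd p} = e}. k (fst p) (snd p)) = 2 * edge_value k e"
      using ab k[of b a] edge_value_doubleton[of k a b, OF k] by simp
  qed
  finally show ?thesis by (simp add: sum_distrib_left[symmetric])
qed

lemma pair_energy_sym: "pair_energy a s b t = pair_energy b t a s"
  by (simp add: pair_energy_alt algebra_simps)

text \<open>A non-zero value of \<open>u\<close> at the root is allowed here and is absorbed in the pinning. It occurs for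
values of \<open>\<beta>\<close> outside of the range of \<open>u \<mapsto> \<beta>\<close>, where the function that recovers \<open>u\<close> is arbitrary.\<close>

lemma A_mat_A_pin:
  assumes "finite_weighted_graph V \<delta> E W" and ij: "i \<in> V" "j \<in> V"
  shows "A_mat V \<delta> W u i j = A_pin V W (\<lambda>i. W i \<delta> * exp (u \<delta>)) u i j"
proof (cases "i = j")
  case True
  note d = finite_weighted_graphD[OF assms(1)]
  have "(\<Sum>k\<in>V. W i k * exp (u i + u k)) = exp (u i) * (\<Sum>k\<in>V. W i k * exp (u k))"
    unfolding sum_distrib_left by (rule sum.cong[OF refl]) (simp add: exp_add)
  also have "(\<Sum>k\<in>V. W i k * exp (u k)) = (\<Sum>k\<in>V - {i}. W i k * exp (u k))"
    using d(1) ij d(8)[of i] by (subst sum.remove[of V i]) auto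
  finally show ?thesis using True
    by (simp only: A_mat_def A_pin_def local_field_def if_True sum.insert[OF d(1,2)])
       (simp add: distrib_left exp_add)
qed (simp add: A_mat_def A_pin_def)

lemma A_mat_A_pin_reset:
  assumes "finite_weighted_graph V \<delta> E W" and ij: "i \<in> V" "j \<in> V"
  shows "A_mat V \<delta> W (u(\<delta> := 0)) i j = A_pin V W (\<lambda>i. W i \<delta>) u i j"
proof -
  note d = finite_weighted_graphD[OF assms(1)]
  have uV: "(u(\<delta> := 0)) i = u i" if "i \<in> V" for i using that d(2) by auto
  have "(\<Sum>k\<in>V - {i}. W i k * exp ((u(\<delta> := 0)) k)) = (\<Sum>k\<in>V - {i}. W i k * exp (u k))"
    by (rule sum.cong[OF refl]) (simp only: uV Diff_iff)
  then have "local_field V W (\<lambda>i. W i \<delta> * exp ((u(\<delta> := 0)) \<delta>)) (u(\<delta> := 0)) i = local_field V W (\<lambda>i. W i \<delta>) u i"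
    unfolding local_field_def by simp
  then show ?thesis unfolding A_mat_A_pin[OF assms] A_pin_def uV[OF ij(1)] uV[OF ij(2)] by (simp only:)
qed

lemma mu_density_eq_dens_pin:
  assumes "finite_weighted_graph V \<delta> E W"
  shows "mu_density V \<delta> E W (u(\<delta> := 0)) (s(\<delta> := 0)) = dens_pin V W (\<lambda>i. W i \<delta>) u s"
proof -
  note d = finite_weighted_graphD[OF assms]
  let ?u = "u(\<delta> := 0)" and ?s = "s(\<delta> := 0)"
  have uV: "?u i = u i" "?s i = s i" if "i \<in> V" for i using that d(2) by auto
  have det: "det_on V (A_mat V \<delta> W ?u) = det_on V (A_pin V W (\<lambda>i. W i \<delta>) u)"
  proof (rule det_on_cong)
    show "A_mat V \<delta> W ?u i j = A_pin V W (\<lambda>i. W i \<delta>) u i j" if "i \<in> V" "j \<in> V" for i j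
      by (rule A_mat_A_pin_reset[OF assms that])
  qed
  \<comment> \<open>symmetrised, because \<open>W\<close> is symmetric only on the vertex set and edge values need symmetry everywhere\<close>
  define k where "k = (\<lambda>i j. (W i j + W j i) / 2 * pair_energy (?u i) (?s i) (?u j) (?s j))"
  have ks: "k i j = k j i" for i j 
    unfolding k_def pair_energy_sym[of "?u i" "?s i" "?u j" "?s j"] by (simp only: add.commute)
  have kW: "k i j = W i j * pair_energy (?u i) (?s i) (?u j) (?s j)" if "i \<in> insert \<delta> V" "j \<in> insert \<delta> V" for i j
    unfolding k_def using d(4)[OF that] by simp
  have E2: "e \<in> E \<Longrightarrow> e \<subseteq> insert \<delta> V \<and> card e = 2" for e by (rule d(3))
  have ev: "edge_value (\<lambda>i j. exp (- W i j * (cosh (?u i - ?u j) - 1 + 1 / 2 * (?s i - ?s j)\<^sup>2 * exp (?u i + ?u j)))) e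
      = exp (- edge_value k e)" if eE: "e \<in> E" for e
  proof -
    obtain a b where ab: "e = {a, b}" using E2[OF eE] by (meson card_2_iff)
    have abV: "a \<in> insert \<delta> V" "b \<in> insert \<delta> V" using E2[OF eE] ab by auto
    let ?h = "\<lambda>i j. exp (- W i j * (cosh (?u i - ?u j) - 1 + 1 / 2 * (?s i - ?s j)\<^sup>2 * exp (?u i + ?u j)))"
    have hk: "?h i j = exp (- k i j)" if "i \<in> insert \<delta> V" "j \<in> insert \<delta> V" for i j
      unfolding kW[OF that] pair_energy_def by simp
    have "?h a b = ?h b a" unfolding hk[OF abV] hk[OF abV(2,1)] ks[of a b] ..
    then have "edge_value ?h e = exp (- k a b)" unfolding ab hk[OF abV, symmetric] by (rule edge_value_doubleton)
    moreover have "edge_value k e = k a b" unfolding ab by (rule edge_value_doubleton[of k a b, OF ks])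
    ultimately show ?thesis by simp
  qed
  have "(\<Prod>e\<in>E. edge_value (\<lambda>i j. exp (- W i j * (cosh (?u i - ?u j) - 1 + 1 / 2 * (?s i - ?s j)\<^sup>2 * exp (?u i + ?u j)))) e)
     = (\<Prod>e\<in>E. exp (- edge_value k e))" by (rule prod.cong[OF refl ev])
  also have "\<dots> = exp (- (\<Sum>e\<in>E. edge_value k e))"
  proof -
    have "finite E" by (rule finite_subset[of E "Pow (insert \<delta> V)"]) (use E2 d(1) in auto)
    then show ?thesis by (simp add: exp_sum sum_negf[symmetric])
  qed
  also have "(\<Sum>e\<in>E. edge_value k e) = 1 / 2 * (\<Sum>i\<in>insert \<delta> V. \<Sum>j\<in>insert \<delta> V. k i j)"
  proof (rule sum_edge_value[OF _ E2 ks])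
    show "finite (insert \<delta> V)" using d(1) by simp
    show "k i j = 0" if "i \<in> insert \<delta> V" "j \<in> insert \<delta> V" "{i, j} \<notin> E" for i j
      using kW[OF that(1,2)] d(6)[OF that] by simp
  qed
  also have "1 / 2 * (\<Sum>i\<in>insert \<delta> V. \<Sum>j\<in>insert \<delta> V. k i j) = energy V W (\<lambda>i. W i \<delta>) u s"
  proof -
    have k0: "k \<delta> \<delta> = 0" using kW[of \<delta> \<delta>] d(8)[of \<delta>] by simp
    have kV: "k i j = W i j * pair_energy (u i) (s i) (u j) (s j)" if "i \<in> V" "j \<in> V" for i j
      using kW[of i j] that by (simp only: uV insert_iff)  simp
    have kd: "k i \<delta> = W i \<delta> * pair_energy (u i) (s i) 0 0" if "i \<in> V" for i
      using kW[of i \<delta>] that by (simp only: uV fun_upd_same insert_iff) simp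
    have "(\<Sum>i\<in>insert \<delta> V. \<Sum>j\<in>insert \<delta> V. k i j) = (\<Sum>j\<in>V. k \<delta> j) + (\<Sum>i\<in>V. k i \<delta>) + (\<Sum>i\<in>V. \<Sum>j\<in>V. k i j)"
      unfolding sum.insert[OF d(1,2)] k0 by (simp add: sum.distrib)
    also have "(\<Sum>j\<in>V. k \<delta> j) = (\<Sum>j\<in>V. k j \<delta>)" by (rule sum.cong[OF refl ks])
    also have "(\<Sum>i\<in>V. k i \<delta>) = (\<Sum>i\<in>V. W i \<delta> * pair_energy (u i) (s i) 0 0)" by (rule sum.cong[OF refl kd])
    also have "(\<Sum>i\<in>V. \<Sum>j\<in>V. k i j) = (\<Sum>i\<in>V. \<Sum>j\<in>V. W i j * pair_energy (u i) (s i) (u j) (s j))"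
      by (intro sum.cong refl kV)
    finally show ?thesis by (simp add: energy_def)
  qed
  finally have edges: "(\<Prod>e\<in>E. edge_value (\<lambda>i j. exp (- W i j * (cosh (?u i - ?u j) - 1 + 1 / 2 * (?s i - ?s j)\<^sup>2 * exp (?u i + ?u j)))) e)
     = exp (- energy V W (\<lambda>i. W i \<delta>) u s)" .
  have "(\<Prod>i\<in>V. exp (- ?u i) / (2 * pi)) = (\<Prod>i\<in>V. exp (- u i) / (2 * pi))"
    by (rule prod.cong[OF refl]) (simp only: uV)
  then show ?thesis unfolding mu_density_def dens_pin_def det edges by (simp only:)
qed

lemma beta_theta_eq:
  assumes "finite_weighted_graph V \<delta> E W"
  shows "beta_of V \<delta> W (u(\<delta> := 0)) = restrict (beta_at V W (\<lambda>i. W i \<delta>) u) V"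
    and "theta_of V \<delta> W (u(\<delta> := 0)) (s(\<delta> := 0)) = restrict (theta_at V W (\<lambda>i. W i \<delta>) u s) V"
proof -
  note d = finite_weighted_graphD[OF assms]
  let ?u = "u(\<delta> := 0)" and ?s = "s(\<delta> := 0)"
  have uV: "?u i = u i" "?s i = s i" if "i \<in> V" for i using that d(2) by auto
  show "beta_of V \<delta> W ?u = restrict (beta_at V W (\<lambda>i. W i \<delta>) u) V"
    unfolding beta_of_def
  proof (rule restrict_ext)
    fix i assume i: "i \<in> V"
    have "(\<Sum>j\<in>V. W i j * exp (?u j - ?u i)) = (\<Sum>j\<in>V. W i j * exp (u j)) * exp (- u i)"
      unfolding sum_distrib_right by (rule sum.cong[OF refl]) (simp only: uV i, simp add: exp_diff exp_minus divide_inverse)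
    then show "1 / 2 * (\<Sum>j\<in>insert \<delta> V. W i j * exp (?u j - ?u i)) = beta_at V W (\<lambda>i. W i \<delta>) u i"
      by (simp only: sum.insert[OF d(1,2)] beta_at_def fun_upd_same uV(1)[OF i]) (simp add: distrib_right)
  qed
  show "theta_of V \<delta> W ?u ?s = restrict (theta_at V W (\<lambda>i. W i \<delta>) u s) V"
    unfolding theta_of_def
  proof (rule restrict_ext)
    fix i assume i: "i \<in> V"
    have "(\<Sum>j\<in>V. W i j * exp (?u j) * (?s i - ?s j)) = (\<Sum>j\<in>V. W i j * exp (u j) * (s i - s j))"
      by (rule sum.cong[OF refl]) (simp only: uV i)
    then show "(\<Sum>j\<in>insert \<delta> V. W i j * exp (?u j) * (?s i - ?s j)) = theta_at V W (\<lambda>i. W i \<delta>) u s i"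
      by (simp only: sum.insert[OF d(1,2)] theta_at_def fun_upd_same uV(2)[OF i]) simp
  qed
qed

lemma sets_coord_leb_RV: "sets (coord_leb V) = sets (RV V)"
  by (rule sets_PiM_cong) auto

definition beta_theta :: "'v set \<Rightarrow> ('v \<Rightarrow> 'v \<Rightarrow> real) \<Rightarrow> ('v \<Rightarrow> real) \<Rightarrow> 'v set \<Rightarrow> ('v \<Rightarrow> real) \<times> ('v \<Rightarrow> real) \<Rightarrow> ('v \<Rightarrow> real) \<times> ('v \<Rightarrow> real)" where
  "beta_theta V W \<eta> S p = (restrict (beta_at V W \<eta> (fst p)) S, restrict (theta_at V W \<eta> (fst p) (snd p)) S)"

lemma beta_theta_measurable:
  assumes "S \<subseteq> V"
  shows "beta_theta V W \<eta> S \<in> leb_us V \<rightarrow>\<^sub>M RV S \<Otimes>\<^sub>M RV S"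
proof -
  have b: "(\<lambda>p. beta_at V W \<eta> (fst p) i) \<in> borel_measurable (leb_us V)" "(\<lambda>p. theta_at V W \<eta> (fst p) (snd p) i) \<in> borel_measurable (leb_us V)" if "i \<in> V" for i
  proof -
    note [measurable] = leb_us_coord[OF that]
    have [measurable]: "(\<lambda>p. \<Sum>j\<in>V. W i j * exp (fst p j)) \<in> borel_measurable (leb_us V)"
      "(\<lambda>p. \<Sum>j\<in>V. W i j * exp (fst p j) * (snd p i - snd p j)) \<in> borel_measurable (leb_us V)"
      by (intro borel_measurable_sum; measurable)+
    show "(\<lambda>p. beta_at V W \<eta> (fst p) i) \<in> borel_measurable (leb_us V)" "(\<lambda>p. theta_at V W \<eta> (fst p) (snd p) i) \<in> borel_measurable (leb_us V)"
      unfolding beta_at_def theta_at_def by simp_all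
  qed
  show ?thesis unfolding beta_theta_def[abs_def]
    by (intro measurable_Pair measurable_restrict b) (use assms in auto)
qed

text \<open>The law of \<open>(\<beta>, \<theta>)\<close> is computed in the pinned model, whose sample space has no coordinate for the
root.\<close>

lemma distr_mu:
  fixes V :: "'v set"
  assumes g: "finite_weighted_graph V \<delta> E W"
  shows "distr (mu V \<delta> E W) (RV V \<Otimes>\<^sub>M RV V) (\<lambda>(u, s). (beta_of V \<delta> W u, theta_of V \<delta> W u s))
    = distr (mu_pin V W (\<lambda>i. W i \<delta>)) (RV V \<Otimes>\<^sub>M RV V) (beta_theta V W (\<lambda>i. W i \<delta>) V)"
proof -
  note d = finite_weighted_graphD[OF g]
  define em where "em = (\<lambda>(u, s). (u(\<delta> := 0 :: real), s(\<delta> := 0 :: real)))"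
  let ?T = "\<lambda>(u, s). (beta_of V \<delta> W u, theta_of V \<delta> W u s)"
  let ?D = "\<lambda>(u, s). ennreal (mu_density V \<delta> E W u s)"
  have co [measurable]: "(\<lambda>p. fst p i) \<in> borel_measurable (Omega_borel V \<delta>)" "(\<lambda>p. snd p i) \<in> borel_measurable (Omega_borel V \<delta>)" if "i \<in> insert \<delta> V" for i
    unfolding Omega_borel_def using that by (intro measurable_restrict_space1; measurable)+
  have em: "em \<in> leb_us V \<rightarrow>\<^sub>M Omega_borel V \<delta>"
    unfolding Omega_borel_def
  proof (rule measurable_restrict_space2)
    show "em \<in> space (leb_us V) \<rightarrow> Omega V \<delta>"
      by (auto simp: em_def Omega_def leb_us_def space_pair_measure space_PiM PiE_def extensional_def)
    have "(\<lambda>p. (fst p)(\<delta> := 0)) \<in> leb_us V \<rightarrow>\<^sub>M coord_leb (insert \<delta> V)" "(\<lambda>p. (snd p)(\<delta> := 0)) \<in> leb_us V \<rightarrow>\<^sub>M coord_leb (insert \<delta> V)"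
      unfolding leb_us_def by (intro upd_measurable; measurable)+
    then show "em \<in> leb_us V \<rightarrow>\<^sub>M RV (insert \<delta> V) \<Otimes>\<^sub>M RV (insert \<delta> V)"
      unfolding em_def case_prod_beta measurable_cong_sets[OF refl sets_coord_leb_RV] by (rule measurable_Pair)
  qed
  have D: "?D \<in> borel_measurable (Omega_borel V \<delta>)"
  proof -
    have a: "(\<lambda>p. A_mat V \<delta> W (fst p) i j) \<in> borel_measurable (Omega_borel V \<delta>)" if "i \<in> V" "j \<in> V" for i j
    proof -
      note [measurable] = co(1)[of i] co(1)[of j]
      have [measurable]: "(\<lambda>p. \<Sum>k\<in>insert \<delta> V. W i k * exp (fst p i + fst p k)) \<in> borel_measurable (Omega_borel V \<delta>)"
      proof (rule borel_measurable_sum)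
        fix k assume "k \<in> insert \<delta> V"
        then have [measurable]: "(\<lambda>p. fst p k) \<in> borel_measurable (Omega_borel V \<delta>)" "(\<lambda>p. fst p i) \<in> borel_measurable (Omega_borel V \<delta>)"
          using co(1) that by auto
        show "(\<lambda>p. W i k * exp (fst p i + fst p k)) \<in> borel_measurable (Omega_borel V \<delta>)" by measurable
      qed
      show ?thesis unfolding A_mat_def using that by (cases "i = j") simp_all
    qed
    have e: "(\<lambda>p. edge_value (\<lambda>i j. exp (- W i j * (cosh (fst p i - fst p j) - 1 + 1 / 2 * (snd p i - snd p j)\<^sup>2 * exp (fst p i + fst p j)))) e) \<in> borel_measurable (Omega_borel V \<delta>)"
      if eE: "e \<in> E" for e
    proof -
      obtain i j where ij: "e = {i, j}" using d(3)[OF eE] by (meson card_2_iff)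
      have iV: "i \<in> insert \<delta> V" "j \<in> insert \<delta> V" using d(3)[OF eE] ij by auto
      note [measurable] = co[OF iV(1)] co[OF iV(2)]
      have "edge_value (\<lambda>i j. exp (- W i j * (cosh (fst p i - fst p j) - 1 + 1 / 2 * (snd p i - snd p j)\<^sup>2 * exp (fst p i + fst p j)))) e
        = exp (- W i j * (cosh (fst p i - fst p j) - 1 + 1 / 2 * (snd p i - snd p j)\<^sup>2 * exp (fst p i + fst p j)))" for p :: "('v \<Rightarrow> real) \<times> ('v \<Rightarrow> real)"
      proof -
        have "cosh (fst p i - fst p j) = cosh (fst p j - fst p i)" by (metis cosh_minus minus_diff_eq)
        then show ?thesis unfolding ij
          by (intro edge_value_doubleton) (simp add: d(4)[OF iV] power2_commute add.commute)
      qed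
      then show ?thesis unfolding cosh_def by simp
    qed
    have p: "(\<lambda>p. exp (- fst p i) / (2 * pi)) \<in> borel_measurable (Omega_borel V \<delta>)" if "i \<in> V" for i
    proof -
      have [measurable]: "(\<lambda>p. fst p i) \<in> borel_measurable (Omega_borel V \<delta>)" using co(1) that by auto
      show ?thesis by measurable
    qed
    have "(\<lambda>p. mu_density V \<delta> E W (fst p) (snd p)) \<in> borel_measurable (Omega_borel V \<delta>)"
      unfolding mu_density_def
      by (intro borel_measurable_times borel_measurable_prod det_on_measurable d(1) a e p)
    then show ?thesis unfolding case_prod_beta by (rule measurable_compose[OF _ measurable_ennreal])
  qed
  have T: "?T \<in> Omega_borel V \<delta> \<rightarrow>\<^sub>M RV V \<Otimes>\<^sub>M RV V"
  proof -
    have b: "(\<lambda>p. 1 / 2 * (\<Sum>j\<in>insert \<delta> V. W i j * exp (fst p j - fst p i))) \<in> borel_measurable (Omega_borel V \<delta>)"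
      "(\<lambda>p. \<Sum>j\<in>insert \<delta> V. W i j * exp (fst p j) * (snd p i - snd p j)) \<in> borel_measurable (Omega_borel V \<delta>)" if "i \<in> V" for i
    proof -
      have i: "(\<lambda>p. fst p i) \<in> borel_measurable (Omega_borel V \<delta>)" "(\<lambda>p. snd p i) \<in> borel_measurable (Omega_borel V \<delta>)"
        using co that by auto
      have 1: "(\<lambda>p. W i j * exp (fst p j - fst p i)) \<in> borel_measurable (Omega_borel V \<delta>)"
        "(\<lambda>p. W i j * exp (fst p j) * (snd p i - snd p j)) \<in> borel_measurable (Omega_borel V \<delta>)" if "j \<in> insert \<delta> V" for j
      proof -
        note [measurable] = i co[OF that]
        show "(\<lambda>p. W i j * exp (fst p j - fst p i)) \<in> borel_measurable (Omega_borel V \<delta>)"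
          "(\<lambda>p. W i j * exp (fst p j) * (snd p i - snd p j)) \<in> borel_measurable (Omega_borel V \<delta>)" by simp_all
      qed
      show "(\<lambda>p. 1 / 2 * (\<Sum>j\<in>insert \<delta> V. W i j * exp (fst p j - fst p i))) \<in> borel_measurable (Omega_borel V \<delta>)"
        by (intro borel_measurable_times borel_measurable_const borel_measurable_sum 1)
      show "(\<lambda>p. \<Sum>j\<in>insert \<delta> V. W i j * exp (fst p j) * (snd p i - snd p j)) \<in> borel_measurable (Omega_borel V \<delta>)"
        by (intro borel_measurable_sum 1)
    qed
    show ?thesis unfolding case_prod_beta beta_of_def theta_of_def
      by (intro measurable_Pair measurable_restrict b)
  qed
  have "mu V \<delta> E W = distr (density (leb_us V) (\<lambda>p. ?D (em p))) (Omega_borel V \<delta>) em"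
    unfolding mu_def leb_us_def[symmetric] em_def[symmetric] by (rule density_distr[OF D em])
  also have "(\<lambda>p. ?D (em p)) = (\<lambda>p. ennreal (dens_pin V W (\<lambda>i. W i \<delta>) (fst p) (snd p)))"
    by (rule ext) (simp add: em_def case_prod_beta mu_density_eq_dens_pin[OF g])
  finally have mu: "mu V \<delta> E W = distr (mu_pin V W (\<lambda>i. W i \<delta>)) (Omega_borel V \<delta>) em" unfolding mu_pin_def .
  have em': "em \<in> mu_pin V W (\<lambda>i. W i \<delta>) \<rightarrow>\<^sub>M Omega_borel V \<delta>" using em by (simp add: mu_pin_def)
  have "distr (mu V \<delta> E W) (RV V \<Otimes>\<^sub>M RV V) ?T = distr (mu_pin V W (\<lambda>i. W i \<delta>)) (RV V \<Otimes>\<^sub>M RV V) (?T \<circ> em)"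
    unfolding mu by (rule distr_distr[OF T em'])
  also have "?T \<circ> em = beta_theta V W (\<lambda>i. W i \<delta>) V"
    by (rule ext) (simp add: em_def beta_theta_def case_prod_beta beta_theta_eq[OF g])
  finally show ?thesis .
qed

section \<open>The martingale\<close>

lemma matrix_inv_on_cong:
  assumes "\<And>i j. i \<in> I \<Longrightarrow> j \<in> I \<Longrightarrow> A i j = B i j"
  shows "matrix_inv_on I A = matrix_inv_on I B"
proof -
  have "(\<forall>i\<in>I. \<forall>j\<in>I. (\<Sum>k\<in>I. A i k * C k j) = (if i = j then 1 else 0) \<and> (\<Sum>k\<in>I. C i k * A k j) = (if i = j then 1 else 0))
    = (\<forall>i\<in>I. \<forall>j\<in>I. (\<Sum>k\<in>I. B i k * C k j) = (if i = j then 1 else 0) \<and> (\<Sum>k\<in>I. C i k * B k j) = (if i = j then 1 else 0))" for C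
    using assms by (intro ball_cong refl) (simp cong: sum.cong)
  then show ?thesis unfolding matrix_inv_on_def by simp
qed

lemma pinned_scale:
  "pinned V W \<eta> \<Longrightarrow> c > 0 \<Longrightarrow> pinned V W (\<lambda>i. \<eta> i * c)"
  unfolding pinned_def by (simp add: zero_less_mult_iff)

text \<open>The inverse matrix in \<^const>\<open>g_fun\<close> is defined by a choice for each \<open>\<beta>\<close> separately. It is measurable
because the matrix is invertible for every value of \<open>u\<close> at all, also for those that are not
recovered from an actual \<open>\<beta>\<close>.\<close>

lemma g_fun_measurable:
  assumes g: "finite_weighted_graph V \<delta> E W" and f: "recovers_u V \<delta> W f" and i: "i \<in> insert \<delta> V"
  shows "(\<lambda>bt. g_fun V \<delta> W f (fst bt) (snd bt) i) \<in> borel_measurable (RV V \<Otimes>\<^sub>M RV V)"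
proof (cases "i = \<delta>")
  case True
  then show ?thesis by (simp add: g_fun_def Let_def)
next
  case False
  then have iV: "i \<in> V" using i by simp
  note d = finite_weighted_graphD[OF g]
  let ?N = "RV V \<Otimes>\<^sub>M RV V"
  have fm: "f \<in> RV V \<rightarrow>\<^sub>M RV (insert \<delta> V)" using f by (simp add: recovers_u_def)
  have um: "(\<lambda>bt. f (fst bt) j) \<in> borel_measurable ?N" if "j \<in> insert \<delta> V" for j
    by (rule measurable_compose[OF measurable_compose[OF measurable_fst fm] measurable_component_singleton[OF that]])
  have tm: "(\<lambda>bt. snd bt j) \<in> borel_measurable ?N" if "j \<in> V" for j
    by (rule measurable_compose[OF measurable_snd measurable_component_singleton[OF that]])
  let ?\<eta> = "\<lambda>bt i. W i \<delta> * exp (f (fst bt) \<delta>)"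
  have p: "pinned V W (?\<eta> z)" for z :: "('a \<Rightarrow> real) \<times> ('a \<Rightarrow> real)"
    by (rule pinned_scale[OF finite_weighted_graph_pinned[OF g]]) simp
  have inv: "matrix_inv_on V (A_mat V \<delta> W u) = matrix_inv_on V (A_pin V W (\<lambda>i. W i \<delta> * exp (u \<delta>)) u)" for u
    by (rule matrix_inv_on_cong) (rule A_mat_A_pin[OF g])
  have Bm: "(\<lambda>bt. matrix_inv_on V (A_mat V \<delta> W (f (fst bt))) i j) \<in> borel_measurable ?N" if j: "j \<in> V" for j
    unfolding inv
  proof (rule A_pin_inverse_measurable(1)[OF d(1) p _ _ iV j])
    show "(\<lambda>bt. W k \<delta> * exp (f (fst bt) \<delta>)) \<in> borel_measurable ?N" for k
      using um[of \<delta>] by measurable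
    show "(\<lambda>bt. f (fst bt) k) \<in> borel_measurable ?N" if "k \<in> V" for k using um that by simp
  qed
  have "(\<lambda>bt. \<Sum>j\<in>V. matrix_inv_on V (A_mat V \<delta> W (f (fst bt))) i j * (exp (f (fst bt) j) * snd bt j)) \<in> borel_measurable ?N"
  proof (rule borel_measurable_sum)
    fix j assume j: "j \<in> V"
    have u: "(\<lambda>bt. f (fst bt) j) \<in> borel_measurable ?N" by (rule um) (use j in simp)
    have e: "(\<lambda>bt. exp (f (fst bt) j)) \<in> borel_measurable ?N" using u by simp
    show "(\<lambda>bt. matrix_inv_on V (A_mat V \<delta> W (f (fst bt))) i j * (exp (f (fst bt) j) * snd bt j)) \<in> borel_measurable ?N"
      by (intro borel_measurable_times Bm[OF j] e tm[OF j])
  qed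
  then show ?thesis using False i by (simp add: g_fun_def Let_def)
qed

text \<open>The composition \<open>s \<mapsto> \<theta> \<mapsto> s\<close> is the multiplication by \<open>A\<close> followed by that by \<open>A\<^sup>-\<^sup>1\<close>.\<close>

lemma recovers_u_s:
  assumes g: "finite_weighted_graph V \<delta> E W" and f: "recovers_u V \<delta> W f" and u: "u \<in> V \<rightarrow>\<^sub>E UNIV"
  shows "f (restrict (beta_at V W (\<lambda>i. W i \<delta>) u) V) = u(\<delta> := 0)"
    and "i \<in> V \<Longrightarrow> g_fun V \<delta> W f (restrict (beta_at V W (\<lambda>i. W i \<delta>) u) V) (restrict (theta_at V W (\<lambda>i. W i \<delta>) u s) V) i = s i"
proof -
  note d = finite_weighted_graphD[OF g]
  have "u(\<delta> := 0) \<in> insert \<delta> V \<rightarrow>\<^sub>E UNIV" using u by (auto simp: PiE_def extensional_def)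
  then have "f (beta_of V \<delta> W (u(\<delta> := 0))) = u(\<delta> := 0)" using f by (simp add: recovers_u_def)
  then show fu: "f (restrict (beta_at V W (\<lambda>i. W i \<delta>) u) V) = u(\<delta> := 0)" unfolding beta_theta_eq(1)[OF g] .
  let ?\<eta> = "\<lambda>i. W i \<delta>"
  note p = finite_weighted_graph_pinned[OF g]
  show "g_fun V \<delta> W f (restrict (beta_at V W ?\<eta> u) V) (restrict (theta_at V W ?\<eta> u s) V) i = s i" if i: "i \<in> V"
  proof -
    have ne: "j \<noteq> \<delta>" if "j \<in> V" for j using that d(2) by auto
    have inv: "matrix_inv_on V (A_mat V \<delta> W (u(\<delta> := 0))) = matrix_inv_on V (A_pin V W ?\<eta> u)"
      by (rule matrix_inv_on_cong) (rule A_mat_A_pin_reset[OF g])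
    let ?B = "matrix_inv_on V (A_pin V W ?\<eta> u)" and ?A = "A_pin V W ?\<eta> u"
    have BA: "(\<Sum>k\<in>V. ?B i k * ?A k j) = (if i = j then 1 else 0)" if "j \<in> V" for j
      by (rule A_pin_inverse_measurable(2)[where \<eta>="\<lambda>_. ?\<eta>" and u="\<lambda>_. u" and N="count_space UNIV :: unit measure", OF d(1) p _ _ i that]) auto
    have "g_fun V \<delta> W f (restrict (beta_at V W ?\<eta> u) V) (restrict (theta_at V W ?\<eta> u s) V) i
      = (\<Sum>j\<in>V. ?B i j * (exp ((u(\<delta> := 0)) j) * restrict (theta_at V W ?\<eta> u s) V j))"
      using i ne[OF i] unfolding g_fun_def fu Let_def inv by simp
    also have "\<dots> = (\<Sum>j\<in>V. ?B i j * (\<Sum>k\<in>V. ?A j k * s k))"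
      by (rule sum.cong[OF refl]) (simp add: A_pin_apply_s[OF d(1)] ne)
    also have "\<dots> = (\<Sum>j\<in>V. \<Sum>k\<in>V. ?B i j * ?A j k * s k)" by (simp add: sum_distrib_left mult.assoc)
    also have "\<dots> = (\<Sum>k\<in>V. \<Sum>j\<in>V. ?B i j * ?A j k * s k)" by (rule sum.swap)
    also have "\<dots> = (\<Sum>k\<in>V. (if i = k then 1 else 0) * s k)"
      by (rule sum.cong[OF refl]) (simp add: sum_distrib_right[symmetric] BA)
    also have "\<dots> = (\<Sum>k\<in>V. if i = k then s k else 0)" by (rule sum.cong[OF refl]) simp
    also have "\<dots> = s i" using i d(1) by simp
    finally show ?thesis .
  qed
qed

text \<open>The process at a fixed time as a function of \<open>(\<beta>, \<theta>)\<close> on \<open>V\<close>.\<close>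

definition product_obs :: "'v set \<Rightarrow> 'v \<Rightarrow> ('v \<Rightarrow> 'v \<Rightarrow> real) \<Rightarrow> (('v \<Rightarrow> real) \<Rightarrow> 'v \<Rightarrow> real) \<Rightarrow> nat \<Rightarrow> (nat \<Rightarrow> 'v) \<Rightarrow>
    ('v \<Rightarrow> real) \<times> ('v \<Rightarrow> real) \<Rightarrow> complex" where
  "product_obs V \<delta> W f k j bt = (\<Prod>l=1..k.
     of_real (exp (if j l \<in> insert \<delta> V then f (fst bt) (j l) else 0)) *
     (1 + \<i> * of_real (if j l \<in> insert \<delta> V then g_fun V \<delta> W f (fst bt) (snd bt) (j l) else 0)))"

lemma product_obs_measurable:
  assumes g: "finite_weighted_graph V \<delta> E W" and f: "recovers_u V \<delta> W f"
  shows "product_obs V \<delta> W f k j \<in> borel_measurable (RV V \<Otimes>\<^sub>M RV V)"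
  unfolding product_obs_def[abs_def]
proof (rule borel_measurable_prod)
  fix l
  let ?N = "RV V \<Otimes>\<^sub>M RV V"
  have fm: "f \<in> RV V \<rightarrow>\<^sub>M RV (insert \<delta> V)" using f by (simp add: recovers_u_def)
  have [measurable]: "(\<lambda>bt. if j l \<in> insert \<delta> V then f (fst bt) (j l) else 0) \<in> borel_measurable ?N"
  proof (cases "j l \<in> insert \<delta> V")
    case True
    from measurable_compose[OF measurable_compose[OF measurable_fst fm] measurable_component_singleton[OF True]]
    show ?thesis using True by simp
  qed simp
  have [measurable]: "(\<lambda>bt. if j l \<in> insert \<delta> V then g_fun V \<delta> W f (fst bt) (snd bt) (j l) else 0) \<in> borel_measurable ?N"
    using g_fun_measurable[OF g f, of "j l"] by (cases "j l \<in> insert \<delta> V") simp_all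
  show "(\<lambda>bt. complex_of_real (exp (if j l \<in> insert \<delta> V then f (fst bt) (j l) else 0)) *
     (1 + \<i> * complex_of_real (if j l \<in> insert \<delta> V then g_fun V \<delta> W f (fst bt) (snd bt) (j l) else 0))) \<in> borel_measurable ?N"
    by measurable
qed

text \<open>On the range of \<open>u \<mapsto> \<beta>\<close> the recovered fields are the original ones. Coordinates \<open>j l\<close> outside of \<open>V\<close>
contribute the factor 1, in agreement with the convention for \<open>zeta\<close>.\<close>

lemma product_obs_zeta:
  assumes g: "finite_weighted_graph V \<delta> E W" and f: "recovers_u V \<delta> W f" and p: "p \<in> space (leb_us V)"
    and j: "\<And>l. l \<in> {1..k} \<Longrightarrow> j l \<noteq> \<delta>"
  shows "product_obs V \<delta> W f k j (beta_theta V W (\<lambda>i. W i \<delta>) V p) = (\<Prod>l=1..k. zeta V (fst p) (snd p) (j l))"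
  unfolding product_obs_def
proof (rule prod.cong[OF refl])
  fix l assume l: "l \<in> {1..k}"
  have u: "fst p \<in> V \<rightarrow>\<^sub>E UNIV" using p by (auto simp: leb_us_def space_pair_measure space_PiM)
  let ?bt = "beta_theta V W (\<lambda>i. W i \<delta>) V p"
  note r = recovers_u_s[OF g f u]
  show "complex_of_real (exp (if j l \<in> insert \<delta> V then f (fst ?bt) (j l) else 0)) *
     (1 + \<i> * complex_of_real (if j l \<in> insert \<delta> V then g_fun V \<delta> W f (fst ?bt) (snd ?bt) (j l) else 0)) = zeta V (fst p) (snd p) (j l)"
  proof (cases "j l \<in> V")
    case True
    then show ?thesis using j[OF l] r(2)[of "j l" "snd p"] by (simp add: beta_theta_def r(1) zeta_def)
  next
    case False
    then show ?thesis using j[OF l] by (simp add: zeta_def)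
  qed
qed

lemma martingale_bounded_linear:
  fixes X :: "nat \<Rightarrow> 'a \<Rightarrow> 'b::{banach, second_countable_topology}" and h :: "'b \<Rightarrow> 'c::{banach, second_countable_topology}"
  assumes h: "bounded_linear h" and X: "martingale M F X"
  shows "martingale M F (\<lambda>n \<omega>. h (X n \<omega>))"
proof -
  have hm: "h \<in> borel_measurable borel"
    by (rule borel_measurable_continuous_onI) (rule linear_continuous_on[OF h])
  have m: "(\<lambda>\<omega>. h (X n \<omega>)) \<in> borel_measurable (F n)" for n
    using X measurable_compose[OF _ hm] unfolding martingale_def by blast
  have i: "integrable M (X n)" for n using X unfolding martingale_def by blast
  have hi: "integrable M (\<lambda>\<omega>. h (X n \<omega>))" for n by (rule integrable_bounded_linear[OF h i])
  have s: "subalgebra M (F n)" for n using X unfolding martingale_def by blast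
  have pull: "(\<integral>\<omega>\<in>A. h (X n \<omega>) \<partial>M) = h (\<integral>\<omega>\<in>A. X n \<omega> \<partial>M)" if "A \<in> sets M" for A n
  proof -
    have "(\<lambda>\<omega>. indicator A \<omega> *\<^sub>R h (X n \<omega>)) = (\<lambda>\<omega>. h (indicator A \<omega> *\<^sub>R X n \<omega>))"
      by (rule ext) (simp add: linear_cmul[OF bounded_linear.linear[OF h]])
    then show ?thesis unfolding set_lebesgue_integral_def
      by (simp only: integral_bounded_linear[OF h integrable_mult_indicator[OF that i]])
  qed
  have "has_cond_exp M (F k) (\<lambda>\<omega>. h (X n \<omega>)) (\<lambda>\<omega>. h (X k \<omega>))" if "k \<le> n" for k n
    unfolding has_cond_exp_def
  proof (intro conjI ballI hi m)
    fix A assume A: "A \<in> sets (F k)"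
    then have AM: "A \<in> sets M" using s[of k] unfolding subalgebra_def by blast
    have "(\<integral>\<omega>\<in>A. X n \<omega> \<partial>M) = (\<integral>\<omega>\<in>A. X k \<omega> \<partial>M)"
      using X that A unfolding martingale_def has_cond_exp_def by blast
    then show "(\<integral>\<omega>\<in>A. h (X n \<omega>) \<partial>M) = (\<integral>\<omega>\<in>A. h (X k \<omega>) \<partial>M)" by (simp only: pull[OF AM])
  qed
  then show ?thesis using X m hi s unfolding martingale_def by blast
qed

theorem corollary1p4:
  fixes Vinf :: "'v set" and Einf :: "'v set set" and W :: "'v \<Rightarrow> 'v \<Rightarrow> real"
    and V :: "nat \<Rightarrow> 'v set" and \<delta> :: "nat \<Rightarrow> 'v"
    and f :: "nat \<Rightarrow> ('v \<Rightarrow> real) \<Rightarrow> ('v \<Rightarrow> real)"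
    and M :: "'a measure" and \<beta> \<theta> :: "'v \<Rightarrow> 'a \<Rightarrow> real"
    and k :: nat and j :: "nat \<Rightarrow> 'v"
    and F :: "nat \<Rightarrow> 'a measure" and X :: "nat \<Rightarrow> 'a \<Rightarrow> complex"
  defines "F \<equiv> beta_theta_filtration M V \<beta> \<theta>"
    and "X \<equiv> \<lambda>n \<omega>. \<Prod>l=1..k. of_real (exp (u_seq V \<delta> f \<beta> n (j l) \<omega>)) *
                (1 + \<i> * of_real (s_seq Vinf W V \<delta> f \<beta> \<theta> n (j l) \<omega>))"
  assumes graph: "infinite_weighted_graph Vinf Einf W"
    and wired: "wired_approximation Vinf Einf W V \<delta>"
    and f: "\<And>n. recovers_u (V n) (\<delta> n) (wired_weight Vinf W (V n) (\<delta> n)) (f n)"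
    and coupling: "infinite_volume_coupling Vinf Einf W V \<delta> M \<beta> \<theta>"
    and k: "k \<ge> 1"
    and j: "\<And>l. l \<in> {1..k} \<Longrightarrow> j l \<in> Vinf"
  shows "martingale M F X \<and>
         martingale M F (\<lambda>n \<omega>. Re (X n \<omega>)) \<and>
         martingale M F (\<lambda>n \<omega>. Im (X n \<omega>))"
proof -
  define w where "w = (\<lambda>n. wired_weight Vinf W (V n) (\<delta> n))"
  define \<eta> where "\<eta> = (\<lambda>n i. w n i (\<delta> n))"
  define N where "N = (\<lambda>n. RV (V n) \<Otimes>\<^sub>M RV (V n))"
  define R where "R = (\<lambda>n. restr_beta_theta (V n) \<beta> \<theta>)"
  define P where "P = (\<lambda>\<zeta> :: 'v \<Rightarrow> complex. \<Prod>l=1..k. \<zeta> (j l))"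
  define \<Psi> where "\<Psi> = (\<lambda>n. product_obs (V n) (\<delta> n) (w n) (f n) k j)"
  note wd = wired[unfolded wired_approximation_def]
  have Vmono: "V m \<subseteq> V n" if "m \<le> n" for m n
    using that wd by (metis lift_Suc_mono_le)
  have Vinf: "V n \<subseteq> Vinf" for n using wd by blast
  have finV: "finite (V n)" for n using wd by blast
  have \<delta>: "\<delta> n \<notin> Vinf" for n using wd by blast
  have fg: "finite_weighted_graph (V n) (\<delta> n) (wired_edges Vinf Einf (V n) (\<delta> n)) (w n)" for n
    using wd unfolding w_def by blast
  have sm: "W i summable_on (Vinf - V n)" if "i \<in> V n" for i n using wd that by blast
  have wW: "w n i l = W i l" if "i \<in> V n" "l \<in> V n" for n i l
    using that by (simp add: w_def wired_weight_def)
  have \<eta>: "\<eta> n i = (\<Sum>\<^sub>\<infinity>l\<in>Vinf - V n. W i l)" if "i \<in> V n" for n i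
    using that \<delta>[of n] Vinf[of n] by (auto simp: \<eta>_def w_def wired_weight_def)
  \<comment> \<open>the wired graph at time \<open>m\<close> arises from the one at time \<open>n\<close> by wiring \<open>V n - V m\<close>\<close>
  have \<eta>w: "wire_pin (V n) (V m) (w n) (\<eta> n) i = \<eta> m i" if mn: "m \<le> n" and i: "i \<in> V m" for m n i
  proof -
    have iV: "i \<in> V n" using i Vmono[OF mn] by auto
    have "Vinf - V m = (Vinf - V n) \<union> (V n - V m)" using Vmono[OF mn] Vinf[of n] by blast
    then have "\<eta> m i = (\<Sum>\<^sub>\<infinity>l\<in>(Vinf - V n) \<union> (V n - V m). W i l)" by (simp add: \<eta>[OF i])
    also have "\<dots> = (\<Sum>\<^sub>\<infinity>l\<in>Vinf - V n. W i l) + (\<Sum>\<^sub>\<infinity>l\<in>V n - V m. W i l)"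
      by (rule infsum_Un_disjoint[OF sm[OF iV]]) (use finV[of n] in auto)
    also have "(\<Sum>\<^sub>\<infinity>l\<in>V n - V m. W i l) = (\<Sum>l\<in>V n - V m. w n i l)"
      using finV[of n] by (simp add: wW[OF iV])
    finally show ?thesis by (simp add: wire_pin_def \<eta>[OF iV])
  qed
  have weq: "wired_weight Vinf W (V n) (\<delta> n) = w n" for n by (simp add: w_def)
  have pn: "pinned (V n) (w n) (\<eta> n)" for n
    using finite_weighted_graph_pinned[OF fg[of n]] by (simp add: \<eta>_def)
  have law: "distr M (N n) (R n) = distr (mu_pin (V n) (w n) (\<eta> n)) (N n) (beta_theta (V n) (w n) (\<eta> n) (V n))" for n
    using coupling distr_mu[OF fg[of n]]
    unfolding infinite_volume_coupling_def Let_def weq N_def R_def \<eta>_def by simp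
  have meas: "\<beta> i \<in> borel_measurable M" "\<theta> i \<in> borel_measurable M" if "i \<in> Vinf" for i
    using coupling that unfolding infinite_volume_coupling_def by blast+
  have Rm: "R n \<in> M \<rightarrow>\<^sub>M N n" for n
    unfolding R_def N_def restr_beta_theta_def
    by (intro measurable_Pair measurable_restrict meas) (use Vinf[of n] in auto)
  have bm: "beta_theta (V n) (w n) (\<eta> n) S \<in> mu_pin (V n) (w n) (\<eta> n) \<rightarrow>\<^sub>M RV S \<Otimes>\<^sub>M RV S" if "S \<subseteq> V n" for n S
    using beta_theta_measurable[OF that] by (simp add: mu_pin_def)
  have bN: "beta_theta (V n) (w n) (\<eta> n) (V n) \<in> mu_pin (V n) (w n) (\<eta> n) \<rightarrow>\<^sub>M N n" for n
    using bm[of "V n" n] by (simp add: N_def)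
  have Xeq: "X n \<omega> = \<Psi> n (R n \<omega>)" for n \<omega>
    unfolding X_def \<Psi>_def product_obs_def R_def restr_beta_theta_def u_seq_def s_seq_def w_def fst_conv snd_conv ..
  have \<Psi>m [measurable]: "\<Psi> n \<in> borel_measurable (N n)" for n
    unfolding \<Psi>_def N_def by (rule product_obs_measurable[OF fg f[unfolded weq]])
  have \<Psi>P: "\<Psi> n (beta_theta (V n) (w n) (\<eta> n) (V n) p) = P (zeta (V n) (fst p) (snd p))" if "p \<in> space (leb_us (V n))" for n p
    unfolding \<Psi>_def \<eta>_def P_def by (rule product_obs_zeta[OF fg f[unfolded weq] that]) (use j \<delta> in metis)
  have pP: "polyfun P" unfolding P_def by (rule polyfun_prod) (auto intro: polyfun_coord)
  have Pint: "integrable (mu_pin (V n) (w n) (\<eta> n)) (\<lambda>p. P (zeta (V n) (fst p) (snd p)))" for n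
    by (rule integrable_polyfun_zeta[OF pn pP])
  have Xint: "integrable M (X n)" for n
  proof -
    have "integrable (mu_pin (V n) (w n) (\<eta> n)) (\<lambda>p. \<Psi> n (beta_theta (V n) (w n) (\<eta> n) (V n) p))"
      by (rule Bochner_Integration.integrable_cong[THEN iffD2, OF refl _ Pint[of n]]) (simp add: mu_pin_def \<Psi>P)
    then have "integrable (distr (mu_pin (V n) (w n) (\<eta> n)) (N n) (beta_theta (V n) (w n) (\<eta> n) (V n))) (\<Psi> n)"
      by (subst integrable_distr_eq[OF bN]) simp_all
    then show ?thesis unfolding law[symmetric] Xeq[abs_def] by (subst (asm) integrable_distr_eq[OF Rm]) simp_all
  qed
  have F: "F n = vimage_algebra (space M) (R n) (N n)" for n
    by (simp add: F_def beta_theta_filtration_def R_def N_def)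
  have Rsp: "R n \<in> space M \<rightarrow> space (N n)" for n using measurable_space[OF Rm[of n]] by blast
  have sub: "subalgebra M (F n)" for n
    unfolding subalgebra_def F using sets_image_in_sets[OF refl Rm[of n]] by simp
  have RF: "R n \<in> F n \<rightarrow>\<^sub>M N n" for n unfolding F by (rule measurable_vimage_algebra1[OF Rsp])
  \<comment> \<open>\<open>R m\<close> is a function of \<open>R n\<close> for \<open>m \<le> n\<close>; this gives the filtration, and it lets an event of
     \<open>F m\<close> be tested under the law at time \<open>n\<close>\<close>
  define pr where "pr = (\<lambda>m (bt :: ('v \<Rightarrow> real) \<times> ('v \<Rightarrow> real)). (restrict (fst bt) (V m), restrict (snd bt) (V m)))"
  have prm: "pr m \<in> N n \<rightarrow>\<^sub>M N m" if "m \<le> n" for m n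
    unfolding pr_def N_def
    by (intro measurable_Pair measurable_compose[OF measurable_fst measurable_restrict_subset] measurable_compose[OF measurable_snd measurable_restrict_subset] Vmono that)
  have prR: "R m \<omega> = pr m (R n \<omega>)" if "m \<le> n" for m n \<omega>
    using Vmono[OF that] by (auto simp: R_def pr_def restr_beta_theta_def restrict_def fun_eq_iff)
  have prb: "pr m (beta_theta (V n) (w n) (\<eta> n) (V n) p) = beta_theta (V n) (w n) (\<eta> n) (V m) p" if "m \<le> n" for m n p
    using Vmono[OF that] by (auto simp: pr_def beta_theta_def restrict_def fun_eq_iff)
  have filt: "filtration (space M) F"
  proof
    show "space (F i) = space M" for i by (simp add: F)
    show "sets (F m) \<subseteq> sets (F n)" if "m \<le> n" for m n
    proof -
      have "(\<lambda>\<omega>. pr m (R n \<omega>)) \<in> F n \<rightarrow>\<^sub>M N m" by (rule measurable_compose[OF RF prm[OF that]])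
      then have "R m \<in> F n \<rightarrow>\<^sub>M N m" unfolding prR[OF that, symmetric] .
      then show ?thesis unfolding F[of m] by (intro sets_image_in_sets) (simp_all add: F)
    qed
  qed
  have Xm: "X n \<in> borel_measurable (F n)" for n
    unfolding Xeq[abs_def] by (rule measurable_compose[OF RF \<Psi>m])
  \<comment> \<open>an integral over an event of \<open>F m\<close>, expressed in the finite model at time \<open>n\<close>\<close>
  have transfer: "integrable (mu_pin (V n) (w n) (\<eta> n)) (observable (V n) (w n) (\<eta> n) (V m) (\<lambda>b t. indicator D (b, t)) P)
      \<and> (\<integral>\<omega>. indicator D (R m \<omega>) *\<^sub>R X n \<omega> \<partial>M)
       = (\<integral>p. observable (V n) (w n) (\<eta> n) (V m) (\<lambda>b t. indicator D (b, t)) P p \<partial>mu_pin (V n) (w n) (\<eta> n))"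
    if mn: "m \<le> n" and D: "D \<in> sets (N m)" for m n D
  proof -
    let ?H = "mu_pin (V n) (w n) (\<eta> n)" and ?b = "beta_theta (V n) (w n) (\<eta> n)"
    have bS: "?b (V m) \<in> ?H \<rightarrow>\<^sub>M N m" using bm[OF Vmono[OF mn]] by (simp add: N_def)
    note [measurable] = prm[OF mn] D
    have G: "(\<lambda>bt. indicator D (pr m bt) *\<^sub>R \<Psi> n bt) \<in> borel_measurable (N n)" by measurable
    have obs: "observable (V n) (w n) (\<eta> n) (V m) (\<lambda>b t. indicator D (b, t)) P p = indicator D (?b (V m) p) *\<^sub>R P (zeta (V n) (fst p) (snd p))" for p
      by (simp add: observable_def beta_theta_def indicator_def)
    have "(\<integral>\<omega>. indicator D (R m \<omega>) *\<^sub>R X n \<omega> \<partial>M) = (\<integral>\<omega>. indicator D (pr m (R n \<omega>)) *\<^sub>R \<Psi> n (R n \<omega>) \<partial>M)"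
      by (simp only: Xeq prR[OF mn, symmetric])
    also have "\<dots> = (\<integral>bt. indicator D (pr m bt) *\<^sub>R \<Psi> n bt \<partial>distr M (N n) (R n))"
      by (rule integral_distr[OF Rm G, symmetric])
    also have "\<dots> = (\<integral>p. indicator D (pr m (?b (V n) p)) *\<^sub>R \<Psi> n (?b (V n) p) \<partial>?H)"
      unfolding law by (rule integral_distr[OF bN G])
    also have "\<dots> = (\<integral>p. observable (V n) (w n) (\<eta> n) (V m) (\<lambda>b t. indicator D (b, t)) P p \<partial>?H)"
      by (rule Bochner_Integration.integral_cong[OF refl]) (unfold obs prb[OF mn], simp add: \<Psi>P mu_pin_def)
    finally have eq: "(\<integral>\<omega>. indicator D (R m \<omega>) *\<^sub>R X n \<omega> \<partial>M)
       = (\<integral>p. observable (V n) (w n) (\<eta> n) (V m) (\<lambda>b t. indicator D (b, t)) P p \<partial>?H)" .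
    have "integrable ?H (\<lambda>p. indicator (?b (V m) -` D \<inter> space ?H) p *\<^sub>R P (zeta (V n) (fst p) (snd p)))"
      by (rule integrable_mult_indicator[OF measurable_sets[OF bS D] Pint])
    then have "integrable ?H (observable (V n) (w n) (\<eta> n) (V m) (\<lambda>b t. indicator D (b, t)) P)"
      by (rule Bochner_Integration.integrable_cong[THEN iffD1, OF refl, rotated]) (unfold obs, simp add: indicator_def)
    with eq show ?thesis by blast
  qed
  have cond: "has_cond_exp M (F m) (X n) (X m)" if mn: "m \<le> n" for m n
    unfolding has_cond_exp_def
  proof (intro conjI ballI Xint Xm)
    fix A assume "A \<in> sets (F m)"
    then obtain D where D: "D \<in> sets (N m)" and A: "A = R m -` D \<inter> space M"
      unfolding F sets_vimage_algebra2[OF Rsp] by blast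
    have ind: "(\<integral>\<omega>\<in>A. X l \<omega> \<partial>M) = (\<integral>\<omega>. indicator D (R m \<omega>) *\<^sub>R X l \<omega> \<partial>M)" for l
      unfolding set_lebesgue_integral_def A
      by (rule Bochner_Integration.integral_cong[OF refl]) (simp add: indicator_def)
    let ?\<Phi> = "\<lambda>b t. indicator D (b, t) :: complex" and ?\<eta> = "wire_pin (V n) (V m) (w n) (\<eta> n)"
    have ww: "w n i l = w m i l" if "i \<in> V m" "l \<in> V m" for i l
    proof -
      have "i \<in> V n" "l \<in> V n" using that Vmono[OF mn] by auto
      then show ?thesis using that by (simp add: wW)
    qed
    have hm: "mu_pin (V m) (w n) ?\<eta> = mu_pin (V m) (w m) (\<eta> m)" by (rule mu_pin_model_cong(1)[OF ww \<eta>w[OF mn]])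
    have om: "observable (V m) (w n) ?\<eta> (V m) ?\<Phi> P = observable (V m) (w m) (\<eta> m) (V m) ?\<Phi> P"
      by (rule observable_cong[OF ww \<eta>w[OF mn] subset_refl])
    note Tn = transfer[OF mn D] and Tm = transfer[OF le_refl D]
    have "(\<integral>p. observable (V n) (w n) (\<eta> n) (V m) ?\<Phi> P p \<partial>mu_pin (V n) (w n) (\<eta> n))
      = (\<integral>p. observable (V m) (w n) ?\<eta> (V m) ?\<Phi> P p \<partial>mu_pin (V m) (w n) ?\<eta>)"
    proof (rule wiring_idD[OF wiring_id_subset[OF finV Vmono[OF mn]] pn pP])
      show "integrable (mu_pin (V n) (w n) (\<eta> n)) (observable (V n) (w n) (\<eta> n) (V m) ?\<Phi> P)" using Tn by blast
      show "integrable (mu_pin (V m) (w n) ?\<eta>) (observable (V m) (w n) ?\<eta> (V m) ?\<Phi> P)" unfolding hm om using Tm by blast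
    qed
    then show "(\<integral>\<omega>\<in>A. X n \<omega> \<partial>M) = (\<integral>\<omega>\<in>A. X m \<omega> \<partial>M)"
      unfolding ind hm om using Tn Tm by simp
  qed
  have mart: "martingale M F X"
    unfolding martingale_def using filt sub Xm Xint cond by blast
  then show ?thesis
    using martingale_bounded_linear[OF bounded_linear_Re mart] martingale_bounded_linear[OF bounded_linear_Im mart] by blast
qed

end
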